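(* Let $S_1,S_2\subset\mathbb{R}^3$ be round spheres of radii $r_1\geq r_2$ with centres separated by a distance $l$ in $\mathbb{R}^3$, and let $\mathcal{H}(S_1),\mathcal{H}(S_2)\subset\mathbb{L}(\mathbb{R}^3)$ be their tangent hypersurfaces. Then: (i) $\mathcal{H}(S_1)\cap\mathcal{H}(S_2)=\emptyset$ if and only if $l<r_1-r_2$; (ii) $\mathcal{H}(S_1)\cap\mathcal{H}(S_2)=S^1$ (a circle) if and only if $l=r_1-r_2$; (iii) $\mathcal{H}(S_1)\cap\mathcal{H}(S_2)=T^2$ (a torus) if and only if $r_1-r_2<l\leq r_1+r_2$; (iv) $\mathcal{H}(S_1)\cap\mathcal{H}(S_2)=T^2\coprod T^2$ (a disjoint union of two tori) if and only if $r_1+r_2<l$. If $l>r_1+r_2$, so that $S_1\cap S_2=\emptyset$, then the intersection tori $T^2$ are totally real and Lorentz.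
   Context: $\mathbb{L}(\mathbb{R}^3)$ is the space of oriented lines in $\mathbb{R}^3$, identified with $T\mathbb{S}^2$: with $\xi$ the standard holomorphic coordinate on $\mathbb{S}^2$ about the north pole, the tangent vector $\eta\,\partial_\xi+\bar\eta\,\partial_{\bar\xi}$ corresponds to the oriented line, parameterized by $r\in\mathbb{R}$, $$x^1+ix^2=\frac{2(\eta-\bar{\xi}^2\bar{\eta})}{(1+\xi\bar{\xi})^2}+\frac{2\xi}{1+\xi\bar{\xi}}r,\qquad x^3=-\frac{2(\xi\bar{\eta}+\bar{\xi}\eta)}{(1+\xi\bar{\xi})^2}+\frac{1-\xi\bar{\xi}}{1+\xi\bar{\xi}}r .$$ It carries the neutral (signature $(2,2)$) metric, invariant under the Euclidean group, $$\mathbb{G}=2(1+\xi\bar{\xi})^{-2}\,\mathrm{Im}\left(d\bar{\eta}\, d\xi+\frac{2\bar{\xi}\eta}{1+\xi\bar{\xi}}d\xi\, d\bar{\xi}\right)$$ and the complex structure $\mathbb{J}^+$ for which $(\xi,\eta)$ are holomorphic coordinates. The tangent hypersurface $\mathcal{H}(S)$ of a surface $S\subset\mathbb{R}^3$ is the set of oriented lines tangent to $S$. A surface in $\mathbb{L}(\mathbb{R}^3)$ is totally real if none of its tangent planes is $\mathbb{J}^+$-invariant (it has no complex points), and Lorentz if the metric induced on it by $\mathbb{G}$ is nondegenerate of signature $(1,1)$ at every point.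
   Formalization: Coincident spheres are excluded; in (iii), at l=r1+r2 the torus is only immersed (it pinches); for l>r1+r2 the tori are Lorentz exactly off the lines lying in a common tangent plane of both spheres; in the line formula, the square of conj(xi) is corrected to xi^2. *)

theory Defs
  imports "HOL-Analysis.Analysis"
begin

text \<open>
  Oriented lines in Euclidean 3-space are modelled by the tangent bundle of the unit sphere: the
  pair (u, v) with u a unit vector and v orthogonal to u stands for the line through v with
  direction u. The foot point v is the point of the line closest to the origin.
\<close>

definition oriented_lines :: "((real^3) \<times> (real^3)) set" where
  "oriented_lines = {(u, v). norm u = 1 \<and> u \<bullet> v = 0}"

definition points_of :: "(real^3) \<times> (real^3) \<Rightarrow> (real^3) set" where
  "points_of \<gamma> = {snd \<gamma> + r *\<^sub>R fst \<gamma> |r. True}"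

text \<open>
  \<open>north_param (\<xi>, \<eta>)\<close> is the oriented line determined by the tangent vector
  \<open>\<eta> \<partial>/\<partial>\<xi> + cnj \<eta> \<partial>/\<partial>(cnj \<xi>)\<close>. Its second component is the differential of \<open>line_dir\<close> at
  \<open>\<xi>\<close> applied to that vector, whence the term \<open>\<xi>\<^sup>2 * cnj \<eta>\<close>; with \<open>(cnj \<xi>)\<^sup>2 * cnj \<eta>\<close> in
  its place the result would not be orthogonal to \<open>line_dir \<xi>\<close>.
\<close>

definition line_dir :: "complex \<Rightarrow> real^3" where
  "line_dir \<xi> = vector
     [Re (2 * \<xi>) / (1 + (cmod \<xi>)\<^sup>2), Im (2 * \<xi>) / (1 + (cmod \<xi>)\<^sup>2),
      (1 - (cmod \<xi>)\<^sup>2) / (1 + (cmod \<xi>)\<^sup>2)]"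

definition line_foot :: "complex \<Rightarrow> complex \<Rightarrow> real^3" where
  "line_foot \<xi> \<eta> = vector
     [Re (2 * (\<eta> - \<xi>\<^sup>2 * cnj \<eta>)) / (1 + (cmod \<xi>)\<^sup>2)\<^sup>2,
      Im (2 * (\<eta> - \<xi>\<^sup>2 * cnj \<eta>)) / (1 + (cmod \<xi>)\<^sup>2)\<^sup>2,
      - Re (2 * (\<xi> * cnj \<eta> + cnj \<xi> * \<eta>)) / (1 + (cmod \<xi>)\<^sup>2)\<^sup>2]"

definition north_param :: "complex \<times> complex \<Rightarrow> (real^3) \<times> (real^3)" where
  "north_param = (\<lambda>(\<xi>, \<eta>). (line_dir \<xi>, line_foot \<xi> \<eta>))"

text \<open>
  The coordinates above miss the lines pointing to the south pole. These are covered by composing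
  with the rotation by \<open>\<pi>\<close> about the first axis. On the overlap the two coordinate systems are
  related by \<open>\<xi>' = 1 / \<xi>\<close>, \<open>\<eta>' = - \<eta> / \<xi>\<^sup>2\<close>; this change is holomorphic and preserves the
  metric below, which is invariant under Euclidean motions. So the complex structure and the
  metric are given by the same formulas in both.
\<close>

definition half_turn :: "real^3 \<Rightarrow> real^3" where
  "half_turn x = vector [x $ 1, - (x $ 2), - (x $ 3)]"

definition south_param :: "complex \<times> complex \<Rightarrow> (real^3) \<times> (real^3)" where
  "south_param p = (half_turn (fst (north_param p)), half_turn (snd (north_param p)))"

definition line_params :: "(complex \<times> complex \<Rightarrow> (real^3) \<times> (real^3)) set" where
  "line_params = {north_param, south_param}"

text \<open>
  The metric at \<open>(\<xi>, \<eta>)\<close> as a symmetric bilinear form on coordinate tangent vectors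
  \<open>(d\<xi>, d\<eta>)\<close>. Products of one-forms are symmetric products,
  \<open>\<alpha> \<beta> = (\<alpha> \<otimes> \<beta> + \<beta> \<otimes> \<alpha>) / 2\<close>, and this one half cancels the leading factor 2.
\<close>

definition neutral_metric ::
  "complex \<times> complex \<Rightarrow> complex \<times> complex \<Rightarrow> complex \<times> complex \<Rightarrow> real" where
  "neutral_metric p X Y =
     (case p of (\<xi>, \<eta>) \<Rightarrow> case X of (a, b) \<Rightarrow> case Y of (a', b') \<Rightarrow>
       1 / (1 + (cmod \<xi>)\<^sup>2)\<^sup>2 *
       Im ((cnj b * a' + cnj b' * a)
           + 2 * cnj \<xi> * \<eta> / complex_of_real (1 + (cmod \<xi>)\<^sup>2) * (a * cnj a' + a' * cnj a)))"

definition complex_structure :: "complex \<times> complex \<Rightarrow> complex \<times> complex" where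
  "complex_structure X = (\<i> * fst X, \<i> * snd X)"

text \<open>Velocities at x of curves in A; for an embedded submanifold this is the tangent space.\<close>

definition tangent_space :: "'a::real_normed_vector set \<Rightarrow> 'a \<Rightarrow> 'a set" where
  "tangent_space A x =
     {w. \<exists>c::real \<Rightarrow> 'a. range c \<subseteq> A \<and> c 0 = x \<and> (c has_vector_derivative w) (at 0)}"

definition tangent_hypersurface :: "(real^3) set \<Rightarrow> ((real^3) \<times> (real^3)) set" where
  "tangent_hypersurface S =
     {\<gamma> \<in> oriented_lines. \<exists>p \<in> S \<inter> points_of \<gamma>. fst \<gamma> \<in> tangent_space S p}"

text \<open>
  The oriented lines tangent to both surfaces along which the two affine tangent planes at the
  points of contact coincide. As both points of contact lie on the line, and the line lies in both
  planes, it suffices to compare the linear tangent planes.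
\<close>

definition bitangent_plane_lines :: "(real^3) set \<Rightarrow> (real^3) set \<Rightarrow> ((real^3) \<times> (real^3)) set" where
  "bitangent_plane_lines S S' =
     {\<gamma> \<in> oriented_lines. \<exists>p \<in> S \<inter> points_of \<gamma>. \<exists>q \<in> S' \<inter> points_of \<gamma>.
        fst \<gamma> \<in> tangent_space S p \<and> tangent_space S p = tangent_space S' q}"

text \<open>
  Tangent planes of a surface of oriented lines are taken in the coordinates \<open>(\<xi>, \<eta>)\<close>.
\<close>

definition totally_real_surface :: "((real^3) \<times> (real^3)) set \<Rightarrow> bool" where
  "totally_real_surface \<Sigma> \<longleftrightarrow>
     \<Sigma> \<subseteq> oriented_lines \<and>
     (\<forall>\<phi>\<in>line_params. \<forall>p. \<phi> p \<in> \<Sigma> \<longrightarrow>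
        complex_structure ` tangent_space (\<phi> -` \<Sigma>) p \<noteq> tangent_space (\<phi> -` \<Sigma>) p)"

definition signature_1_1_on :: "('a::real_vector \<Rightarrow> 'a \<Rightarrow> real) \<Rightarrow> 'a set \<Rightarrow> bool" where
  "signature_1_1_on g P \<longleftrightarrow>
     (\<exists>X Y. P = span {X, Y} \<and> g X X > 0 \<and> g Y Y < 0 \<and> g X Y = 0)"

definition lorentz_at :: "((real^3) \<times> (real^3)) set \<Rightarrow> (real^3) \<times> (real^3) \<Rightarrow> bool" where
  "lorentz_at \<Sigma> \<gamma> \<longleftrightarrow>
     (\<forall>\<phi>\<in>line_params. \<forall>p. \<phi> p = \<gamma> \<longrightarrow>
        signature_1_1_on (neutral_metric p) (tangent_space (\<phi> -` \<Sigma>) p))"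

definition lorentz_surface :: "((real^3) \<times> (real^3)) set \<Rightarrow> bool" where
  "lorentz_surface \<Sigma> \<longleftrightarrow> \<Sigma> \<subseteq> oriented_lines \<and> (\<forall>\<gamma>\<in>\<Sigma>. lorentz_at \<Sigma> \<gamma>)"

primrec C_k :: "nat \<Rightarrow> ('a::euclidean_space \<Rightarrow> 'b::real_normed_vector) \<Rightarrow> bool" where
  "C_k 0 f \<longleftrightarrow> continuous_on UNIV f"
| "C_k (Suc k) f \<longleftrightarrow>
     (\<exists>f'. (\<forall>x. (f has_derivative f' x) (at x)) \<and> (\<forall>v. C_k k (\<lambda>x. f' x v)))"

definition smooth_immersion :: "('a::euclidean_space \<Rightarrow> 'b::real_normed_vector) \<Rightarrow> bool" where
  "smooth_immersion f \<longleftrightarrow> (\<forall>k. C_k k f) \<and> (\<forall>x. inj (frechet_derivative f (at x)))"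

text \<open>
  The circle and the torus are taken as quotients of the line and the plane by the period
  lattices \<open>2\<pi>\<int>\<close> and \<open>2\<pi>\<int> \<times> 2\<pi>\<int>\<close>. By compactness an injective immersion of either is an
  embedding. Curves and surfaces of oriented lines are immersed in the ambient space
  \<open>(real^3) \<times> (real^3)\<close>, of which the space of oriented lines is a submanifold.
\<close>

definition embedded_circle :: "'b::real_normed_vector set \<Rightarrow> bool" where
  "embedded_circle X \<longleftrightarrow>
     (\<exists>f::real \<Rightarrow> 'b. smooth_immersion f \<and> (\<forall>t. f (t + 2 * pi) = f t) \<and>
        inj_on f {0..<2 * pi} \<and> range f = X)"

definition torus_immersion :: "(real \<times> real \<Rightarrow> 'b::real_normed_vector) \<Rightarrow> bool" where
  "torus_immersion f \<longleftrightarrow>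
     smooth_immersion f \<and> (\<forall>s t. f (s + 2 * pi, t) = f (s, t) \<and> f (s, t + 2 * pi) = f (s, t))"

definition immersed_torus :: "'b::real_normed_vector set \<Rightarrow> bool" where
  "immersed_torus X \<longleftrightarrow> (\<exists>f. torus_immersion f \<and> range f = X)"

definition embedded_torus :: "'b::real_normed_vector set \<Rightarrow> bool" where
  "embedded_torus X \<longleftrightarrow>
     (\<exists>f. torus_immersion f \<and> inj_on f ({0..<2 * pi} \<times> {0..<2 * pi}) \<and> range f = X)"

definition disjoint_embedded_tori :: "'b::real_normed_vector set \<Rightarrow> bool" where
  "disjoint_embedded_tori X \<longleftrightarrow>
     (\<exists>T T'. embedded_torus T \<and> embedded_torus T' \<and> T \<inter> T' = {} \<and> X = T \<union> T')"

end

theory Submission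
  imports Defs
begin

text \<open>
  A line with direction \<open>u\<close> is tangent to a sphere if the perpendicular from the centre to the line has
  length equal to the radius. Let \<open>N1\<close> and \<open>N2\<close> be these perpendiculars for a common tangent of the
  two spheres. Both are orthogonal to \<open>u\<close>, and \<open>c2 - c1 = N1 - N2 + h u\<close>, where \<open>h\<close> is the signed
  distance of the points of contact. With \<open>\<theta>\<close> the oriented angle from \<open>N1\<close> to \<open>N2\<close>, Pythagoras gives
  \<open>h\<^sup>2 = l\<^sup>2 - r1\<^sup>2 - r2\<^sup>2 + 2 r1 r2 cos \<theta>\<close>. Conversely, a solution \<open>(h, \<theta>)\<close> prescribes the
  coordinates of the axis \<open>c2 - c1\<close> in the orthonormal frame of \<open>u\<close>, \<open>N1 / r1\<close> and their cross product,
  and so determines the line up to a rotation about the axis (\<open>line_at_surj\<close>, \<open>line_at_inj\<close>). This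
  rotation acts freely, and a global smooth choice of frame exists, so the intersection is the
  product of a circle and the plane curve of solutions \<open>(h, \<theta>)\<close>.
  
  That curve is empty for \<open>l < r1 - r2\<close>, the single point \<open>h = \<theta> = 0\<close> for \<open>l = r1 - r2\<close>, a simple closed
  curve for \<open>r1 - r2 < l < r1 + r2\<close>, a figure eight for \<open>l = r1 + r2\<close>, and for \<open>l > r1 + r2\<close> it is the
  union of two graphs over the circle, one for each sign of \<open>h\<close>. This gives a circle, an embedded
  torus, an immersed torus and two disjoint tori (\<open>circle_of_common_tangents\<close>, \<open>crossing_spheres\<close>,
  \<open>touching_spheres\<close>, \<open>separated_spheres\<close>). The types exclude each other: two disjoint
  compact tori are not connected, and an immersed surface does not fit into a smooth curve for
  reasons of measure (\<open>immersed_surface_not_in_curve\<close>).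
  
  For the last part, let \<open>(u', v')\<close> be a tangent vector of the intersection and
  \<open>q\<^sub>i = v' + (c\<^sub>i \<bullet> u) u'\<close>. Tangency to the spheres means that \<open>q\<^sub>i\<close> is orthogonal to \<open>N\<^sub>i\<close>, and
  \<open>q\<^sub>2 - q\<^sub>1 = h u'\<close>. The complex structure rotates \<open>u'\<close> and, up to multiples of \<open>u\<close>, also \<open>v'\<close> by the
  right angle \<open>u \<times> _\<close>, and the metric is \<open>- det (u, u', v') / 2\<close>; the computation in coordinates is
  done once, in \<open>line_chart\<close>. If the tangent plane were complex, then \<open>q\<^sub>i\<close> would be parallel to
  \<open>u\<close>, which forces \<open>u' = 0\<close> because \<open>h\<close> is nonzero for separated spheres. Finally, the components of
  \<open>q\<^sub>i\<close> along \<open>u \<times> N\<^sub>i\<close> are linear coordinates on the tangent plane, and the metric is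
  their product times a constant multiple of \<open>sin \<theta> / h\<close> (\<open>det_variation\<close>). It is therefore Lorentz where
  \<open>sin \<theta>\<close> is nonzero and vanishes where the contact normals are parallel, that is, along the lines with
  a common tangent plane.
\<close>

section \<open>Smooth maps\<close>

lemma C_k_const: "C_k k (\<lambda>x. c)"
proof (induction k arbitrary: c)
  case (Suc k)
  have "\<forall>x. ((\<lambda>x. c) has_derivative (\<lambda>v. 0)) (at x)" by simp
  with Suc show ?case unfolding C_k.simps by (intro exI[of _ "\<lambda>x v. 0"]) auto
qed simp

lemma C_k_SucI:
  "(\<And>x. (f has_derivative f' x) (at x)) \<Longrightarrow> (\<And>v. C_k k (\<lambda>x. f' x v)) \<Longrightarrow> C_k (Suc k) f"
  by auto

lemma C_k_bounded_linear:
  assumes "bounded_linear L" shows "C_k k L"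
proof (cases k)
  case 0
  with assms show ?thesis by (simp add: linear_continuous_on)
next
  case (Suc n)
  with bounded_linear_imp_has_derivative[OF assms] show ?thesis
    by (auto intro!: exI[of _ "\<lambda>x. L"] simp: C_k_const)
qed

lemma C_k_SucD: "C_k (Suc k) f \<Longrightarrow> C_k k f"
proof (induction k arbitrary: f)
  case 0
  then obtain f' where "\<forall>x. (f has_derivative f' x) (at x)" by auto
  then show ?case by (auto intro!: continuous_at_imp_continuous_on has_derivative_continuous)
next
  case (Suc k)
  then show ?case by (auto simp: C_k.simps(2)[of _ f])
qed

lemma C_k_add:
  assumes "C_k k f" "C_k k g" shows "C_k k (\<lambda>x. f x + g x)"
  using assms
proof (induction k arbitrary: f g)
  case 0
  then show ?case by (auto intro: continuous_intros)
next
  case (Suc k)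
  from Suc.prems obtain f' g' where
    f: "\<And>x. (f has_derivative f' x) (at x)" "\<And>v. C_k k (\<lambda>x. f' x v)" and
    g: "\<And>x. (g has_derivative g' x) (at x)" "\<And>v. C_k k (\<lambda>x. g' x v)" by auto
  have "((\<lambda>x. f x + g x) has_derivative (\<lambda>v. f' x v + g' x v)) (at x)" for x
    by (intro derivative_intros f g)
  then show ?case by (rule C_k_SucI) (rule Suc.IH[OF f(2) g(2)])
qed

lemma (in bounded_bilinear) C_k_prod:
  assumes "C_k k f" "C_k k g" shows "C_k k (\<lambda>x. prod (f x) (g x))"
  using assms
proof (induction k arbitrary: f g)
  case 0
  then show ?case by (auto intro: continuous_on)
next
  case (Suc k)
  from Suc.prems obtain f' g' where
    f: "\<And>x. (f has_derivative f' x) (at x)" "\<And>v. C_k k (\<lambda>x. f' x v)" and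
    g: "\<And>x. (g has_derivative g' x) (at x)" "\<And>v. C_k k (\<lambda>x. g' x v)" by auto
  have "((\<lambda>x. prod (f x) (g x)) has_derivative (\<lambda>v. prod (f x) (g' x v) + prod (f' x v) (g x))) (at x)" for x
    by (intro FDERIV f g)
  moreover have "C_k k (\<lambda>x. prod (f x) (g' x v) + prod (f' x v) (g x))" for v
    by (intro C_k_add Suc.IH f g C_k_SucD[OF Suc.prems(1)] C_k_SucD[OF Suc.prems(2)])
  ultimately show ?case
    unfolding C_k.simps
    by (intro exI[of _ "\<lambda>x v. prod (f x) (g' x v) + prod (f' x v) (g x)"]) auto
qed

lemmas C_k_mult = bounded_bilinear.C_k_prod[OF bounded_bilinear_mult]
lemmas C_k_scaleR = bounded_bilinear.C_k_prod[OF bounded_bilinear_scaleR]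
lemmas C_k_inner = bounded_bilinear.C_k_prod[OF bounded_bilinear_inner]

lemma C_k_minus: "C_k k f \<Longrightarrow> C_k k (\<lambda>x. - f x)"
  using C_k_scaleR[OF C_k_const[of k "-1"], of f] by simp

lemma C_k_diff: "C_k k f \<Longrightarrow> C_k k g \<Longrightarrow> C_k k (\<lambda>x. f x - g x)"
  using C_k_add[of k f "\<lambda>x. - g x"] C_k_minus[of k g] by simp

lemma C_k_power: "C_k k f \<Longrightarrow> C_k k (\<lambda>x. f x ^ n :: real)"
  by (induction n) (auto intro: C_k_const C_k_mult)

lemma C_k_compose_bounded_linear:
  assumes "bounded_linear L" "C_k k f" shows "C_k k (\<lambda>x. L (f x))"
  using assms(2)
proof (induction k arbitrary: f)
  case 0
  then show ?case by (auto intro: continuous_on_compose2[OF linear_continuous_on[OF assms(1)]])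
next
  case (Suc k)
  from Suc.prems obtain f' where
    f: "\<And>x. (f has_derivative f' x) (at x)" "\<And>v. C_k k (\<lambda>x. f' x v)" by auto
  have "((\<lambda>x. L (f x)) has_derivative (\<lambda>v. L (f' x v))) (at x)" for x
    by (rule bounded_linear.has_derivative[OF assms(1) f(1)])
  then show ?case by (rule C_k_SucI) (rule Suc.IH[OF f(2)])
qed

lemma C_k_compose_linear_right:
  assumes "bounded_linear L" "C_k k f" shows "C_k k (\<lambda>x. f (L x))"
  using assms(2)
proof (induction k arbitrary: f)
  case 0
  then show ?case using continuous_on_compose2[of UNIV f UNIV L] linear_continuous_on[OF assms(1)] by simp
next
  case (Suc k)
  from Suc.prems obtain f' where
    f: "\<And>x. (f has_derivative f' x) (at x)" "\<And>v. C_k k (\<lambda>x. f' x v)" by auto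
  have "((\<lambda>x. f (L x)) has_derivative (\<lambda>v. f' (L x) (L v))) (at x)" for x
    using diff_chain_at[OF bounded_linear_imp_has_derivative[OF assms(1)] f(1)] by (simp add: o_def)
  then show ?case by (rule C_k_SucI) (rule Suc.IH[OF f(2)])
qed

lemma C_k_Pair:
  assumes "C_k k f" "C_k k g" shows "C_k k (\<lambda>x. (f x, g x))"
proof -
  have "bounded_linear (\<lambda>y. (y, 0))" "bounded_linear (\<lambda>y. (0, y))"
    by (intro bounded_linear_Pair bounded_linear_ident bounded_linear_zero)+
  from C_k_add[OF C_k_compose_bounded_linear[OF this(1) assms(1)]
      C_k_compose_bounded_linear[OF this(2) assms(2)]]
  show ?thesis by simp
qed

text \<open>
  The derivatives of the next functions are built from the functions themselves and the derivative
  of \<open>f\<close>, so that induction on the order of differentiability closes up. Sine and cosine need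
  each other and are treated together.
\<close>
lemma C_k_inverse:
  fixes f :: "_ \<Rightarrow> real"
  assumes "C_k k f" "\<And>x. f x \<noteq> 0" shows "C_k k (\<lambda>x. inverse (f x))"
  using assms
proof (induction k arbitrary: f)
  case 0
  then show ?case by (auto intro: continuous_intros)
next
  case (Suc k)
  from Suc.prems obtain f' where
    f: "\<And>x. (f has_derivative f' x) (at x)" "\<And>v. C_k k (\<lambda>x. f' x v)" by auto
  have "((\<lambda>x. inverse (f x)) has_derivative (\<lambda>v. - (inverse (f x) * f' x v * inverse (f x)))) (at x)" for x
    using Suc.prems f by (auto intro!: derivative_eq_intros)
  moreover have "C_k k (\<lambda>x. - (inverse (f x) * f' x v * inverse (f x)))" for v
    by (intro C_k_minus C_k_mult f Suc.IH C_k_SucD[OF Suc.prems(1)] Suc.prems(2))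
  ultimately show ?case
    unfolding C_k.simps
    by (intro exI[of _ "\<lambda>x v. - (inverse (f x) * f' x v * inverse (f x))"]) auto
qed

lemma C_k_divide:
  fixes f g :: "_ \<Rightarrow> real"
  assumes "C_k k f" "C_k k g" "\<And>x. g x \<noteq> 0" shows "C_k k (\<lambda>x. f x / g x)"
  unfolding divide_inverse by (intro C_k_mult C_k_inverse assms)

lemma C_k_sqrt:
  assumes "C_k k f" "\<And>x. 0 < f x" shows "C_k k (\<lambda>x. sqrt (f x))"
  using assms
proof (induction k arbitrary: f)
  case 0
  then show ?case by (auto intro: continuous_intros)
next
  case (Suc k)
  from Suc.prems obtain f' where
    f: "\<And>x. (f has_derivative f' x) (at x)" "\<And>v. C_k k (\<lambda>x. f' x v)" by auto
  have "sqrt (f x) \<noteq> 0" for x using Suc.prems(2)[of x] by auto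
  have "((\<lambda>x. sqrt (f x)) has_derivative (\<lambda>v. f' x v * inverse (2 * sqrt (f x)))) (at x)" for x
    using Suc.prems(2)[of x] f by (auto intro!: derivative_eq_intros simp: divide_simps)
  moreover have "C_k k (\<lambda>x. f' x v * inverse (2 * sqrt (f x)))" for v
    using Suc.prems(2) \<open>\<And>x. sqrt (f x) \<noteq> 0\<close>
    by (intro C_k_mult C_k_inverse f Suc.IH C_k_SucD[OF Suc.prems(1)] C_k_const) auto
  ultimately show ?case
    unfolding C_k.simps
    by (intro exI[of _ "\<lambda>x v. f' x v * inverse (2 * sqrt (f x))"]) auto
qed

lemma C_k_sin_cos:
  fixes f :: "_ \<Rightarrow> real"
  assumes "C_k k f" shows "C_k k (\<lambda>x. sin (f x)) \<and> C_k k (\<lambda>x. cos (f x))"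
  using assms
proof (induction k arbitrary: f)
  case 0
  then show ?case by (auto intro: continuous_intros)
next
  case (Suc k)
  from Suc.prems obtain f' where
    f: "\<And>x. (f has_derivative f' x) (at x)" "\<And>v. C_k k (\<lambda>x. f' x v)" by auto
  note IH = Suc.IH[OF C_k_SucD[OF Suc.prems(1)]]
  have "((\<lambda>x. sin (f x)) has_derivative (\<lambda>v. f' x v * cos (f x))) (at x)"
       "((\<lambda>x. cos (f x)) has_derivative (\<lambda>v. f' x v * (- sin (f x)))) (at x)" for x
    using f by (auto intro!: derivative_eq_intros)
  moreover have "C_k k (\<lambda>x. f' x v * cos (f x))" "C_k k (\<lambda>x. f' x v * (- sin (f x)))" for v
    using IH by (auto intro!: C_k_mult C_k_minus f)
  ultimately show ?case
    unfolding C_k.simps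
    by (intro conjI exI[of _ "\<lambda>x v. f' x v * cos (f x)"] exI[of _ "\<lambda>x v. f' x v * (- sin (f x))"]) auto
qed

lemmas C_k_intros = C_k_const C_k_add C_k_diff C_k_minus C_k_mult C_k_scaleR C_k_inner C_k_power
  C_k_Pair C_k_divide C_k_sqrt C_k_sin_cos[THEN conjunct1] C_k_sin_cos[THEN conjunct2]
  C_k_bounded_linear[OF bounded_linear_fst] C_k_bounded_linear[OF bounded_linear_snd]
  C_k_bounded_linear[OF bounded_linear_ident]

lemma smooth_immersionD:
  assumes "smooth_immersion f"
  shows "(f has_derivative frechet_derivative f (at x)) (at x)"
    and "inj (frechet_derivative f (at x))"
    and "continuous_on A f"
proof -
  from assms have "C_k (Suc 0) f" and inj: "\<forall>x. inj (frechet_derivative f (at x))"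
    unfolding smooth_immersion_def by blast+
  then obtain f' where f': "\<And>x. (f has_derivative f' x) (at x)" by auto
  then show "(f has_derivative frechet_derivative f (at x)) (at x)"
    using frechet_derivative_works differentiable_def by blast
  show "inj (frechet_derivative f (at x))" using inj by blast
  show "continuous_on A f"
    using f' by (auto intro!: continuous_at_imp_continuous_on has_derivative_continuous)
qed

text \<open>
  An immersion is recognised by the velocities of its restrictions to straight lines, so that in
  applications a chain-rule argument along one line replaces the computation of a Jacobian.
\<close>
lemma smooth_immersionI:
  assumes C_k: "\<And>k. C_k k f"
    and immersed: "\<And>x h. ((\<lambda>t::real. f (x + t *\<^sub>R h)) has_vector_derivative 0) (at 0) \<Longrightarrow> h = 0"
  shows "smooth_immersion f"
  unfolding smooth_immersion_def
proof (intro conjI allI)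
  show "C_k k f" for k by (rule C_k)
  fix x
  from C_k[of "Suc 0"] obtain f' where "\<And>x. (f has_derivative f' x) (at x)" by auto
  then have D: "(f has_derivative frechet_derivative f (at x)) (at x)"
    using frechet_derivative_works differentiable_def by blast
  then interpret L: bounded_linear "frechet_derivative f (at x)"
    by (rule has_derivative_bounded_linear)
  show "inj (frechet_derivative f (at x))"
  proof (rule injI)
    fix a b assume eq: "frechet_derivative f (at x) a = frechet_derivative f (at x) b"
    have "((\<lambda>t::real. x + t *\<^sub>R (a - b)) has_derivative (\<lambda>t. t *\<^sub>R (a - b))) (at 0)"
      by (auto intro!: derivative_eq_intros)
    from diff_chain_at[OF this, of f] D
    have "((\<lambda>t::real. f (x + t *\<^sub>R (a - b))) has_derivative
        (\<lambda>t. frechet_derivative f (at x) (t *\<^sub>R (a - b)))) (at 0)"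
      by (simp add: o_def)
    then have "((\<lambda>t::real. f (x + t *\<^sub>R (a - b))) has_vector_derivative 0) (at 0)"
      unfolding has_vector_derivative_def using eq by (simp add: L.scaleR L.diff)
    from immersed[OF this] show "a = b" by simp
  qed
qed

lemma has_vector_derivative_chain_zero:
  assumes "F differentiable (at (g t))" "(g has_vector_derivative 0) (at t)"
  shows "((\<lambda>t. F (g t)) has_vector_derivative 0) (at t)"
proof -
  obtain F' where F': "(F has_derivative F') (at (g t))" using assms(1) by (auto simp: differentiable_def)
  have "linear F'" using F' by (rule has_derivative_linear)
  with vector_derivative_diff_chain_within[of g 0 t UNIV F F'] F' assms(2) linear_0[of F']
  show ?thesis by (simp add: o_def has_derivative_at_withinI)
qed

text \<open>
  A linear left inverse of the derivative at one point flattens the surface onto the plane; its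
  image there has interior points by the open mapping theorem, while the image of the curve is
  negligible.
\<close>
lemma immersed_surface_not_in_curve:
  fixes f :: "real \<times> real \<Rightarrow> 'b::euclidean_space" and g :: "real \<Rightarrow> 'b"
  assumes f: "smooth_immersion f" and g: "smooth_immersion g"
  shows "\<not> range f \<subseteq> range g"
proof
  assume sub: "range f \<subseteq> range g"
  let ?f' = "frechet_derivative f (at 0)"
  have D: "(f has_derivative ?f') (at 0)" by (rule smooth_immersionD[OF f])
  have lin: "linear ?f'" using D by (rule has_derivative_linear)
  obtain L where L: "linear L" "L \<circ> ?f' = id"
    using linear_injective_left_inverse[OF lin smooth_immersionD(2)[OF f]] by blast
  have bL: "bounded_linear L" by (rule linear_conv_bounded_linear[THEN iffD1, OF L(1)])
  have "((L \<circ> f) has_derivative (L \<circ> ?f')) (at 0)"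
    by (intro diff_chain_at D bounded_linear_imp_has_derivative bL)
  then have "(L \<circ> f) 0 \<in> interior ((L \<circ> f) ` UNIV)"
    unfolding L(2)
    by (intro sussmann_open_mapping[where S = UNIV and f' = id and g' = id])
      (auto simp: L(2) bounded_linear_ident[folded id_def] simp del: o_apply intro!: continuous_on_compose smooth_immersionD(3)[OF f] linear_continuous_on[OF bL])
  moreover have "negligible ((L \<circ> g) ` UNIV)"
  proof (rule negligible_differentiable_image_lowdim)
    show "(L \<circ> g) differentiable_on UNIV"
      unfolding differentiable_on_def differentiable_def
      using diff_chain_at[OF smooth_immersionD(1)[OF g] bounded_linear_imp_has_derivative[OF bL]] by auto
  qed simp
  moreover have "interior ((L \<circ> f) ` UNIV) \<subseteq> (L \<circ> g) ` UNIV"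
    using sub interior_subset[of "(L \<circ> f) ` UNIV"] unfolding image_comp[symmetric] by blast
  ultimately show False
    using open_not_negligible[OF open_interior] negligible_subset by blast
qed

section \<open>Lines tangent to spheres\<close>

unbundle cross3_syntax

text \<open>The vector from \<open>c\<close> to the point of the line closest to \<open>c\<close>.\<close>
definition offset :: "real^3 \<Rightarrow> (real^3) \<times> (real^3) \<Rightarrow> real^3" where
  "offset c \<gamma> = snd \<gamma> - c + (c \<bullet> fst \<gamma>) *\<^sub>R fst \<gamma>"

lemma oriented_linesD:
  assumes "\<gamma> \<in> oriented_lines"
  shows "fst \<gamma> \<bullet> fst \<gamma> = 1" "fst \<gamma> \<bullet> snd \<gamma> = 0" "snd \<gamma> \<bullet> fst \<gamma> = 0"
  using assms unfolding oriented_lines_def by (auto simp: norm_eq_1 inner_commute)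

lemma offset_orthogonal:
  assumes "\<gamma> \<in> oriented_lines"
  shows "offset c \<gamma> \<bullet> fst \<gamma> = 0"
  using oriented_linesD[OF assms] by (simp add: offset_def inner_simps)

lemma offset_diff:
  "offset c \<gamma> - offset c' \<gamma> = (c' - c) - ((c' - c) \<bullet> fst \<gamma>) *\<^sub>R fst \<gamma>"
  by (simp add: offset_def inner_simps algebra_simps)

lemma tangent_space_sphere:
  fixes c :: "real^3"
  assumes "0 < r" and p: "p \<in> sphere c r"
  shows "tangent_space (sphere c r) p = {w. w \<bullet> (p - c) = 0}"
proof (intro set_eqI iffI)
  fix w assume "w \<in> tangent_space (sphere c r) p"
  then obtain g where g: "range g \<subseteq> sphere c r" "g 0 = p" "(g has_vector_derivative w) (at (0::real))"
    unfolding tangent_space_def by blast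
  have "((\<lambda>t. (g t - c) \<bullet> (g t - c)) has_derivative (\<lambda>t. (g 0 - c) \<bullet> (t *\<^sub>R w) + (t *\<^sub>R w) \<bullet> (g 0 - c))) (at 0)"
    using g(3) unfolding has_vector_derivative_def by (auto intro!: derivative_eq_intros)
  moreover have "(g t - c) \<bullet> (g t - c) = r\<^sup>2" for t
  proof -
    have "g t \<in> sphere c r" using g(1) by blast
    then have "norm (g t - c) = r" by (simp add: dist_norm norm_minus_commute)
    then show ?thesis by (simp add: power2_norm_eq_inner[symmetric])
  qed
  then have "(\<lambda>t. (g t - c) \<bullet> (g t - c)) = (\<lambda>t. r\<^sup>2)" by blast
  ultimately have "((\<lambda>t. r\<^sup>2) has_derivative (\<lambda>t. (g 0 - c) \<bullet> (t *\<^sub>R w) + (t *\<^sub>R w) \<bullet> (g 0 - c))) (at 0)"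
    by simp
  from has_derivative_unique[OF this has_derivative_const]
  have "(\<lambda>t. (g 0 - c) \<bullet> (t *\<^sub>R w) + (t *\<^sub>R w) \<bullet> (g 0 - c)) = (\<lambda>t. 0)" .
  from fun_cong[OF this, of 1] show "w \<in> {w. w \<bullet> (p - c) = 0}"
    using g(2) by (simp add: inner_commute)
next
  fix w assume "w \<in> {w. w \<bullet> (p - c) = 0}"
  then have w: "w \<bullet> (p - c) = 0" "(p - c) \<bullet> w = 0" by (auto simp: inner_commute)
  define k where "k = (w \<bullet> w) / r\<^sup>2"
  have "0 \<le> k" by (simp add: k_def)
  have pos: "0 < 1 + k * t\<^sup>2" for t :: real
    using \<open>0 \<le> k\<close> by (metis add_pos_nonneg mult_nonneg_nonneg zero_le_power2 zero_less_one)
  \<comment> \<open>The line through \<open>p\<close> in direction \<open>w\<close>, projected radially to the sphere.\<close>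
  define g where "g = (\<lambda>t::real. c + (1 / sqrt (1 + k * t\<^sup>2)) *\<^sub>R (p - c + t *\<^sub>R w))"
  have pp: "(p - c) \<bullet> (p - c) = r\<^sup>2"
    using p by (auto simp: dist_norm norm_minus_commute power2_norm_eq_inner[symmetric])
  have "g t \<in> sphere c r" for t
  proof -
    have "(p - c + t *\<^sub>R w) \<bullet> (p - c + t *\<^sub>R w) = r\<^sup>2 + t\<^sup>2 * (w \<bullet> w)"
      unfolding inner_add_left inner_add_right using w pp by (simp add: power2_eq_square)
    also have "\<dots> = r\<^sup>2 * (1 + k * t\<^sup>2)" using \<open>0 < r\<close> by (simp add: k_def field_simps)
    finally have "(norm (g t - c))\<^sup>2 = r\<^sup>2"
      unfolding power2_norm_eq_inner g_def using pos[of t]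
      by (simp add: power2_eq_square[symmetric] power_divide)
    then show ?thesis using \<open>0 < r\<close>
      by (simp add: dist_norm norm_minus_commute)
  qed
  moreover have "(g has_vector_derivative w) (at 0)"
    unfolding has_vector_derivative_def g_def by (auto intro!: derivative_eq_intros)
  moreover have "g 0 = p" by (simp add: g_def)
  ultimately show "w \<in> tangent_space (sphere c r) p"
    unfolding tangent_space_def by (intro CollectI exI[of _ g]) auto
qed

text \<open>
  The tangent plane is orthogonal to the radius, so the point of contact is the foot of the
  perpendicular from the centre.
\<close>
lemma contact_point_iff:
  assumes "\<gamma> \<in> oriented_lines" "0 < r"
  shows "p \<in> sphere c r \<inter> points_of \<gamma> \<and> fst \<gamma> \<in> tangent_space (sphere c r) p
    \<longleftrightarrow> p = c + offset c \<gamma> \<and> norm (offset c \<gamma>) = r" (is "?L \<longleftrightarrow> ?R")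
proof
  assume L: ?L
  then obtain s where s: "p = snd \<gamma> + s *\<^sub>R fst \<gamma>" unfolding points_of_def by auto
  from L have "fst \<gamma> \<bullet> (p - c) = 0" using tangent_space_sphere[OF assms(2)] by auto
  then have "s = c \<bullet> fst \<gamma>" using oriented_linesD[OF assms(1)] by (simp add: s inner_simps inner_commute)
  then have "p - c = offset c \<gamma>" by (simp add: s offset_def)
  with L show ?R by (auto simp: dist_norm norm_minus_commute algebra_simps)
next
  assume R: ?R
  then have S: "p \<in> sphere c r" by (simp add: dist_norm)
  moreover have "p \<in> points_of \<gamma>" using R unfolding points_of_def offset_def by auto
  moreover have "fst \<gamma> \<bullet> (p - c) = 0" using R offset_orthogonal[OF assms(1)] by (simp add: inner_commute)
  ultimately show ?L using tangent_space_sphere[OF assms(2)] by auto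
qed

lemma tangent_hypersurface_sphere:
  assumes "0 < r"
  shows "tangent_hypersurface (sphere c r) = {\<gamma> \<in> oriented_lines. norm (offset c \<gamma>) = r}"
  unfolding tangent_hypersurface_def Bex_def conj_assoc[symmetric]
  by (rule Collect_cong) (use contact_point_iff[OF _ assms] in \<open>auto simp del: mem_sphere\<close>)

section \<open>Common tangent lines of two spheres\<close>

locale two_spheres =
  fixes c1 c2 :: "real^3" and r1 r2 :: real
  assumes r2_pos: "0 < r2" and r2_le: "r2 \<le> r1"
begin

definition common_tangents :: "((real^3) \<times> (real^3)) set" where
  "common_tangents = {\<gamma> \<in> oriented_lines. norm (offset c1 \<gamma>) = r1 \<and> norm (offset c2 \<gamma>) = r2}"

lemma common_tangents_eq:
  "tangent_hypersurface (sphere c1 r1) \<inter> tangent_hypersurface (sphere c2 r2) = common_tangents"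
  using r2_pos r2_le tangent_hypersurface_sphere[of r1 c1] tangent_hypersurface_sphere[of r2 c2]
  by (auto simp: common_tangents_def)

text \<open>
  Up to rotation about the axis through the centres, a common tangent is determined by three
  numbers: the signed distance \<open>height\<close> between the two points of contact, and the cosine and the
  sine of the oriented angle between the two contact normals.
\<close>
definition height :: "(real^3) \<times> (real^3) \<Rightarrow> real" where
  "height \<gamma> = (c2 - c1) \<bullet> fst \<gamma>"

definition cosine :: "(real^3) \<times> (real^3) \<Rightarrow> real" where
  "cosine \<gamma> = (offset c1 \<gamma> \<bullet> offset c2 \<gamma>) / (r1 * r2)"

definition sine :: "(real^3) \<times> (real^3) \<Rightarrow> real" where
  "sine \<gamma> = (fst \<gamma> \<bullet> (offset c1 \<gamma> \<times> offset c2 \<gamma>)) / (r1 * r2)"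

abbreviation separation :: real where "separation \<equiv> dist c1 c2"

lemma r1_pos: "0 < r1" using r2_pos r2_le by simp

lemma separation_sq: "(c2 - c1) \<bullet> (c2 - c1) = separation\<^sup>2"
  by (metis dist_commute dist_norm power2_norm_eq_inner)

lemma common_tangentsD:
  assumes "\<gamma> \<in> common_tangents"
  shows "\<gamma> \<in> oriented_lines"
    and "fst \<gamma> \<bullet> fst \<gamma> = 1"
    and "offset c1 \<gamma> \<bullet> offset c1 \<gamma> = r1\<^sup>2" and "offset c2 \<gamma> \<bullet> offset c2 \<gamma> = r2\<^sup>2"
    and "offset c1 \<gamma> \<bullet> fst \<gamma> = 0" and "offset c2 \<gamma> \<bullet> fst \<gamma> = 0"
    and "offset c1 \<gamma> \<bullet> offset c2 \<gamma> = r1 * r2 * cosine \<gamma>"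
    and "c2 - c1 = offset c1 \<gamma> - offset c2 \<gamma> + height \<gamma> *\<^sub>R fst \<gamma>"
proof -
  show \<gamma>: "\<gamma> \<in> oriented_lines" using assms by (simp add: common_tangents_def)
  show "fst \<gamma> \<bullet> fst \<gamma> = 1" "offset c1 \<gamma> \<bullet> fst \<gamma> = 0" "offset c2 \<gamma> \<bullet> fst \<gamma> = 0"
    using oriented_linesD[OF \<gamma>] offset_orthogonal[OF \<gamma>] by auto
  show "offset c1 \<gamma> \<bullet> offset c1 \<gamma> = r1\<^sup>2" "offset c2 \<gamma> \<bullet> offset c2 \<gamma> = r2\<^sup>2"
    using assms by (auto simp: common_tangents_def power2_norm_eq_inner[symmetric])
  show "offset c1 \<gamma> \<bullet> offset c2 \<gamma> = r1 * r2 * cosine \<gamma>"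
    using r1_pos r2_pos by (simp add: cosine_def)
  show "c2 - c1 = offset c1 \<gamma> - offset c2 \<gamma> + height \<gamma> *\<^sub>R fst \<gamma>"
    by (simp add: offset_diff[of c1 \<gamma> c2] height_def)
qed

text \<open>
  The theorem of Pythagoras for \<open>c2 - c1\<close>, written as the sum of the difference of the contact
  normals and an orthogonal multiple of the direction of the line.
\<close>
lemma height_sq:
  assumes "\<gamma> \<in> common_tangents"
  shows "(height \<gamma>)\<^sup>2 = separation\<^sup>2 - r1\<^sup>2 - r2\<^sup>2 + 2 * r1 * r2 * cosine \<gamma>"
proof -
  note D = common_tangentsD[OF assms]
  have "separation\<^sup>2 = (c2 - c1) \<bullet> (offset c1 \<gamma> - offset c2 \<gamma> + height \<gamma> *\<^sub>R fst \<gamma>)"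
    using separation_sq D(8) by metis
  also have "\<dots> = (offset c1 \<gamma> - offset c2 \<gamma> + height \<gamma> *\<^sub>R fst \<gamma>) \<bullet> (offset c1 \<gamma> - offset c2 \<gamma> + height \<gamma> *\<^sub>R fst \<gamma>)"
    using D(8) by metis
  also have "\<dots> = r1\<^sup>2 + r2\<^sup>2 - 2 * r1 * r2 * cosine \<gamma> + (height \<gamma>)\<^sup>2"
    using D(2-7) D(5,6)[unfolded inner_commute[of _ "fst \<gamma>"]]
    by (simp add: inner_add_left inner_add_right inner_diff_left inner_diff_right inner_commute power2_eq_square)
  finally show ?thesis by simp
qed

lemma cosine_sine:
  assumes "\<gamma> \<in> common_tangents"
  shows "(cosine \<gamma>)\<^sup>2 + (sine \<gamma>)\<^sup>2 = 1"
proof -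
  note D = common_tangentsD[OF assms]
  let ?u = "fst \<gamma>" and ?N1 = "offset c1 \<gamma>" and ?N2 = "offset c2 \<gamma>"
  have "?u \<times> (?N1 \<times> ?N2) = 0" using D by (simp add: Lagrange inner_commute)
  with norm_cross_dot[of ?u "?N1 \<times> ?N2"]
  have "(?u \<bullet> (?N1 \<times> ?N2))\<^sup>2 = (norm (?N1 \<times> ?N2))\<^sup>2"
    using D(2) by (simp add: norm_eq_1)
  also have "\<dots> = r1\<^sup>2 * r2\<^sup>2 - (r1 * r2 * cosine \<gamma>)\<^sup>2"
    using D unfolding norm_cross by (simp add: power2_norm_eq_inner)
  finally have "(?u \<bullet> (?N1 \<times> ?N2))\<^sup>2 = (r1 * r2)\<^sup>2 * (1 - (cosine \<gamma>)\<^sup>2)" 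
    by (simp add: power_mult_distrib algebra_simps)
  then have "(sine \<gamma>)\<^sup>2 = 1 - (cosine \<gamma>)\<^sup>2"
    using r1_pos r2_pos by (simp add: sine_def power_divide)
  then show ?thesis by simp
qed

text \<open>
  Up to positive factors, the coordinates of the axis with respect to the contact normal of the
  first sphere and the direction orthogonal to it and to the line.
\<close>
lemma inner_axis:
  assumes "\<gamma> \<in> common_tangents"
  shows "offset c1 \<gamma> \<bullet> (c2 - c1) = r1 * (r1 - r2 * cosine \<gamma>)"
    and "(fst \<gamma> \<times> offset c1 \<gamma>) \<bullet> (c2 - c1) = - (r1 * r2 * sine \<gamma>)"
proof -
  note D = common_tangentsD[OF assms]
  show "offset c1 \<gamma> \<bullet> (c2 - c1) = r1 * (r1 - r2 * cosine \<gamma>)"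
    unfolding D(8) using D by (simp add: inner_simps power2_eq_square algebra_simps)
  have "(fst \<gamma> \<times> offset c1 \<gamma>) \<bullet> offset c2 \<gamma> = r1 * r2 * sine \<gamma>"
    unfolding sine_def using r1_pos r2_pos cross_triple[of "fst \<gamma>" "offset c1 \<gamma>" "offset c2 \<gamma>"]
    by (simp add: inner_commute)
  then show "(fst \<gamma> \<times> offset c1 \<gamma>) \<bullet> (c2 - c1) = - (r1 * r2 * sine \<gamma>)"
    unfolding D(8) by (simp add: inner_add_right inner_diff_right dot_cross_self)
qed

end

section \<open>Rotation about the axis of the centres\<close>

text \<open>
  Cylindrical coordinates about the axis \<open>e\<close>: a vector is a complex number, its component
  orthogonal to the axis, together with a height.
\<close>
locale axis_frame =
  fixes a e :: "real^3"
  assumes a_unit: "a \<bullet> a = 1" and e_unit: "e \<bullet> e = 1" and a_e: "a \<bullet> e = 0"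
begin

definition b :: "real^3" where "b = a \<times> e"

definition planar :: "real^3 \<Rightarrow> complex" where
  "planar w = Complex (w \<bullet> a) (w \<bullet> b)"

definition cyl :: "complex \<Rightarrow> real \<Rightarrow> real^3" where
  "cyl z h = Re z *\<^sub>R a + Im z *\<^sub>R b + h *\<^sub>R e"

lemma frame_simps [simp]:
  "a \<bullet> a = 1" "b \<bullet> b = 1" "e \<bullet> e = 1" "a \<bullet> b = 0" "b \<bullet> a = 0" "a \<bullet> e = 0" "e \<bullet> a = 0"
  "b \<bullet> e = 0" "e \<bullet> b = 0"
  using a_unit e_unit a_e by (auto simp: b_def dot_cross dot_cross_self inner_commute)

lemma planar_cyl [simp]: "planar (cyl z h) = z" and cyl_axis [simp]: "cyl z h \<bullet> e = h"
  by (simp_all add: planar_def cyl_def inner_simps)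

lemma inner_expand: "w \<bullet> w' = (w \<bullet> a) * (w' \<bullet> a) + (w \<bullet> b) * (w' \<bullet> b) + (w \<bullet> e) * (w' \<bullet> e)"
proof -
  have gram: "(w \<bullet> (a \<times> e)) * (w' \<bullet> (a \<times> e)) =
    (w \<bullet> w') * ((a \<bullet> a) * (e \<bullet> e) - (a \<bullet> e) * (a \<bullet> e))
    - (w \<bullet> a) * ((a \<bullet> w') * (e \<bullet> e) - (a \<bullet> e) * (e \<bullet> w'))
    + (w \<bullet> e) * ((a \<bullet> w') * (e \<bullet> a) - (a \<bullet> a) * (e \<bullet> w'))"
    by (simp add: cross3_simps)
  then show ?thesis by (simp add: b_def[symmetric] inner_commute)
qed

lemma cyl_planar: "cyl (planar w) (w \<bullet> e) = w"
proof -
  have "(cyl (planar w) (w \<bullet> e) - w) \<bullet> w' = 0" for w'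
    using inner_expand[of w w'] by (simp add: cyl_def planar_def inner_simps inner_commute)
  then have "(cyl (planar w) (w \<bullet> e) - w) \<bullet> (cyl (planar w) (w \<bullet> e) - w) = 0" by blast
  then show ?thesis by simp
qed

lemma cross_axis: "(w \<times> w') \<bullet> e = Im (planar w * cnj (planar w'))"
proof -
  have "b \<times> a = e"
    unfolding b_def cross_skew[of "a \<times> e"] Lagrange[of a a e] by (simp add: inner_commute)
  then have "(w \<times> w') \<bullet> e = (w \<times> w') \<bullet> (b \<times> a)" by simp
  then show ?thesis unfolding dot_cross by (simp add: planar_def)
qed

text \<open>
  All Gram data of two vectors and the axis, including the orientation, are in one complex number.
\<close>
lemma hermitian: "planar w * cnj (planar w') = Complex (w \<bullet> w' - (w \<bullet> e) * (w' \<bullet> e)) ((w \<times> w') \<bullet> e)"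
  using inner_expand[of w w'] cross_axis[of w w'] by (simp add: complex_eq_iff planar_def)

end

locale two_spheres_frame = two_spheres + axis_frame +
  assumes axis: "c2 - c1 = separation *\<^sub>R e" and separation_pos: "0 < separation"
begin

text \<open>
  The line determined by its invariants \<open>m\<close>, \<open>c\<close>, \<open>s\<close> (for \<open>height\<close>, \<open>cosine\<close>, \<open>sine\<close>) and an angle
  \<open>\<phi>\<close> of rotation about the axis. With respect to the orthonormal frame formed by the direction \<open>u\<close>
  of the line, the contact normal \<open>n\<close> of the first sphere and \<open>u \<times> n\<close>, the unit vector \<open>e\<close> of the
  axis has coordinates \<open>(\<delta>1, \<delta>2, \<delta>3)\<close>. The frame chosen for \<open>\<phi> = 0\<close> is \<open>(a, e, b)\<close> turned by the
  shortest rotation that takes \<open>\<delta>1 a + \<delta>2 e + \<delta>3 b\<close> to \<open>e\<close>. This rotation depends smoothly on the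
  invariants, because \<open>\<delta>2 = - 1\<close> never occurs: the first sphere is the larger one, so \<open>\<delta>2 \<ge> 0\<close>.
\<close>
definition \<delta>1 :: "real \<Rightarrow> real" where "\<delta>1 m = m / separation"
definition \<delta>2 :: "real \<Rightarrow> real" where "\<delta>2 c = (r1 - r2 * c) / separation"
definition \<delta>3 :: "real \<Rightarrow> real" where "\<delta>3 s = - r2 * s / separation"

definition dir_planar :: "real \<Rightarrow> real \<Rightarrow> real \<Rightarrow> complex" where
  "dir_planar m c s = Complex (1 - (\<delta>1 m)\<^sup>2 / (1 + \<delta>2 c)) (- \<delta>1 m * \<delta>3 s / (1 + \<delta>2 c))"

definition normal_planar :: "real \<Rightarrow> real \<Rightarrow> complex" where
  "normal_planar m s = Complex (- \<delta>1 m) (- \<delta>3 s)"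

definition dir :: "real \<Rightarrow> real \<Rightarrow> real \<Rightarrow> real \<Rightarrow> real^3" where
  "dir \<phi> m c s = cyl (cis \<phi> * dir_planar m c s) (\<delta>1 m)"

definition normal :: "real \<Rightarrow> real \<Rightarrow> real \<Rightarrow> real \<Rightarrow> real^3" where
  "normal \<phi> m c s = cyl (cis \<phi> * normal_planar m s) (\<delta>2 c)"

definition line_at :: "real \<Rightarrow> real \<Rightarrow> real \<Rightarrow> real \<Rightarrow> (real^3) \<times> (real^3)" where
  "line_at \<phi> m c s = (dir \<phi> m c s,
     r1 *\<^sub>R normal \<phi> m c s + (c1 - (c1 \<bullet> dir \<phi> m c s) *\<^sub>R dir \<phi> m c s))"

definition admissible :: "real \<Rightarrow> real \<Rightarrow> real \<Rightarrow> bool" where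
  "admissible m c s \<longleftrightarrow> c\<^sup>2 + s\<^sup>2 = 1 \<and> m\<^sup>2 = separation\<^sup>2 - r1\<^sup>2 - r2\<^sup>2 + 2 * r1 * r2 * c"

lemma admissible_invariants:
  assumes "\<gamma> \<in> common_tangents"
  shows "admissible (height \<gamma>) (cosine \<gamma>) (sine \<gamma>)"
  using cosine_sine[OF assms] height_sq[OF assms] by (simp add: admissible_def)

lemma \<delta>2_nonneg:
  assumes "c\<^sup>2 \<le> 1" shows "0 \<le> \<delta>2 c"
proof -
  have "c \<le> 1" using assms by (simp add: abs_square_le_1)
  then have "r2 * c \<le> r2 * 1" using r2_pos by (intro mult_left_mono) auto
  then show ?thesis using r2_le separation_pos by (simp add: \<delta>2_def)
qed

lemma admissibleD:
  assumes "admissible m c s"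
  shows "0 \<le> \<delta>2 c" and "(\<delta>1 m)\<^sup>2 + (\<delta>2 c)\<^sup>2 + (\<delta>3 s)\<^sup>2 = 1"
proof -
  from assms have cs: "s\<^sup>2 = 1 - c\<^sup>2" and m: "m\<^sup>2 = separation\<^sup>2 - r1\<^sup>2 - r2\<^sup>2 + 2 * r1 * r2 * c"
    by (auto simp: admissible_def)
  have "0 \<le> s\<^sup>2" by simp
  then have "c\<^sup>2 \<le> 1" using cs by simp
  then show "0 \<le> \<delta>2 c" by (rule \<delta>2_nonneg)
  have "(\<delta>1 m)\<^sup>2 + (\<delta>2 c)\<^sup>2 + (\<delta>3 s)\<^sup>2 = (m\<^sup>2 + (r1 - r2 * c)\<^sup>2 + r2\<^sup>2 * s\<^sup>2) / separation\<^sup>2"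
    by (simp add: \<delta>1_def \<delta>2_def \<delta>3_def power_divide power_mult_distrib add_divide_distrib)
  also have "m\<^sup>2 + (r1 - r2 * c)\<^sup>2 + r2\<^sup>2 * s\<^sup>2 = separation\<^sup>2"
    unfolding cs m by (simp add: power2_eq_square algebra_simps)
  finally show "(\<delta>1 m)\<^sup>2 + (\<delta>2 c)\<^sup>2 + (\<delta>3 s)\<^sup>2 = 1" using separation_pos by simp
qed

text \<open>
  These are the Hermitian products of the planar components that an orthonormal frame must have in
  which the axis has coordinates \<open>(\<delta>1, \<delta>2, \<delta>3)\<close>.
\<close>
lemma planar_frame:
  assumes "admissible m c s"
  shows "dir_planar m c s * cnj (dir_planar m c s) = of_real (1 - (\<delta>1 m)\<^sup>2)"
    and "normal_planar m s * cnj (normal_planar m s) = of_real (1 - (\<delta>2 c)\<^sup>2)"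
    and "dir_planar m c s * cnj (normal_planar m s) = Complex (- \<delta>1 m * \<delta>2 c) (\<delta>3 s)"
proof -
  define x where "x = \<delta>1 m"
  define y where "y = \<delta>2 c"
  define z where "z = \<delta>3 s"
  have y: "1 + y \<noteq> 0" and z: "z\<^sup>2 = 1 - x\<^sup>2 - y\<^sup>2"
    using admissibleD[OF assms] by (auto simp: x_def y_def z_def)
  note defs = dir_planar_def normal_planar_def x_def[symmetric] y_def[symmetric] z_def[symmetric]
  have f: "(1 - y\<^sup>2) / (1 + y) = 1 - y" using y by (simp add: field_simps power2_eq_square)
  have "(1 - x\<^sup>2 / (1 + y))\<^sup>2 + (x * z / (1 + y))\<^sup>2 = 1 - 2 * x\<^sup>2 / (1 + y) + x\<^sup>2 * (x\<^sup>2 + z\<^sup>2) / (1 + y)\<^sup>2"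
    by (simp add: power2_eq_square algebra_simps add_divide_distrib)
  also have "x\<^sup>2 + z\<^sup>2 = (1 + y) * (1 - y)" using z by (simp add: power2_eq_square algebra_simps)
  also have "1 - 2 * x\<^sup>2 / (1 + y) + x\<^sup>2 * ((1 + y) * (1 - y)) / (1 + y)\<^sup>2 = 1 - x\<^sup>2"
  proof -
    have "x\<^sup>2 * ((1 + y) * (1 - y)) / (1 + y)\<^sup>2 = x\<^sup>2 * (1 - y) / (1 + y)"
      using y by (simp add: power2_eq_square)
    also have "\<dots> = 2 * x\<^sup>2 / (1 + y) - x\<^sup>2"
    proof -
      have "x\<^sup>2 * (1 - y) = 2 * x\<^sup>2 - x\<^sup>2 * (1 + y)" by (simp add: algebra_simps)
      then show ?thesis using y by (simp add: diff_divide_distrib)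
    qed
    finally show ?thesis by simp
  qed
  finally show "dir_planar m c s * cnj (dir_planar m c s) = of_real (1 - (\<delta>1 m)\<^sup>2)"
    unfolding defs by (simp add: complex_eq_iff power2_eq_square)
  show "normal_planar m s * cnj (normal_planar m s) = of_real (1 - (\<delta>2 c)\<^sup>2)"
    unfolding defs using z by (simp add: complex_eq_iff power2_eq_square)
  have "- (1 - x\<^sup>2 / (1 + y)) * x + x * z / (1 + y) * z = x * ((x\<^sup>2 + z\<^sup>2) / (1 + y) - 1)"
    by (simp add: power2_eq_square algebra_simps add_divide_distrib)
  also have "x\<^sup>2 + z\<^sup>2 = 1 - y\<^sup>2" using z by simp
  also have "x * ((1 - y\<^sup>2) / (1 + y) - 1) = - x * y" unfolding f by (simp add: algebra_simps)
  finally show "dir_planar m c s * cnj (normal_planar m s) = Complex (- \<delta>1 m * \<delta>2 c) (\<delta>3 s)"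
    unfolding defs by (simp add: complex_eq_iff power2_eq_square algebra_simps)
qed

lemma frame_at:
  assumes "admissible m c s"
  shows "dir \<phi> m c s \<bullet> dir \<phi> m c s = 1" "normal \<phi> m c s \<bullet> normal \<phi> m c s = 1"
    and "dir \<phi> m c s \<bullet> normal \<phi> m c s = 0" "(dir \<phi> m c s \<times> normal \<phi> m c s) \<bullet> e = \<delta>3 s"
proof -
  have rot: "cis \<phi> * z * cnj (cis \<phi> * w) = z * cnj w" for z w
  proof -
    have "cis \<phi> * cnj (cis \<phi>) = 1" by (simp add: cis_cnj cis_mult)
    then show ?thesis by (metis complex_cnj_mult mult.assoc mult.left_commute mult_1)
  qed
  note H = hermitian[of "dir \<phi> m c s" "dir \<phi> m c s"] hermitian[of "normal \<phi> m c s" "normal \<phi> m c s"]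
    hermitian[of "dir \<phi> m c s" "normal \<phi> m c s"]
  show "dir \<phi> m c s \<bullet> dir \<phi> m c s = 1" "normal \<phi> m c s \<bullet> normal \<phi> m c s = 1"
    "dir \<phi> m c s \<bullet> normal \<phi> m c s = 0" "(dir \<phi> m c s \<times> normal \<phi> m c s) \<bullet> e = \<delta>3 s"
    using H unfolding dir_def normal_def planar_cyl cyl_axis rot planar_frame[OF assms]
    by (simp_all add: complex_eq_iff power2_eq_square)
qed

lemma line_at:
  assumes "admissible m c s"
  shows "line_at \<phi> m c s \<in> common_tangents"
    and "height (line_at \<phi> m c s) = m" "cosine (line_at \<phi> m c s) = c" "sine (line_at \<phi> m c s) = s"
    and "offset c1 (line_at \<phi> m c s) = r1 *\<^sub>R normal \<phi> m c s"
proof -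
  let ?u = "dir \<phi> m c s" and ?n = "normal \<phi> m c s" and ?\<gamma> = "line_at \<phi> m c s"
  note F = frame_at[OF assms, of \<phi>]
  have Fc: "?n \<bullet> ?u = 0" using F(3) by (simp add: inner_commute)
  show N1: "offset c1 ?\<gamma> = r1 *\<^sub>R ?n" by (simp add: offset_def line_at_def)
  have m: "(c2 - c1) \<bullet> ?u = m" and n: "(c2 - c1) \<bullet> ?n = r1 - r2 * c"
    using separation_pos unfolding axis dir_def normal_def
    by (simp_all add: inner_commute[of e] \<delta>1_def \<delta>2_def)
  then show h: "height ?\<gamma> = m" by (simp add: height_def line_at_def)
  have N2: "offset c2 ?\<gamma> = r1 *\<^sub>R ?n - (c2 - c1) + m *\<^sub>R ?u"
    using offset_diff[of c1 ?\<gamma> c2] m unfolding N1 by (simp add: line_at_def algebra_simps)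
  have L: "?\<gamma> \<in> oriented_lines"
    unfolding oriented_lines_def line_at_def using F
    by (auto simp: norm_eq_1 inner_simps inner_commute[of c1])
  have "offset c1 ?\<gamma> \<bullet> offset c2 ?\<gamma> = r1 * (r1 * (?n \<bullet> ?n) - (c2 - c1) \<bullet> ?n + m * (?n \<bullet> ?u))"
    unfolding N1 N2 by (simp add: inner_simps inner_commute algebra_simps)
  then have nn: "offset c1 ?\<gamma> \<bullet> offset c2 ?\<gamma> = r1 * r2 * c"
    unfolding F Fc n by simp
  then show "cosine ?\<gamma> = c" using r1_pos r2_pos by (simp add: cosine_def)
  have "offset c2 ?\<gamma> \<bullet> offset c2 ?\<gamma> = r1\<^sup>2 - 2 * r1 * ((c2 - c1) \<bullet> ?n) + (c2 - c1) \<bullet> (c2 - c1) - 2 * m * ((c2 - c1) \<bullet> ?u) + m\<^sup>2"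
    unfolding N2 using F Fc
    by (simp add: inner_add_left inner_add_right inner_diff_left inner_diff_right inner_commute power2_eq_square algebra_simps)
  also have "\<dots> = r2\<^sup>2"
    unfolding m n separation_sq using assms by (simp add: admissible_def power2_eq_square algebra_simps)
  finally show "?\<gamma> \<in> common_tangents"
    unfolding common_tangents_def using L N1 F r1_pos r2_pos
    by (simp add: norm_eq_square power2_eq_square)
  have "?u \<bullet> (offset c1 ?\<gamma> \<times> offset c2 ?\<gamma>) = - r1 * separation * (?u \<bullet> (?n \<times> e))"
    unfolding N1 N2 axis
    by (simp add: cross_mult_left cross_mult_right cross_add_right Cross3.right_diff_distrib
        inner_add_right inner_diff_right dot_cross_self)
  also have "?u \<bullet> (?n \<times> e) = \<delta>3 s"
    using F(4) cross_triple[of ?u ?n e] by (simp add: inner_commute)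
  finally show "sine ?\<gamma> = s"
    using r1_pos r2_pos separation_pos by (simp add: sine_def line_at_def \<delta>3_def)
qed

text \<open>
  The direction and the contact normal are not both parallel to the axis, so rotation about the
  axis acts freely on the common tangents.
\<close>
lemma planar_frame_nonzero:
  assumes "admissible m c s"
  shows "dir_planar m c s \<noteq> 0 \<or> normal_planar m s \<noteq> 0"
proof (rule ccontr)
  assume "\<not> ?thesis"
  then have "complex_of_real (1 - (\<delta>1 m)\<^sup>2) = 0" "complex_of_real (1 - (\<delta>2 c)\<^sup>2) = 0"
    unfolding planar_frame(1,2)[OF assms, symmetric] by auto
  then have "(\<delta>1 m)\<^sup>2 = 1" "(\<delta>2 c)\<^sup>2 = 1" unfolding of_real_eq_0_iff by auto
  with admissibleD(2)[OF assms] show False by (smt (verit) zero_le_power2)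
qed

text \<open>
  The quotient of the members of one nonzero pair is a phase, as their moduli agree; equality of the
  mixed products passes it on to the other pair.
\<close>
lemma common_phase:
  assumes "z * cnj z = z' * cnj z'" "w * cnj w = w' * cnj w'" "z * cnj w = z' * cnj w'"
  shows "\<exists>\<phi>. z' = cis \<phi> * z \<and> w' = cis \<phi> * w"
proof -
  have aux: "\<exists>\<phi>. z' = cis \<phi> * z \<and> w' = cis \<phi> * w"
    if "z \<noteq> 0" "z * cnj z = z' * cnj z'" "w * cnj w = w' * cnj w'" "z * cnj w = z' * cnj w'" for z z' w w'
  proof -
    have "cmod z = cmod z'" using that(2) by (simp add: complex_norm_square[symmetric] flip: of_real_power)
    with \<open>z \<noteq> 0\<close> have "z' / z \<noteq> 0" "cmod (z' / z) = 1" by (auto simp: norm_divide)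
    then have c: "z' / z = cis (Arg (z' / z))"
      using cis_Arg[of "z' / z"] by (simp add: sgn_eq)
    have "cnj z * w = cnj z' * w'" using arg_cong[OF that(4), of cnj] by simp
    then have "z * cnj z * w' = z' * cnj z * w" using that(2) by (simp add: ac_simps)
    then have "w' = z' / z * w" using \<open>z \<noteq> 0\<close> by (simp add: field_simps)
    then show ?thesis using c \<open>z \<noteq> 0\<close> by (metis nonzero_eq_divide_eq)
  qed
  show ?thesis
  proof (cases "z = 0")
    case False
    then show ?thesis using aux assms by blast
  next
    case z: True
    then have z': "z' = 0" using assms(1) by simp
    show ?thesis
    proof (cases "w = 0")
      case True
      then show ?thesis using z z' assms(2) by simp
    next
      case False
      have "w * cnj z = w' * cnj z'" using z z' by simp
      from aux[OF False assms(2) assms(1) this] show ?thesis by blast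
    qed
  qed
qed

text \<open>
  Two orthonormal frames with the same orientation in which the axis has the same coordinates
  differ by a rotation about the axis.
\<close>
lemma line_at_surj:
  assumes \<gamma>: "\<gamma> \<in> common_tangents"
  shows "\<exists>\<phi>. \<gamma> = line_at \<phi> (height \<gamma>) (cosine \<gamma>) (sine \<gamma>)"
proof -
  let ?m = "height \<gamma>" and ?c = "cosine \<gamma>" and ?s = "sine \<gamma>"
  let ?u = "fst \<gamma>" and ?n = "(1 / r1) *\<^sub>R offset c1 \<gamma>"
  note D = common_tangentsD[OF \<gamma>] and P = planar_frame[OF admissible_invariants[OF \<gamma>]]
  have l0: "separation \<noteq> 0" using separation_pos by simp
  have e: "e = (1 / separation) *\<^sub>R (c2 - c1)" unfolding axis using l0 by simp
  have ue: "?u \<bullet> e = \<delta>1 ?m" using l0 unfolding e by (simp add: height_def \<delta>1_def inner_commute)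
  have ne: "?n \<bullet> e = \<delta>2 ?c" using l0 r1_pos inner_axis(1)[OF \<gamma>] unfolding e \<delta>2_def by simp
  have une: "(?u \<times> ?n) \<bullet> e = \<delta>3 ?s"
    using l0 r1_pos inner_axis(2)[OF \<gamma>] unfolding e \<delta>3_def by (simp add: cross_mult_right)
  have un: "?u \<bullet> ?u = 1" "?n \<bullet> ?n = 1" "?u \<bullet> ?n = 0"
    using D r1_pos by (auto simp: inner_commute power2_eq_square)
  have "planar ?u * cnj (planar ?u) = of_real (1 - (\<delta>1 ?m)\<^sup>2)"
       "planar ?n * cnj (planar ?n) = of_real (1 - (\<delta>2 ?c)\<^sup>2)"
       "planar ?u * cnj (planar ?n) = Complex (- \<delta>1 ?m * \<delta>2 ?c) (\<delta>3 ?s)"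
    unfolding hermitian ue ne une un by (simp_all add: complex_eq_iff power2_eq_square)
  with common_phase[of "dir_planar ?m ?c ?s" "planar ?u" "normal_planar ?m ?s" "planar ?n"] P
  obtain \<phi> where "planar ?u = cis \<phi> * dir_planar ?m ?c ?s" "planar ?n = cis \<phi> * normal_planar ?m ?s"
    by auto
  then have u: "?u = dir \<phi> ?m ?c ?s" and n: "?n = normal \<phi> ?m ?c ?s"
    unfolding dir_def normal_def using cyl_planar ue ne by metis+
  have "offset c1 \<gamma> = r1 *\<^sub>R normal \<phi> ?m ?c ?s" using r1_pos by (simp add: n[symmetric])
  then have "\<gamma> = line_at \<phi> ?m ?c ?s"
    unfolding line_at_def u[symmetric] by (simp add: offset_def prod_eq_iff algebra_simps)
  then show ?thesis by blast
qed

lemma line_at_inj: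
  assumes "admissible m c s" "line_at \<phi> m c s = line_at \<psi> m' c' s'" "admissible m' c' s'"
  shows "m = m' \<and> c = c' \<and> s = s' \<and> cis \<phi> = cis \<psi>"
proof -
  have *: "m = m'" "c = c'" "s = s'"
    using line_at[OF assms(1), of \<phi>] line_at[OF assms(3), of \<psi>] assms(2) by auto
  have "planar (fst (line_at \<phi> m c s)) = planar (fst (line_at \<psi> m c s))"
    "planar (offset c1 (line_at \<phi> m c s)) = planar (offset c1 (line_at \<psi> m c s))"
    using assms(2) * by auto
  moreover have "planar (r1 *\<^sub>R w) = of_real r1 * planar w" for w
    by (simp add: planar_def complex_eq_iff)
  ultimately have "cis \<phi> * dir_planar m c s = cis \<psi> * dir_planar m c s"
     "cis \<phi> * normal_planar m s = cis \<psi> * normal_planar m s"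
    using r1_pos unfolding line_at(5)[OF assms(1)] by (auto simp: line_at_def dir_def normal_def)
  then have "cis \<phi> = cis \<psi>" using planar_frame_nonzero[OF assms(1)] by auto
  with * show ?thesis by blast
qed

end

section \<open>Tori of common tangents\<close>

lemma bounded_bilinear_cross3: "bounded_bilinear (\<times>)"
  using bilinear_cross bilinear_conv_bounded_bilinear by blast

lemma differentiable_offset: "offset c differentiable (at \<gamma>)"
  unfolding offset_def[abs_def] differentiable_def
  by (rule exI) (auto intro!: derivative_eq_intros)

lemma cis_inj_on_period: "cis s = cis t \<Longrightarrow> s \<in> {0..<2 * pi} \<Longrightarrow> t \<in> {0..<2 * pi} \<Longrightarrow> s = t"
proof -
  assume eq: "cis s = cis t" and s: "s \<in> {0..<2 * pi}" and t: "t \<in> {0..<2 * pi}"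
  then obtain n :: int where n: "s = t + 2 * pi * n"
    using sin_cos_eq_iff[of s t] by (auto simp: complex_eq_iff)
  have "0 \<le> s" "s < 2 * pi" "0 \<le> t" "t < 2 * pi" using s t by auto
  then have "2 * pi * n < 2 * pi * 1" "2 * pi * (-1) < 2 * pi * n" unfolding n by linarith+
  then have "real_of_int n < 1" "-1 < real_of_int n"
    using mult_less_cancel_left_pos[of "2 * pi" n 1] mult_less_cancel_left_pos[of "2 * pi" "-1" n]
    by (simp_all only: pi_gt_zero mult_pos_pos zero_less_numeral simp_thms)
  then have "n = 0" by linarith
  then show "s = t" using n by auto
qed

context two_spheres
begin

lemma differentiable_invariants:
  "height differentiable (at \<gamma>)" "cosine differentiable (at \<gamma>)" "sine differentiable (at \<gamma>)"
proof -
  obtain D1 D2 where D: "(offset c1 has_derivative D1) (at \<gamma>)" "(offset c2 has_derivative D2) (at \<gamma>)"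
    using differentiable_offset by (meson differentiable_def)
  have f: "(fst has_derivative fst) (at \<gamma>)" by (auto intro!: derivative_eq_intros)
  show "height differentiable (at \<gamma>)"
    unfolding height_def[abs_def] differentiable_def by (rule exI) (auto intro!: derivative_eq_intros)
  show "cosine differentiable (at \<gamma>)"
    unfolding cosine_def[abs_def] differentiable_def divide_inverse
    by (rule exI) (rule has_derivative_mult_left has_derivative_inner D)+
  show "sine differentiable (at \<gamma>)"
    unfolding sine_def[abs_def] differentiable_def divide_inverse
    by (rule exI) (rule has_derivative_mult_left has_derivative_inner D f
        bounded_bilinear.FDERIV[OF bounded_bilinear_cross3])+
qed

end

text \<open>
  The space of common tangents is a surface of revolution over the curve of admissible invariants:
  a closed regular parametrization of that curve yields an immersed torus.
\<close>
locale invariant_curve = two_spheres_frame +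
  fixes m c s :: "real \<Rightarrow> real"
  assumes admissible: "\<And>t. admissible (m t) (c t) (s t)"
    and smooth: "\<And>k. C_k k m" "\<And>k. C_k k c" "\<And>k. C_k k s"
    and periodic: "\<And>t. m (t + 2 * pi) = m t" "\<And>t. c (t + 2 * pi) = c t" "\<And>t. s (t + 2 * pi) = s t"
    and regular: "\<And>t. \<exists>m' c' s'. (m has_real_derivative m') (at t) \<and> (c has_real_derivative c') (at t)
      \<and> (s has_real_derivative s') (at t) \<and> (m' \<noteq> 0 \<or> c' \<noteq> 0 \<or> s' \<noteq> 0)"
begin

definition torus :: "real \<times> real \<Rightarrow> (real^3) \<times> (real^3)" where
  "torus z = line_at (fst z) (m (snd z)) (c (snd z)) (s (snd z))"

lemma torus_in: "torus z \<in> common_tangents"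
  unfolding torus_def by (rule line_at(1)[OF admissible])

lemma torus_C_k: "C_k k torus"
proof -
  have C: "C_k k (\<lambda>z::real\<times>real. m (snd z))" "C_k k (\<lambda>z::real\<times>real. c (snd z))"
    "C_k k (\<lambda>z::real\<times>real. s (snd z))" "C_k k (\<lambda>z::real\<times>real. fst z)"
    by (intro C_k_compose_linear_right[OF bounded_linear_snd] smooth
        C_k_bounded_linear[OF bounded_linear_fst])+
  have nz: "1 + \<delta>2 (c t) \<noteq> 0" for t using admissibleD(1)[OF admissible[of t]] by linarith
  have sep: "separation \<noteq> 0" using separation_pos by simp
  have D: "C_k k (\<lambda>z::real\<times>real. \<delta>1 (m (snd z)))" "C_k k (\<lambda>z::real\<times>real. \<delta>2 (c (snd z)))"
    "C_k k (\<lambda>z::real\<times>real. \<delta>3 (s (snd z)))"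
    unfolding \<delta>1_def \<delta>2_def \<delta>3_def using sep by (auto intro!: C_k_intros C)
  have "C_k k (\<lambda>z::real\<times>real. dir (fst z) (m (snd z)) (c (snd z)) (s (snd z)))"
       "C_k k (\<lambda>z::real\<times>real. normal (fst z) (m (snd z)) (c (snd z)) (s (snd z)))"
    unfolding dir_def normal_def cyl_def dir_planar_def normal_planar_def
    by (simp_all, (intro C_k_intros C D nz)+)
  then show ?thesis
    unfolding torus_def[abs_def] line_at_def by (intro C_k_intros)
qed

text \<open>
  If the line has velocity zero, so have its invariants, and by regularity of the curve the second
  component of the velocity in the parameter plane vanishes. What remains is a rotation about the
  axis, which acts freely.
\<close>
lemma torus_immersed:
  assumes "((\<lambda>t::real. torus (z + t *\<^sub>R h)) has_vector_derivative 0) (at 0)"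
  shows "h = 0"
proof -
  obtain \<phi> \<tau> where z: "z = (\<phi>, \<tau>)" by fastforce
  obtain h1 h2 where h: "h = (h1, h2)" by fastforce
  let ?g = "\<lambda>t::real. torus (z + t *\<^sub>R h)"
  note chain = has_vector_derivative_chain_zero[OF _ assms]
  have inv: "height (?g t) = m (\<tau> + t * h2)" "cosine (?g t) = c (\<tau> + t * h2)" "sine (?g t) = s (\<tau> + t * h2)"
    "offset c1 (?g t) = r1 *\<^sub>R normal (\<phi> + t * h1) (m (\<tau> + t * h2)) (c (\<tau> + t * h2)) (s (\<tau> + t * h2))" for t
    by (simp_all add: torus_def z h line_at[OF admissible])
  have d0: "((\<lambda>t. m (\<tau> + t * h2)) has_real_derivative 0) (at 0)"
    "((\<lambda>t. c (\<tau> + t * h2)) has_real_derivative 0) (at 0)"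
    "((\<lambda>t. s (\<tau> + t * h2)) has_real_derivative 0) (at 0)"
    using chain[OF differentiable_invariants(1)] chain[OF differentiable_invariants(2)]
      chain[OF differentiable_invariants(3)]
    unfolding inv has_real_derivative_iff_has_vector_derivative by auto
  obtain m' c' s' where d: "(m has_real_derivative m') (at \<tau>)" "(c has_real_derivative c') (at \<tau>)"
    "(s has_real_derivative s') (at \<tau>)" "m' \<noteq> 0 \<or> c' \<noteq> 0 \<or> s' \<noteq> 0" using regular by blast
  have "((\<lambda>t. f (\<tau> + t * h2)) has_real_derivative f' * h2) (at 0)"
    if "(f has_real_derivative f') (at \<tau>)" for f f'
    by (rule DERIV_chain2[where f = f]) (use that in \<open>auto intro!: derivative_eq_intros\<close>)
  from this[OF d(1)] this[OF d(2)] this[OF d(3)] d0 have "m' * h2 = 0" "c' * h2 = 0" "s' * h2 = 0"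
    using DERIV_unique by blast+
  then have h2: "h2 = 0" using d(4) by auto
  have phase: "h1 = 0 \<or> w = 0" if "((\<lambda>t. cis (\<phi> + t * h1) * w) has_vector_derivative 0) (at 0)" for w
  proof -
    have "((\<lambda>t. cis (\<phi> + t * h1) * w) has_derivative (\<lambda>t. (t * h1) *\<^sub>R (\<i> * cis \<phi>) * w)) (at 0)"
      by (auto intro!: derivative_eq_intros)
    from has_derivative_unique[OF this that[unfolded has_vector_derivative_def]]
    have "(1 * h1) *\<^sub>R (\<i> * cis \<phi>) * w = 1 *\<^sub>R 0" by (rule fun_cong)
    then show ?thesis by simp
  qed
  have planar: "planar differentiable (at w)" for w
    unfolding planar_def[abs_def] complex_eq differentiable_def
    by (rule exI) (auto intro!: derivative_eq_intros simp: Complex_eq)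
  have "fst differentiable (at \<gamma>)" for \<gamma> :: "(real^3) \<times> (real^3)"
    by (rule bounded_linear_imp_differentiable[OF bounded_linear_fst])
  then have "((\<lambda>t. planar (fst (?g t))) has_vector_derivative 0) (at 0)"
    by (intro has_vector_derivative_chain_zero[OF planar] chain)
  moreover have "planar (fst (?g t)) = cis (\<phi> + t * h1) * dir_planar (m \<tau>) (c \<tau>) (s \<tau>)" for t
    by (simp add: torus_def z h h2 line_at_def dir_def)
  ultimately have 1: "h1 = 0 \<or> dir_planar (m \<tau>) (c \<tau>) (s \<tau>) = 0" using phase by simp
  have "(\<lambda>w. planar ((1 / r1) *\<^sub>R w)) differentiable (at w)" for w
    unfolding planar_def[abs_def] differentiable_def
    by (rule exI) (use r1_pos in \<open>auto intro!: derivative_eq_intros simp: Complex_eq\<close>)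
  then have "((\<lambda>t. planar ((1 / r1) *\<^sub>R offset c1 (?g t))) has_vector_derivative 0) (at 0)"
    by (intro has_vector_derivative_chain_zero[OF _ chain] differentiable_offset)
  moreover have "planar ((1 / r1) *\<^sub>R offset c1 (?g t)) = cis (\<phi> + t * h1) * normal_planar (m \<tau>) (s \<tau>)" for t
    unfolding inv using r1_pos by (simp add: h2 normal_def)
  ultimately have "h1 = 0 \<or> normal_planar (m \<tau>) (s \<tau>) = 0" using phase by simp
  with 1 planar_frame_nonzero[OF admissible] h h2 show ?thesis by (auto simp: zero_prod_def)
qed

lemma torus_immersion_torus: "torus_immersion torus"
  unfolding torus_immersion_def
proof (intro conjI allI)
  show "smooth_immersion torus"
    by (rule smooth_immersionI[OF torus_C_k torus_immersed])
  show "torus (x + 2 * pi, t) = torus (x, t)" "torus (x, t + 2 * pi) = torus (x, t)" for x t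
    by (simp_all add: torus_def periodic line_at_def dir_def normal_def cis_mult[symmetric])
qed

lemma range_torus:
  "range torus = {\<gamma> \<in> common_tangents. \<exists>t. height \<gamma> = m t \<and> cosine \<gamma> = c t \<and> sine \<gamma> = s t}"
proof (intro set_eqI iffI)
  fix \<gamma> assume "\<gamma> \<in> range torus"
  then show "\<gamma> \<in> {\<gamma> \<in> common_tangents. \<exists>t. height \<gamma> = m t \<and> cosine \<gamma> = c t \<and> sine \<gamma> = s t}"
    using torus_in line_at[OF admissible] by (auto simp: torus_def)
next
  fix \<gamma> assume "\<gamma> \<in> {\<gamma> \<in> common_tangents. \<exists>t. height \<gamma> = m t \<and> cosine \<gamma> = c t \<and> sine \<gamma> = s t}"
  then obtain t where "\<gamma> \<in> common_tangents" "height \<gamma> = m t" "cosine \<gamma> = c t" "sine \<gamma> = s t" by blast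
  then obtain \<phi> where "\<gamma> = line_at \<phi> (m t) (c t) (s t)" using line_at_surj[of \<gamma>] by auto
  then have "\<gamma> = torus (\<phi>, t)" by (simp add: torus_def)
  then show "\<gamma> \<in> range torus" by blast
qed

lemma inj_torus:
  assumes "inj_on (\<lambda>t. (m t, c t, s t)) {0..<2 * pi}"
  shows "inj_on torus (Sigma {0..<2 * pi} (\<lambda>_. {0..<2 * pi}))"
proof (rule inj_onI)
  fix x y :: "real \<times> real"
  assume x: "x \<in> Sigma {0..<2 * pi} (\<lambda>_. {0..<2 * pi})" and y: "y \<in> Sigma {0..<2 * pi} (\<lambda>_. {0..<2 * pi})"
    and eq: "torus x = torus y"
  from line_at_inj[OF admissible eq[unfolded torus_def] admissible]
  have "m (snd x) = m (snd y)" "c (snd x) = c (snd y)" "s (snd x) = s (snd y)" "cis (fst x) = cis (fst y)"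
    by auto
  with inj_onD[OF assms, of "snd x" "snd y"] cis_inj_on_period[of "fst x" "fst y"] x y
  show "x = y" by (auto simp: prod_eq_iff)
qed

lemma embedded_torus_range:
  assumes "inj_on (\<lambda>t. (m t, c t, s t)) {0..<2 * pi}"
  shows "embedded_torus (range torus)"
  unfolding embedded_torus_def using torus_immersion_torus inj_torus[OF assms] by blast

end

section \<open>The topological type of the intersection\<close>

text \<open>
  By periodicity the closed period square already has the full image.
\<close>
lemma torus_immersion_compact:
  fixes f :: "real \<times> real \<Rightarrow> 'b::real_normed_vector"
  assumes "torus_immersion f"
  shows "compact (range f)"
proof -
  have per: "f (s + 2 * pi * of_int n, t) = f (s, t)" "f (s, t + 2 * pi * of_int n) = f (s, t)" for s t n
  proof -
    have "f (s + 2 * pi * of_nat k, t) = f (s, t)" "f (s, t + 2 * pi * of_nat k) = f (s, t)" for s t k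
    proof (induction k)
      case (Suc k)
      have "f ((s + 2 * pi * of_nat k) + 2 * pi, t) = f (s + 2 * pi * of_nat k, t)"
           "f (s, (t + 2 * pi * of_nat k) + 2 * pi) = f (s, t + 2 * pi * of_nat k)"
        using assms unfolding torus_immersion_def by blast+
      with Suc show "f (s + 2 * pi * of_nat (Suc k), t) = f (s, t)" "f (s, t + 2 * pi * of_nat (Suc k)) = f (s, t)"
        by (simp_all add: algebra_simps)
    qed simp_all
    note nat = this
    show "f (s + 2 * pi * of_int n, t) = f (s, t)"
    proof (cases n rule: int_cases2)
      case (nonpos k)
      then show ?thesis using nat(1)[of "s + 2 * pi * of_int n" k t] by simp
    qed (simp add: nat)
    show "f (s, t + 2 * pi * of_int n) = f (s, t)"
    proof (cases n rule: int_cases2)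
      case (nonpos k)
      then show ?thesis using nat(2)[of s "t + 2 * pi * of_int n" k] by simp
    qed (simp add: nat)
  qed
  have "range f \<subseteq> f ` (cbox (0, 0) (2 * pi, 2 * pi))"
  proof
    fix x assume "x \<in> range f"
    then obtain s t where x: "x = f (s, t)" by auto
    define r where "r s = s + 2 * pi * of_int (- \<lfloor>s / (2 * pi)\<rfloor>)" for s
    have "0 \<le> r s \<and> r s \<le> 2 * pi" for s
    proof -
      have "r s = 2 * pi * frac (s / (2 * pi))" by (simp add: r_def frac_def algebra_simps)
      then show ?thesis using frac_ge_0[of "s / (2 * pi)"] frac_lt_1[of "s / (2 * pi)"]
        by (simp add: mult_left_le less_imp_le)
    qed
    moreover have "x = f (r s, r t)" unfolding x r_def per ..
    ultimately show "x \<in> f ` (cbox (0, 0) (2 * pi, 2 * pi))" by (auto simp: cbox_Pair_eq)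
  qed
  then have "range f = f ` (cbox (0, 0) (2 * pi, 2 * pi))" by blast
  then show ?thesis
    using compact_continuous_image[OF smooth_immersionD(3) compact_cbox] assms
    unfolding torus_immersion_def by metis
qed

lemma immersed_torus_connected:
  assumes "immersed_torus X" shows "connected X" "X \<noteq> {}"
  using assms connected_continuous_image[OF smooth_immersionD(3) connected_UNIV]
  unfolding immersed_torus_def torus_immersion_def by blast+

lemma embedded_circle_connected:
  assumes "embedded_circle X" shows "connected X" "X \<noteq> {}"
  using assms connected_continuous_image[OF smooth_immersionD(3) connected_UNIV]
  unfolding embedded_circle_def by blast+

lemma embedded_torus_imp_immersed_torus: "embedded_torus X \<Longrightarrow> immersed_torus X"
  unfolding embedded_torus_def immersed_torus_def by blast

lemma disjoint_embedded_tori_not_connected: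
  assumes "disjoint_embedded_tori X" shows "\<not> connected X"
proof
  assume conn: "connected X"
  obtain T T' where T: "embedded_torus T" "embedded_torus T'" "T \<inter> T' = {}" "X = T \<union> T'"
    using assms unfolding disjoint_embedded_tori_def by blast
  then have "compact T" "compact T'" "T \<noteq> {}" "T' \<noteq> {}"
    using torus_immersion_compact immersed_torus_connected(2)[OF embedded_torus_imp_immersed_torus]
    unfolding embedded_torus_def by blast+
  with T conn show False
    using compact_imp_closed unfolding connected_closed by blast
qed

lemma immersed_torus_not_in_circle:
  fixes X :: "'b::euclidean_space set"
  assumes "immersed_torus T" "T \<subseteq> X" shows "\<not> embedded_circle X"
  using assms immersed_surface_not_in_curve[where 'b = 'b]
  unfolding immersed_torus_def torus_immersion_def embedded_circle_def by blast

context two_spheres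
begin

text \<open>
  Both summands on the left are nonnegative, so this decides whether there are common tangents, and
  leaves no freedom for the invariants if the right-hand side vanishes.
\<close>
lemma gap_sq:
  assumes "\<gamma> \<in> common_tangents"
  shows "(height \<gamma>)\<^sup>2 + 2 * r1 * r2 * (1 - cosine \<gamma>) = separation\<^sup>2 - (r1 - r2)\<^sup>2"
  using height_sq[OF assms] by (simp add: power2_eq_square algebra_simps)

lemma cosine_le_1: "\<gamma> \<in> common_tangents \<Longrightarrow> cosine \<gamma> \<le> 1"
  using cosine_sine[of \<gamma>] by (metis abs_le_D1 abs_square_le_1 le_add_same_cancel1 zero_le_power2)

lemma no_common_tangents:
  assumes "separation < r1 - r2" shows "common_tangents = {}"
proof (rule ccontr)
  assume "common_tangents \<noteq> {}"
  then obtain \<gamma> where \<gamma>: "\<gamma> \<in> common_tangents" by blast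
  have "0 \<le> 2 * r1 * r2 * (1 - cosine \<gamma>)" using r1_pos r2_pos cosine_le_1[OF \<gamma>] by simp
  then have "(r1 - r2)\<^sup>2 \<le> separation\<^sup>2" using gap_sq[OF \<gamma>] zero_le_power2[of "height \<gamma>"] by linarith
  moreover have "0 \<le> separation" by simp
  ultimately show False using assms power2_le_imp_le[of "r1 - r2" separation] by linarith
qed

end

context two_spheres_frame
begin

text \<open>
  For internally touching spheres the height vanishes and the contact normals agree, hence both
  point along the axis.
\<close>
lemma circle_of_common_tangents:
  assumes "separation = r1 - r2" shows "embedded_circle common_tangents"
proof -
  define f where "f t = (cyl (cis t) 0, r1 *\<^sub>R e + (c1 - (c1 \<bullet> cyl (cis t) 0) *\<^sub>R cyl (cis t) 0))" for t
  have N1: "offset c1 (f t) = r1 *\<^sub>R e" for t by (simp add: offset_def f_def)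
  have e1: "norm e = 1" by (simp add: norm_eq_1)
  have "cyl (cis t) 0 \<bullet> cyl (cis t) 0 = 1" for t
    by (simp add: cyl_def inner_simps power2_eq_square[symmetric])
  then have L: "f t \<in> oriented_lines" for t
    unfolding oriented_lines_def f_def by (auto simp: norm_eq_1 inner_simps inner_commute[of c1])
  have "offset c2 (f t) = offset c1 (f t) - (c2 - c1)" for t
    using offset_diff[of c1 "f t" c2] unfolding axis by (simp add: f_def inner_commute[of e] algebra_simps)
  then have N2: "offset c2 (f t) = r2 *\<^sub>R e" for t
    unfolding N1 axis assms by (simp add: scaleR_diff_left)
  have in_X: "f t \<in> common_tangents" for t
    unfolding common_tangents_def using L N1 N2 r1_pos r2_pos e1 by simp
  have "common_tangents \<subseteq> range f"
  proof
    fix \<gamma> assume \<gamma>: "\<gamma> \<in> common_tangents"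
    note D = common_tangentsD[OF \<gamma>]
    have "0 \<le> 2 * r1 * r2 * (1 - cosine \<gamma>)" using r1_pos r2_pos cosine_le_1[OF \<gamma>] by simp
    moreover have "(height \<gamma>)\<^sup>2 + 2 * r1 * r2 * (1 - cosine \<gamma>) = 0"
      unfolding gap_sq[OF \<gamma>] assms by simp
    ultimately have "(height \<gamma>)\<^sup>2 = 0" "2 * r1 * r2 * (1 - cosine \<gamma>) = 0"
      using zero_le_power2[of "height \<gamma>"] by linarith+
    then have h: "height \<gamma> = 0" and c: "cosine \<gamma> = 1" using r1_pos r2_pos by auto
    have o: "offset c1 \<gamma> - r1 *\<^sub>R e = 0"
    proof -
      have "offset c1 \<gamma> \<bullet> e = r1"
        using inner_axis(1)[OF \<gamma>] separation_pos assms unfolding axis c by simp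
      then have "(offset c1 \<gamma> - r1 *\<^sub>R e) \<bullet> (offset c1 \<gamma> - r1 *\<^sub>R e) = 0"
        using D(3) by (simp add: inner_diff_left inner_diff_right inner_commute power2_eq_square)
      then show ?thesis by simp
    qed
    have "fst \<gamma> \<bullet> e = 0" using h separation_pos by (simp add: height_def axis inner_commute)
    then have u: "fst \<gamma> = cyl (planar (fst \<gamma>)) 0" using cyl_planar[of "fst \<gamma>"] by simp
    have "(Re (planar (fst \<gamma>)))\<^sup>2 + (Im (planar (fst \<gamma>)))\<^sup>2 = 1"
      using inner_expand[of "fst \<gamma>" "fst \<gamma>"] D(2) \<open>fst \<gamma> \<bullet> e = 0\<close> by (simp add: planar_def power2_eq_square)
    then obtain t where "Re (planar (fst \<gamma>)) = cos t" "Im (planar (fst \<gamma>)) = sin t" by (rule sincos_total_2pi)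
    then have "planar (fst \<gamma>) = cis t" by (simp add: complex_eq_iff)
    then have "fst \<gamma> = cyl (cis t) 0" using u by simp
    then have "\<gamma> = f t" using o by (simp add: f_def offset_def prod_eq_iff algebra_simps)
    then show "\<gamma> \<in> range f" by blast
  qed
  then have ran: "range f = common_tangents" using in_X by blast
  have pl: "planar (fst (f t)) = cis t" for t by (simp add: f_def)
  have "smooth_immersion f"
  proof (rule smooth_immersionI)
    show "C_k k f" for k unfolding f_def[abs_def] cyl_def by simp (intro C_k_intros)
    fix t h :: real
    assume "((\<lambda>x. f (t + x *\<^sub>R h)) has_vector_derivative 0) (at 0)"
    moreover have "(\<lambda>\<gamma>. planar (fst \<gamma>)) differentiable (at x)" for x :: "(real^3) \<times> (real^3)"
      unfolding planar_def[abs_def] differentiable_def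
      by (rule exI) (auto intro!: derivative_eq_intros simp: Complex_eq)
    ultimately have "((\<lambda>x. cis (t + x * h)) has_vector_derivative 0) (at 0)"
      using has_vector_derivative_chain_zero[of "\<lambda>\<gamma>. planar (fst \<gamma>)" "\<lambda>x. f (t + x *\<^sub>R h)" 0] by (simp add: pl)
    moreover have "((\<lambda>x. cis (t + x * h)) has_derivative (\<lambda>x. (x * h) *\<^sub>R (\<i> * cis t))) (at 0)"
      by (auto intro!: derivative_eq_intros)
    ultimately have "(1 * h) *\<^sub>R (\<i> * cis t) = 1 *\<^sub>R 0"
      using has_derivative_unique unfolding has_vector_derivative_def by metis
    then show "h = 0" by simp
  qed
  moreover have "f (t + 2 * pi) = f t" for t by (simp add: f_def cis_mult[symmetric])
  moreover have "inj_on f {0..<2 * pi}"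
    using pl cis_inj_on_period unfolding inj_on_def by metis
  ultimately show ?thesis unfolding embedded_circle_def using ran by blast
qed

text \<open>
  With \<open>\<theta>\<close> the angle between the contact normals, the invariants satisfy
  \<open>height\<^sup>2 = 4 r1 r2 (k - sin\<^sup>2 (\<theta>/2))\<close>, where \<open>k < 1\<close> if the spheres cross and \<open>k = 1\<close> if they
  touch externally. The solutions are \<open>height = 2 sqrt (k r1 r2) cos t\<close>, \<open>sin (\<theta>/2) = sqrt k sin t\<close>.
  This is a simple closed curve for \<open>k < 1\<close> and a figure eight for \<open>k = 1\<close>.
\<close>
lemma crossing_spheres_parameter:
  assumes "r1 - r2 < separation"
  defines "k \<equiv> (separation\<^sup>2 - (r1 - r2)\<^sup>2) / (4 * r1 * r2)"
  shows "0 < k" and "separation\<^sup>2 - r1\<^sup>2 - r2\<^sup>2 = 4 * r1 * r2 * k - 2 * r1 * r2"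
    and "separation < r1 + r2 \<Longrightarrow> k < 1" and "separation = r1 + r2 \<Longrightarrow> k = 1"
proof -
  have pos: "0 < 4 * r1 * r2" using r1_pos r2_pos by simp
  have "(r1 - r2)\<^sup>2 < separation\<^sup>2" using assms(1) r2_le by (intro power_strict_mono) auto
  then show "0 < k" unfolding k_def using pos by simp
  show eq: "separation\<^sup>2 - r1\<^sup>2 - r2\<^sup>2 = 4 * r1 * r2 * k - 2 * r1 * r2"
  proof -
    have "4 * r1 * r2 \<noteq> 0" using r1_pos r2_pos by simp
    then have "4 * r1 * r2 * k = separation\<^sup>2 - (r1 - r2)\<^sup>2"
      by (simp only: k_def times_divide_eq_right nonzero_mult_div_cancel_left not_False_eq_True)
    then show ?thesis by (simp add: power2_eq_square algebra_simps)
  qed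
  show "k < 1" if "separation < r1 + r2"
  proof -
    have "separation\<^sup>2 < (r1 + r2)\<^sup>2" using that separation_pos by (intro power_strict_mono) auto
    then show ?thesis unfolding k_def using pos by (simp add: power2_eq_square algebra_simps)
  qed
  show "k = 1" if "separation = r1 + r2"
    unfolding k_def that using r1_pos r2_pos by (simp add: power2_eq_square algebra_simps)
qed

lemma crossing_spheres:
  assumes "r1 - r2 < separation" "separation < r1 + r2"
  shows "embedded_torus common_tangents"
proof -
  define k where "k = (separation\<^sup>2 - (r1 - r2)\<^sup>2) / (4 * r1 * r2)"
  note K = crossing_spheres_parameter[OF assms(1), folded k_def]
  have k0: "0 < k" and k1: "k < 1" by (rule K(1), rule K(3)[OF assms(2)])
  define q where "q = sqrt (4 * r1 * r2 * k)"
  have q: "0 < q" "q\<^sup>2 = 4 * r1 * r2 * k" using r1_pos r2_pos k0 by (auto simp: q_def)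
  define m where "m t = q * cos t" for t
  define c where "c t = 1 - 2 * k * (sin t)\<^sup>2" for t
  define s where "s t = 2 * sqrt k * sin t * sqrt (1 - k * (sin t)\<^sup>2)" for t
  have bound: "0 < 1 - k * x" if "x \<le> 1" "0 \<le> x" for x
    using that k0 k1 mult_left_mono[of x 1 k] by linarith
  have pos: "0 < 1 - k * (sin t)\<^sup>2" for t
    by (rule bound) (auto simp: abs_square_le_1)
  have s2: "(s t)\<^sup>2 = 4 * k * (sin t)\<^sup>2 * (1 - k * (sin t)\<^sup>2)" for t
    using pos[of t] k0 by (simp add: s_def power_mult_distrib)
  interpret invariant_curve c1 c2 r1 r2 a e m c s
  proof
    fix t
    have "(c t)\<^sup>2 + (s t)\<^sup>2 = 1"
      unfolding s2 c_def by (simp add: power2_eq_square algebra_simps)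
    moreover have "(m t)\<^sup>2 = separation\<^sup>2 - r1\<^sup>2 - r2\<^sup>2 + 2 * r1 * r2 * c t"
      unfolding K(2) c_def m_def power_mult_distrib q(2) cos_squared_eq by (simp add: algebra_simps)
    ultimately show "admissible (m t) (c t) (s t)" by (simp add: admissible_def)
    show "C_k n m" "C_k n c" "C_k n s" for n
      unfolding m_def[abs_def] c_def[abs_def] s_def[abs_def] by (intro C_k_intros pos)+
    show "m (t + 2 * pi) = m t" "c (t + 2 * pi) = c t" "s (t + 2 * pi) = s t"
      by (simp_all add: m_def c_def s_def)
    let ?s' = "2 * sqrt k * (cos t * sqrt (1 - k * (sin t)\<^sup>2) + sin t * (- (k * (2 * sin t * cos t)) * (inverse (sqrt (1 - k * (sin t)\<^sup>2)) / 2)))"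
    have "(m has_real_derivative q * - sin t) (at t)" "(c has_real_derivative - (2 * k * (2 * sin t * cos t))) (at t)"
      unfolding m_def[abs_def] c_def[abs_def] by (auto intro!: derivative_eq_intros)
    moreover have "(s has_real_derivative ?s') (at t)"
      unfolding s_def[abs_def] using pos[of t] by (auto intro!: derivative_eq_intros simp: algebra_simps)
    moreover have "q * - sin t \<noteq> 0 \<or> ?s' \<noteq> 0"
    proof (cases "sin t = 0")
      case True
      then have "cos t \<noteq> 0" using sin_zero_abs_cos_one by force
      then show ?thesis using True k0 by simp
    qed (use q in simp)
    ultimately show "\<exists>m' c' s'. (m has_real_derivative m') (at t) \<and> (c has_real_derivative c') (at t)
      \<and> (s has_real_derivative s') (at t) \<and> (m' \<noteq> 0 \<or> c' \<noteq> 0 \<or> s' \<noteq> 0)" by blast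
  qed
  have "common_tangents \<subseteq> range torus"
  proof
    fix \<gamma> assume \<gamma>: "\<gamma> \<in> common_tangents"
    define x where "x = height \<gamma> / q"
    have h: "height \<gamma> = q * x" using q by (simp add: x_def)
    have "4 * r1 * r2 * (k * x\<^sup>2) = 4 * r1 * r2 * k - 2 * r1 * r2 + 2 * r1 * r2 * cosine \<gamma>"
      using height_sq[OF \<gamma>] unfolding h K(2) power_mult_distrib q(2) by (simp add: algebra_simps)
    also have "\<dots> = 4 * r1 * r2 * (k - (1 - cosine \<gamma>) / 2)"
      by (simp add: algebra_simps diff_divide_distrib)
    finally have "k * x\<^sup>2 = k - (1 - cosine \<gamma>) / 2"
      using r1_pos r2_pos by (simp only: mult_cancel_left) auto
    then have c: "cosine \<gamma> = 1 - 2 * k * (1 - x\<^sup>2)" by (simp add: field_simps)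
    then have "0 \<le> k * (1 - x\<^sup>2)" using cosine_le_1[OF \<gamma>] by simp
    then have x2: "0 \<le> 1 - x\<^sup>2" using k0 by (simp add: zero_le_mult_iff)
    have D: "0 < 1 - k * (1 - x\<^sup>2)" by (rule bound) (use x2 in auto)
    define y where "y = sine \<gamma> / (2 * sqrt k * sqrt (1 - k * (1 - x\<^sup>2)))"
    have s: "sine \<gamma> = 2 * sqrt k * y * sqrt (1 - k * (1 - x\<^sup>2))"
      using k0 D by (simp add: y_def)
    have "(sine \<gamma>)\<^sup>2 = 4 * k * (1 - x\<^sup>2) * (1 - k * (1 - x\<^sup>2))"
      using cosine_sine[OF \<gamma>] unfolding c by (simp add: power2_eq_square algebra_simps)
    then have "(4 * k * (1 - k * (1 - x\<^sup>2))) * y\<^sup>2 = (4 * k * (1 - k * (1 - x\<^sup>2))) * (1 - x\<^sup>2)"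
      unfolding s using k0 D by (simp add: power_mult_distrib algebra_simps)
    then have y: "y\<^sup>2 = 1 - x\<^sup>2" using k0 D by (simp only: mult_cancel_left) auto
    then have "x\<^sup>2 + y\<^sup>2 = 1" by simp
    then obtain t where t: "x = cos t" "y = sin t" by (rule sincos_total_2pi)
    have "height \<gamma> = m t" "cosine \<gamma> = c t" "sine \<gamma> = s t"
      unfolding h c s y[symmetric] unfolding t m_def c_def s_def by simp_all
    then show "\<gamma> \<in> range torus" unfolding range_torus using \<gamma> by blast
  qed
  then have "range torus = common_tangents" using torus_in by blast
  moreover have "inj_on (\<lambda>t. (m t, c t, s t)) {0..<2 * pi}"
  proof (rule inj_onI)
    fix t t' assume t: "t \<in> {0..<2 * pi}" "t' \<in> {0..<2 * pi}" and eq: "(m t, c t, s t) = (m t', c t', s t')"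
    then have cos: "cos t = cos t'" using q by (simp add: m_def)
    then have "(sin t)\<^sup>2 = (sin t')\<^sup>2" by (simp add: sin_squared_eq)
    then have "sin t = sin t'" using eq pos[of t'] k0 by (simp add: s_def)
    then show "t = t'" using cos t by (intro cis_inj_on_period) (auto simp: complex_eq_iff)
  qed
  ultimately show ?thesis using embedded_torus_range by simp
qed

text \<open>
  For \<open>k = 1\<close> the parameter is \<open>t = \<theta>/2\<close>, and the curve passes through the crossing point, where the
  height vanishes, at \<open>t = \<pi>/2\<close> and at \<open>t = 3\<pi>/2\<close>.
\<close>
lemma touching_spheres:
  assumes "separation = r1 + r2"
  shows "immersed_torus common_tangents"
proof -
  have lt: "r1 - r2 < separation" using assms r2_pos by simp
  note K = crossing_spheres_parameter[OF lt]
  have K2: "separation\<^sup>2 - r1\<^sup>2 - r2\<^sup>2 = 2 * r1 * r2" using K(2) K(4)[OF assms] by simp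
  define q where "q = sqrt (4 * r1 * r2)"
  have q: "0 < q" "q\<^sup>2 = 4 * r1 * r2" using r1_pos r2_pos by (auto simp: q_def)
  define m where "m t = q * cos t" for t
  define c where "c t = cos (2 * t)" for t :: real
  define s where "s t = sin (2 * t)" for t :: real
  interpret invariant_curve c1 c2 r1 r2 a e m c s
  proof
    fix t
    have "(m t)\<^sup>2 = separation\<^sup>2 - r1\<^sup>2 - r2\<^sup>2 + 2 * r1 * r2 * c t"
      unfolding K2 c_def m_def power_mult_distrib q(2) cos_double_cos by (simp add: algebra_simps)
    then show "admissible (m t) (c t) (s t)" by (simp add: admissible_def c_def s_def)
    show "C_k n m" "C_k n c" "C_k n s" for n
      unfolding m_def[abs_def] c_def[abs_def] s_def[abs_def] by (intro C_k_intros)+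
    have "2 * (t + 2 * pi) = (2 * t + 2 * pi) + 2 * pi" by simp
    then show "m (t + 2 * pi) = m t" "c (t + 2 * pi) = c t" "s (t + 2 * pi) = s t"
      unfolding m_def c_def s_def by (simp_all only: sin_periodic cos_periodic)
    have "(m has_real_derivative q * - sin t) (at t)" "(c has_real_derivative - (2 * sin (2 * t))) (at t)"
      "(s has_real_derivative 2 * cos (2 * t)) (at t)"
      unfolding m_def[abs_def] c_def[abs_def] s_def[abs_def] by (auto intro!: derivative_eq_intros)
    moreover have "- (2 * sin (2 * t)) \<noteq> 0 \<or> 2 * cos (2 * t) \<noteq> 0"
      using sin_zero_abs_cos_one[of "2 * t"] by force
    ultimately show "\<exists>m' c' s'. (m has_real_derivative m') (at t) \<and> (c has_real_derivative c') (at t)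
      \<and> (s has_real_derivative s') (at t) \<and> (m' \<noteq> 0 \<or> c' \<noteq> 0 \<or> s' \<noteq> 0)" by blast
  qed
  have "common_tangents \<subseteq> range torus"
  proof
    fix \<gamma> assume \<gamma>: "\<gamma> \<in> common_tangents"
    obtain \<theta> where \<theta>: "cosine \<gamma> = cos \<theta>" "sine \<gamma> = sin \<theta>"
      using sincos_total_2pi[OF cosine_sine[OF \<gamma>]] by blast
    have "cos \<theta> = 2 * (cos (\<theta> / 2))\<^sup>2 - 1" using cos_double_cos[of "\<theta> / 2"] by simp
    then have "(height \<gamma>)\<^sup>2 = q\<^sup>2 * (cos (\<theta> / 2))\<^sup>2"
      using height_sq[OF \<gamma>] unfolding K2 q(2) \<theta> by (simp only:) (simp add: algebra_simps)
    then have "(height \<gamma>)\<^sup>2 = (q * cos (\<theta> / 2))\<^sup>2" by (simp add: power_mult_distrib)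
    then consider "height \<gamma> = m (\<theta> / 2)" | "height \<gamma> = m (\<theta> / 2 + pi)"
      unfolding m_def power2_eq_iff by force
    moreover have "cosine \<gamma> = c (\<theta> / 2)" "cosine \<gamma> = c (\<theta> / 2 + pi)" "sine \<gamma> = s (\<theta> / 2)" "sine \<gamma> = s (\<theta> / 2 + pi)"
      by (simp_all add: c_def s_def \<theta> distrib_left)
    ultimately show "\<gamma> \<in> range torus" unfolding range_torus using \<gamma> by blast
  qed
  then have "range torus = common_tangents" using torus_in by blast
  then show ?thesis using torus_immersion_torus unfolding immersed_torus_def by blast
qed

text \<open>
  For separated spheres the height never vanishes, and each of its signs gives a curve that is a
  graph over the circle of angles between the contact normals.
\<close>
lemma separated_spheres_height:
  assumes "r1 + r2 < separation" "- 1 \<le> x"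
  shows "0 < separation\<^sup>2 - r1\<^sup>2 - r2\<^sup>2 + 2 * r1 * r2 * x"
proof -
  have "(r1 + r2)\<^sup>2 < separation\<^sup>2" using assms(1) r1_pos r2_pos by (intro power_strict_mono) auto
  moreover have "2 * r1 * r2 * (- 1) \<le> 2 * r1 * r2 * x" using assms(2) r1_pos r2_pos by (intro mult_left_mono) auto
  ultimately show ?thesis by (simp add: power2_sum)
qed

lemma separated_spheres_half:
  assumes sep: "r1 + r2 < separation" and sgn: "\<sigma> = 1 \<or> \<sigma> = - 1"
  shows "embedded_torus {\<gamma> \<in> common_tangents. 0 < \<sigma> * height \<gamma>}"
proof -
  define h where "h x = separation\<^sup>2 - r1\<^sup>2 - r2\<^sup>2 + 2 * r1 * r2 * x" for x
  have h: "0 < h (cos t)" for t unfolding h_def by (rule separated_spheres_height[OF sep]) simp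
  define m where "m t = \<sigma> * sqrt (h (cos t))" for t
  have \<sigma>: "\<sigma>\<^sup>2 = 1" using sgn by auto
  interpret invariant_curve c1 c2 r1 r2 a e m cos sin
  proof
    fix t :: real
    have "(m t)\<^sup>2 = h (cos t)" using h[of t] \<sigma> by (simp add: m_def power_mult_distrib)
    then show "admissible (m t) (cos t) (sin t)" by (simp add: admissible_def h_def)
    have "C_k n (\<lambda>t::real. h (cos t))" for n unfolding h_def by (intro C_k_intros)
    then show "C_k n m" for n
      unfolding m_def[abs_def] by (intro C_k_mult C_k_const C_k_sqrt h)
    show "C_k n (cos :: real \<Rightarrow> real)" "C_k n (sin :: real \<Rightarrow> real)" for n
      using C_k_sin_cos[OF C_k_bounded_linear[OF bounded_linear_ident, of n]] by simp_all
    show "m (t + 2 * pi) = m t" "cos (t + 2 * pi) = cos t" "sin (t + 2 * pi) = sin t"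
      by (simp_all add: m_def)
    have "(m has_real_derivative \<sigma> * (2 * r1 * r2 * - sin t * (inverse (sqrt (h (cos t))) / 2))) (at t)"
      unfolding m_def[abs_def] h_def[abs_def] using h[of t, unfolded h_def]
      by (auto intro!: derivative_eq_intros simp: field_simps)
    moreover have "- sin t \<noteq> 0 \<or> cos t \<noteq> 0" using sin_zero_abs_cos_one[of t] by force
    ultimately show "\<exists>m' c' s'. (m has_real_derivative m') (at t) \<and> (cos has_real_derivative c') (at t)
      \<and> (sin has_real_derivative s') (at t) \<and> (m' \<noteq> 0 \<or> c' \<noteq> 0 \<or> s' \<noteq> 0)"
      using DERIV_cos[of t] DERIV_sin[of t] by blast
  qed
  have "range torus = {\<gamma> \<in> common_tangents. 0 < \<sigma> * height \<gamma>}"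
  proof (intro set_eqI iffI)
    fix \<gamma> assume "\<gamma> \<in> range torus"
    then obtain t where \<gamma>: "\<gamma> \<in> common_tangents" "height \<gamma> = m t" unfolding range_torus by blast
    have "\<sigma> * m t = sqrt (h (cos t))" using \<sigma> by (simp add: m_def power2_eq_square mult.assoc[symmetric])
    then show "\<gamma> \<in> {\<gamma> \<in> common_tangents. 0 < \<sigma> * height \<gamma>}" using \<gamma> h[of t] by simp
  next
    fix \<gamma> assume "\<gamma> \<in> {\<gamma> \<in> common_tangents. 0 < \<sigma> * height \<gamma>}"
    then have \<gamma>: "\<gamma> \<in> common_tangents" and pos: "0 < \<sigma> * height \<gamma>" by auto
    obtain t where t: "cosine \<gamma> = cos t" "sine \<gamma> = sin t"
      using sincos_total_2pi[OF cosine_sine[OF \<gamma>]] by blast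
    have "(\<sigma> * height \<gamma>)\<^sup>2 = h (cos t)"
      using height_sq[OF \<gamma>] \<sigma> by (simp add: power_mult_distrib t h_def)
    then have "\<sigma> * height \<gamma> = sqrt (h (cos t))" using pos by (metis abs_of_pos real_sqrt_abs)
    then have "height \<gamma> = m t" using sgn by (auto simp: m_def)
    then show "\<gamma> \<in> range torus" unfolding range_torus using \<gamma> t by blast
  qed
  moreover have "inj_on (\<lambda>t. (m t, cos t, sin t)) {0..<2 * pi}"
    by (rule inj_onI) (auto intro!: cis_inj_on_period simp: complex_eq_iff)
  ultimately show ?thesis using embedded_torus_range by simp
qed

lemma separated_spheres_height_nonzero:
  assumes "r1 + r2 < separation" "\<gamma> \<in> common_tangents"
  shows "height \<gamma> \<noteq> 0"
proof -
  have "(cosine \<gamma>)\<^sup>2 \<le> 1" using cosine_sine[OF assms(2)] zero_le_power2[of "sine \<gamma>"] by linarith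
  then have "- 1 \<le> cosine \<gamma>" by (auto simp: abs_square_le_1 abs_le_iff)
  from separated_spheres_height[OF assms(1) this] height_sq[OF assms(2)] show ?thesis by auto
qed

lemma separated_spheres:
  assumes "r1 + r2 < separation"
  shows "disjoint_embedded_tori common_tangents"
proof -
  have "common_tangents = {\<gamma> \<in> common_tangents. 0 < 1 * height \<gamma>} \<union> {\<gamma> \<in> common_tangents. 0 < - 1 * height \<gamma>}"
    using separated_spheres_height_nonzero[OF assms] by force
  moreover have "{\<gamma> \<in> common_tangents. 0 < 1 * height \<gamma>} \<inter> {\<gamma> \<in> common_tangents. 0 < - 1 * height \<gamma>} = {}"
    by auto
  moreover note separated_spheres_half[OF assms, of 1] separated_spheres_half[OF assms, of "- 1"]
  ultimately show ?thesis unfolding disjoint_embedded_tori_def by blast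
qed

end

section \<open>Coordinates on the space of oriented lines\<close>

lemma has_derivative_vector_3:
  fixes f g h :: "_ \<Rightarrow> real"
  assumes "(f has_derivative f') F" "(g has_derivative g') F" "(h has_derivative h') F"
  shows "((\<lambda>x. vector [f x, g x, h x] :: real^3) has_derivative (\<lambda>v. vector [f' v, g' v, h' v])) F"
proof -
  have eq: "vector [x, y, z] = x *\<^sub>R axis 1 1 + y *\<^sub>R axis 2 1 + z *\<^sub>R (axis 3 1 :: real^3)" for x y z
    by (simp add: vec_eq_iff forall_3 axis_def)
  show ?thesis unfolding eq by (intro derivative_intros assms)
qed

lemma vec3_eq_iff: "(x :: real^3) = y \<longleftrightarrow> x $ 1 = y $ 1 \<and> x $ 2 = y $ 2 \<and> x $ 3 = y $ 3"
  by (simp add: vec_eq_iff forall_3)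

lemma inner3: "(x :: real^3) \<bullet> y = x $ 1 * y $ 1 + x $ 2 * y $ 2 + x $ 3 * y $ 3"
  by (simp add: inner_vec_def sum_3)

definition denom :: "complex \<Rightarrow> real" where "denom \<xi> = 1 + (cmod \<xi>)\<^sup>2"

lemma denom_pos: "0 < denom \<xi>" "denom \<xi> \<noteq> 0"
  by (simp_all add: denom_def add_pos_nonneg add_nonneg_eq_0_iff)

lemma denom_eq: "denom \<xi> = 1 + (Re \<xi>)\<^sup>2 + (Im \<xi>)\<^sup>2"
  by (simp add: denom_def cmod_power2)

lemma line_dir_nth:
  "line_dir \<xi> $ 1 = 2 * Re \<xi> / denom \<xi>" "line_dir \<xi> $ 2 = 2 * Im \<xi> / denom \<xi>"
  "line_dir \<xi> $ 3 = 2 / denom \<xi> - 1"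
  using denom_pos(2)[of \<xi>] by (simp_all add: line_dir_def denom_def[symmetric] field_simps)

lemma line_foot_nth:
  "line_foot \<xi> \<eta> $ 1 = 2 * Re \<eta> / denom \<xi> - 4 * Re \<xi> * Re (cnj \<xi> * \<eta>) / (denom \<xi>)\<^sup>2"
  "line_foot \<xi> \<eta> $ 2 = 2 * Im \<eta> / denom \<xi> - 4 * Im \<xi> * Re (cnj \<xi> * \<eta>) / (denom \<xi>)\<^sup>2"
  "line_foot \<xi> \<eta> $ 3 = - 4 * Re (cnj \<xi> * \<eta>) / (denom \<xi>)\<^sup>2"
proof -
  have split: "x / denom \<xi> = x * denom \<xi> / (denom \<xi>)\<^sup>2" for x
    using denom_pos(2)[of \<xi>] by (simp add: power2_eq_square)
  show "line_foot \<xi> \<eta> $ 1 = 2 * Re \<eta> / denom \<xi> - 4 * Re \<xi> * Re (cnj \<xi> * \<eta>) / (denom \<xi>)\<^sup>2"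
    "line_foot \<xi> \<eta> $ 2 = 2 * Im \<eta> / denom \<xi> - 4 * Im \<xi> * Re (cnj \<xi> * \<eta>) / (denom \<xi>)\<^sup>2"
    unfolding split diff_divide_distrib[symmetric] line_foot_def denom_def[symmetric]
    by (simp_all add: denom_eq power2_eq_square) (simp_all add: algebra_simps)
  show "line_foot \<xi> \<eta> $ 3 = - 4 * Re (cnj \<xi> * \<eta>) / (denom \<xi>)\<^sup>2"
    unfolding line_foot_def denom_def[symmetric] by (simp add: algebra_simps)
qed

text \<open>Inverse stereographic projection is conformal and orientation preserving.\<close>
lemma stereographic:
  "line_dir \<xi> \<bullet> line_dir \<xi> = 1" "line_dir \<xi> \<bullet> line_foot \<xi> a = 0"
  "line_foot \<xi> a \<bullet> line_foot \<xi> b = 4 / (denom \<xi>)\<^sup>2 * Re (cnj a * b)"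
  "line_dir \<xi> \<times> line_foot \<xi> a = line_foot \<xi> (\<i> * a)"
proof -
  define x y k where "x = Re \<xi>" and "y = Im \<xi>" and "k = denom \<xi>"
  have k: "k \<noteq> 0" and ky: "y\<^sup>2 = k - 1 - x\<^sup>2" using denom_pos denom_eq by (auto simp: k_def x_def y_def)
  note nth = line_dir_nth line_foot_nth x_def[symmetric] y_def[symmetric] k_def[symmetric]
  show "line_dir \<xi> \<bullet> line_dir \<xi> = 1"
    unfolding inner3 nth using k by (simp add: field_simps) (use ky in algebra)
  show "line_dir \<xi> \<bullet> line_foot \<xi> a = 0"
    unfolding inner3 nth using k by (simp add: nth field_simps) (use ky in algebra)
  show "line_foot \<xi> a \<bullet> line_foot \<xi> b = 4 / (denom \<xi>)\<^sup>2 * Re (cnj a * b)"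
    unfolding inner3 nth using k by (simp add: nth field_simps) (use ky in algebra)
  show "line_dir \<xi> \<times> line_foot \<xi> a = line_foot \<xi> (\<i> * a)"
    unfolding vec3_eq_iff cross_components nth using k
    by (intro conjI; simp add: nth power2_eq_square field_simps)
      (use ky[unfolded power2_eq_square] in algebra)+
qed

lemma line_dir_derivative: "(line_dir has_derivative line_foot \<xi>) (at \<xi>)"
proof -
  have ld: "line_dir = (\<lambda>\<xi>. vector [2 * Re \<xi> / denom \<xi>, 2 * Im \<xi> / denom \<xi>, 2 / denom \<xi> - 1])"
    by (rule ext) (simp add: vec3_eq_iff line_dir_nth)
  have k: "(denom has_derivative (\<lambda>a. 2 * Re (cnj \<xi> * a))) (at \<xi>)"
    unfolding denom_eq[abs_def] by (auto intro!: derivative_eq_intros)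
  note nz = denom_pos(2)[of \<xi>]
  have 1: "((\<lambda>\<xi>. 2 * Re \<xi> / denom \<xi>) has_derivative (\<lambda>a. line_foot \<xi> a $ 1)) (at \<xi>)"
    using nz by (auto intro!: derivative_eq_intros k simp: line_foot_nth field_simps power2_eq_square)
  have 2: "((\<lambda>\<xi>. 2 * Im \<xi> / denom \<xi>) has_derivative (\<lambda>a. line_foot \<xi> a $ 2)) (at \<xi>)"
    using nz by (auto intro!: derivative_eq_intros k simp: line_foot_nth field_simps power2_eq_square)
  have 3: "((\<lambda>\<xi>. 2 / denom \<xi> - 1) has_derivative (\<lambda>a. line_foot \<xi> a $ 3)) (at \<xi>)"
    using nz by (auto intro!: derivative_eq_intros k simp: line_foot_nth field_simps power2_eq_square)
  have "vector [line_foot \<xi> a $ 1, line_foot \<xi> a $ 2, line_foot \<xi> a $ 3] = line_foot \<xi> a" for a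
    by (simp add: vec3_eq_iff)
  with has_derivative_vector_3[OF 1 2 3] show ?thesis unfolding ld by simp
qed

text \<open>
  The tangential part of the derivative of the foot point is the covariant derivative of the
  tangent vector \<open>\<eta>\<close>; the Christoffel symbol of the round metric in a conformal coordinate is
  \<open>- 2 * cnj \<xi> / denom \<xi>\<close>.
\<close>
definition covariant :: "complex \<times> complex \<Rightarrow> complex \<times> complex \<Rightarrow> complex" where
  "covariant p X = snd X - 2 * cnj (fst p) * snd p * fst X / denom (fst p)"

definition north_derivative :: "complex \<times> complex \<Rightarrow> complex \<times> complex \<Rightarrow> (real^3) \<times> (real^3)" where
  "north_derivative p X = (line_foot (fst p) (fst X), line_foot (fst p) (covariant p X)
     - (line_foot (fst p) (fst X) \<bullet> line_foot (fst p) (snd p)) *\<^sub>R line_dir (fst p))"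

lemma line_foot_derivative:
  "((\<lambda>p. line_foot (fst p) (snd p)) has_derivative (\<lambda>X. snd (north_derivative p X))) (at p)"
proof -
  obtain \<xi> \<eta> where p: "p = (\<xi>, \<eta>)" by fastforce
  have lf: "(\<lambda>p. line_foot (fst p) (snd p)) = (\<lambda>p. vector
      [2 * Re (snd p) / denom (fst p) - 4 * Re (fst p) * Re (cnj (fst p) * snd p) / (denom (fst p))\<^sup>2,
       2 * Im (snd p) / denom (fst p) - 4 * Im (fst p) * Re (cnj (fst p) * snd p) / (denom (fst p))\<^sup>2,
       2 * 0 / denom (fst p) - 4 * 1 * Re (cnj (fst p) * snd p) / (denom (fst p))\<^sup>2])"
    by (rule ext) (simp add: vec3_eq_iff line_foot_nth minus_divide_left)
  define x y u v k where "x = Re \<xi>" and "y = Im \<xi>" and "u = Re \<eta>" and "v = Im \<eta>" and "k = denom \<xi>"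
  have k: "k \<noteq> 0" and ky: "y\<^sup>2 = k - 1 - x\<^sup>2" using denom_pos denom_eq by (auto simp: k_def x_def y_def)
  have kd: "((\<lambda>p. denom (fst p)) has_derivative (\<lambda>X. 2 * Re (cnj \<xi> * fst X))) (at p)"
    unfolding denom_eq[abs_def] p by (auto intro!: derivative_eq_intros)
  have sd: "((\<lambda>p. Re (cnj (fst p) * snd p)) has_derivative
      (\<lambda>X. Re (cnj \<xi> * snd X) + Re (cnj (fst X) * \<eta>))) (at p)"
    unfolding p by (auto intro!: derivative_eq_intros)
  have d: "((\<lambda>p. 2 * g p / denom (fst p) - 4 * f p * Re (cnj (fst p) * snd p) / (denom (fst p))\<^sup>2) has_derivative
      (\<lambda>X. 2 * g' X / k - 2 * g p * (2 * Re (cnj \<xi> * fst X)) / k\<^sup>2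
        - 4 * (f' X * Re (cnj \<xi> * \<eta>) + f p * (Re (cnj \<xi> * snd X) + Re (cnj (fst X) * \<eta>))) / k\<^sup>2
        + 8 * f p * Re (cnj \<xi> * \<eta>) * (2 * Re (cnj \<xi> * fst X)) / k ^ 3)) (at p)"
    if f: "(f has_derivative f') (at p)" and g: "(g has_derivative g') (at p)"
    for f g :: "complex \<times> complex \<Rightarrow> real" and f' g'
  proof (rule has_derivative_eq_rhs)
    show "((\<lambda>p. 2 * g p / denom (fst p) - 4 * f p * Re (cnj (fst p) * snd p) / (denom (fst p))\<^sup>2) has_derivative
      (\<lambda>X. (2 * g' X * denom (fst p) - 2 * g p * (2 * Re (cnj \<xi> * fst X))) / (denom (fst p) * denom (fst p))
        - ((4 * f p * (Re (cnj \<xi> * snd X) + Re (cnj (fst X) * \<eta>)) + 4 * f' X * Re (cnj (fst p) * snd p)) * (denom (fst p))\<^sup>2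
          - 4 * f p * Re (cnj (fst p) * snd p) * (2 * denom (fst p) * (2 * Re (cnj \<xi> * fst X))))
          / ((denom (fst p))\<^sup>2 * (denom (fst p))\<^sup>2))) (at p)"
      by (intro has_derivative_diff has_derivative_divide' has_derivative_mult has_derivative_mult_right
          f g kd sd) (auto intro!: derivative_eq_intros kd simp: denom_pos)
  qed (use k in \<open>auto simp: p k_def[symmetric] power2_eq_square power3_eq_cube field_simps\<close>)
  have Re_Im: "((\<lambda>p. Re (fst p)) has_derivative (\<lambda>X. Re (fst X))) (at p)" "((\<lambda>p. Im (fst p)) has_derivative (\<lambda>X. Im (fst X))) (at p)"
    "((\<lambda>p. Re (snd p)) has_derivative (\<lambda>X. Re (snd X))) (at p)" "((\<lambda>p. Im (snd p)) has_derivative (\<lambda>X. Im (snd X))) (at p)"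
    for p :: "complex \<times> complex"
    by (auto intro!: derivative_eq_intros)
  note nth = north_derivative_def covariant_def line_foot_nth line_dir_nth stereographic(3)
  note fold = x_def[symmetric] y_def[symmetric] u_def[symmetric] v_def[symmetric] k_def[symmetric]
  have 1: "((\<lambda>p. 2 * Re (snd p) / denom (fst p) - 4 * Re (fst p) * Re (cnj (fst p) * snd p) / (denom (fst p))\<^sup>2)
      has_derivative (\<lambda>X. snd (north_derivative p X) $ 1)) (at p)"
    by (rule has_derivative_eq_rhs[OF d[OF Re_Im(1,3)]], rule ext)
      (use k in \<open>simp add: p nth fold field_simps power2_eq_square power3_eq_cube\<close>, use ky in algebra)
  have 2: "((\<lambda>p. 2 * Im (snd p) / denom (fst p) - 4 * Im (fst p) * Re (cnj (fst p) * snd p) / (denom (fst p))\<^sup>2)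
      has_derivative (\<lambda>X. snd (north_derivative p X) $ 2)) (at p)"
    by (rule has_derivative_eq_rhs[OF d[OF Re_Im(2,4)]], rule ext)
      (use k in \<open>simp add: p nth fold field_simps power2_eq_square power3_eq_cube\<close>, use ky in algebra)
  have 3: "((\<lambda>p. 2 * 0 / denom (fst p) - 4 * 1 * Re (cnj (fst p) * snd p) / (denom (fst p))\<^sup>2)
      has_derivative (\<lambda>X. snd (north_derivative p X) $ 3)) (at p)"
    by (rule has_derivative_eq_rhs[OF d[OF has_derivative_const has_derivative_const]], rule ext)
      (use k in \<open>simp add: p nth fold field_simps power2_eq_square power3_eq_cube\<close>, use ky in algebra)
  have "vector [w $ 1, w $ 2, w $ 3] = (w :: real^3)" for w by (simp add: vec3_eq_iff)
  with has_derivative_vector_3[OF 1 2 3] show ?thesis unfolding lf by (simp only:)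
qed

lemma north_param_in: "north_param p \<in> oriented_lines"
  by (cases p) (simp add: north_param_def oriented_lines_def norm_eq_1 stereographic)

lemma north_param_derivative: "(north_param has_derivative north_derivative p) (at p)"
proof -
  have eq: "north_param = (\<lambda>p. (line_dir (fst p), line_foot (fst p) (snd p)))"
    by (rule ext) (simp add: north_param_def case_prod_unfold)
  have "((\<lambda>p. line_dir (fst p)) has_derivative (\<lambda>X. line_foot (fst p) (fst X))) (at p)"
    using diff_chain_at[OF bounded_linear_imp_has_derivative[OF bounded_linear_fst] line_dir_derivative]
    by (simp add: o_def)
  from has_derivative_Pair[OF this line_foot_derivative] show ?thesis
    unfolding eq by (simp add: north_derivative_def[abs_def])
qed

text \<open>
  The complex structure acts on horizontal and vertical parts of a variation by the rotation
  \<open>u \<times> _\<close>, and the metric is \<open>- det (u, u', v') / 2\<close>, polarized.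
\<close>
lemma north_derivative_complex_structure:
  "fst (north_derivative p (complex_structure X)) = fst (north_param p) \<times> fst (north_derivative p X)"
  "\<exists>k. snd (north_derivative p (complex_structure X)) =
     fst (north_param p) \<times> snd (north_derivative p X) + k *\<^sub>R fst (north_param p)"
proof -
  have cov: "covariant p (complex_structure X) = \<i> * covariant p X"
    by (simp add: covariant_def complex_structure_def algebra_simps)
  have u: "fst (north_param p) = line_dir (fst p)" by (simp add: north_param_def case_prod_unfold)
  show "fst (north_derivative p (complex_structure X)) = fst (north_param p) \<times> fst (north_derivative p X)"
    by (simp add: north_derivative_def u stereographic(4) complex_structure_def)
  have "fst (north_param p) \<times> snd (north_derivative p X) = line_foot (fst p) (\<i> * covariant p X)"
    by (simp add: north_derivative_def u Cross3.right_diff_distrib cross_mult_right stereographic(4))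
  then show "\<exists>k. snd (north_derivative p (complex_structure X)) =
     fst (north_param p) \<times> snd (north_derivative p X) + k *\<^sub>R fst (north_param p)"
    unfolding u by (intro exI[of _ "- (line_foot (fst p) (fst (complex_structure X)) \<bullet> line_foot (fst p) (snd p))"])
      (simp add: north_derivative_def cov)
qed

lemma neutral_metric_eq_det:
  "neutral_metric p X Y = - (1 / 4) *
     (fst (north_param p) \<bullet> (fst (north_derivative p X) \<times> snd (north_derivative p Y))
      + fst (north_param p) \<bullet> (fst (north_derivative p Y) \<times> snd (north_derivative p X)))"
proof -
  obtain \<xi> \<eta> where p: "p = (\<xi>, \<eta>)" by fastforce
  obtain a b where X: "X = (a, b)" by fastforce
  obtain a' b' where Y: "Y = (a', b')" by fastforce
  have u: "fst (north_param p) = line_dir \<xi>" by (simp add: north_param_def p)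
  have det: "line_dir \<xi> \<bullet> (line_foot \<xi> z \<times> (line_foot \<xi> w - k *\<^sub>R line_dir \<xi>)) = - 4 / (denom \<xi>)\<^sup>2 * Im (z * cnj w)" for z w k
  proof -
    have "line_dir \<xi> \<bullet> (line_foot \<xi> z \<times> (line_foot \<xi> w - k *\<^sub>R line_dir \<xi>)) = (line_dir \<xi> \<times> line_foot \<xi> z) \<bullet> line_foot \<xi> w"
      using cross_triple[of "line_dir \<xi>" "line_foot \<xi> z" "line_foot \<xi> w"]
      by (simp add: Cross3.right_diff_distrib cross_mult_right inner_diff_right dot_cross_self inner_commute)
    also have "\<dots> = 4 / (denom \<xi>)\<^sup>2 * Re (cnj (\<i> * z) * w)"
      unfolding stereographic(3,4) ..
    also have "Re (cnj (\<i> * z) * w) = - Im (z * cnj w)" by (simp add: algebra_simps)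
    finally show ?thesis by (simp only: mult_minus_right mult_minus_left minus_divide_left)
  qed
  define r where "r = 1 / denom \<xi>"
  have r: "x / denom \<xi> = x * r" "x / (denom \<xi>)\<^sup>2 = x * r\<^sup>2" for x
    by (simp_all add: r_def power_divide)
  have m: "neutral_metric p X Y = 1 / (denom \<xi>)\<^sup>2 *
      (Im (cnj b * a' + cnj b' * a) + 2 * Im (cnj \<xi> * \<eta> * (a * cnj a' + a' * cnj a)) / denom \<xi>)"
  proof -
    have "2 * cnj \<xi> * \<eta> / complex_of_real (denom \<xi>) * z = 2 * (cnj \<xi> * \<eta> * z) / complex_of_real (denom \<xi>)" for z
      by (simp add: mult.assoc)
    moreover have "Im (2 * w) = 2 * Im w" for w by simp
    ultimately show ?thesis
      unfolding neutral_metric_def p X Y prod.case denom_def[symmetric]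
      by (simp only: plus_complex.sel Im_divide_of_real)
  qed
  have d: "Im (z * cnj (w - 2 * cnj \<xi> * \<eta> * y / complex_of_real (denom \<xi>)))
      = Im (z * cnj w) - 2 * Im (z * cnj (cnj \<xi> * \<eta> * y)) / denom \<xi>" for z w y
    by (simp add: right_diff_distrib diff_divide_distrib add_divide_distrib algebra_simps)
  show ?thesis
    unfolding m u north_derivative_def covariant_def
    unfolding p X Y fst_conv snd_conv det d
    unfolding r by (simp add: algebra_simps)
qed

definition north_coords :: "(real^3) \<times> (real^3) \<Rightarrow> complex \<times> complex" where
  "north_coords \<gamma> = (let \<omega> = 1 + fst \<gamma> $ 3; \<zeta> = Complex (fst \<gamma> $ 1) (fst \<gamma> $ 2) in
     ((1 / \<omega>) *\<^sub>R \<zeta>, (1 / \<omega>\<^sup>2) *\<^sub>R (\<omega> *\<^sub>R Complex (snd \<gamma> $ 1) (snd \<gamma> $ 2) - (snd \<gamma> $ 3) *\<^sub>R \<zeta>)))"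

lemma north_coords_param: "north_coords (north_param p) = p"
proof -
  obtain \<xi> \<eta> where p: "p = (\<xi>, \<eta>)" by fastforce
  define k where "k = denom \<xi>"
  have k: "k \<noteq> 0" "(Im \<xi>)\<^sup>2 = k - 1 - (Re \<xi>)\<^sup>2" using denom_pos denom_eq by (auto simp: k_def)
  show ?thesis
    using k(1) by (simp add: north_coords_def north_param_def p line_dir_nth line_foot_nth complex_eq_iff
        k_def[symmetric] Let_def field_simps power2_eq_square)
qed

lemma north_param_coords:
  assumes "\<gamma> \<in> oriented_lines" "1 + fst \<gamma> $ 3 \<noteq> 0"
  shows "north_param (north_coords \<gamma>) = \<gamma>"
proof -
  obtain u v where \<gamma>: "\<gamma> = (u, v)" by fastforce
  define w where "w = 1 + u $ 3"
  have w: "w \<noteq> 0" and u3: "u $ 3 = w - 1" using assms(2) by (auto simp: \<gamma> w_def)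
  obtain \<xi> \<eta> where c: "north_coords \<gamma> = (\<xi>, \<eta>)" by fastforce
  then have re: "Re \<xi> = u $ 1 / w" "Im \<xi> = u $ 2 / w"
    by (auto simp: north_coords_def \<gamma> Let_def w_def)
  have uu: "(u $ 1)\<^sup>2 + (u $ 2)\<^sup>2 = 1 - (w - 1)\<^sup>2"
    using oriented_linesD(1)[OF assms(1)] by (simp add: \<gamma> inner3 u3 power2_eq_square)
  have "denom \<xi> = 1 + ((u $ 1)\<^sup>2 + (u $ 2)\<^sup>2) / w\<^sup>2"
    by (simp add: denom_eq re power_divide add_divide_distrib)
  also have "\<dots> = 2 / w" unfolding uu using w by (simp add: field_simps power2_eq_square)
  finally have k: "denom \<xi> = 2 / w" .
  have dir: "line_dir \<xi> = u" using w by (simp add: vec3_eq_iff line_dir_nth k re u3)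
  define v' where "v' = line_foot \<xi> \<eta>"
  have p: "north_param (\<xi>, \<eta>) = (u, v')" by (simp add: north_param_def v'_def dir)
  \<comment> \<open>Both foot points are orthogonal to \<open>u\<close> and have the same coordinate.\<close>
  have "north_coords (u, v') = north_coords (u, v)" using north_coords_param[of "(\<xi>, \<eta>)"] p c \<gamma> by simp
  then have e: "w * (v $ 1) - v $ 3 * u $ 1 = w * (v' $ 1) - v' $ 3 * u $ 1"
     "w * (v $ 2) - v $ 3 * u $ 2 = w * (v' $ 2) - v' $ 3 * u $ 2"
    using w by (simp_all add: north_coords_def Let_def w_def[symmetric] complex_eq_iff)
  define D where "D = v - v'"
  have D: "w * D $ 1 = D $ 3 * u $ 1" "w * D $ 2 = D $ 3 * u $ 2"
    using e by (simp_all add: D_def algebra_simps)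
  have "u \<bullet> v = 0" "u \<bullet> v' = 0"
    using oriented_linesD(2)[OF assms(1)] oriented_linesD(2)[OF north_param_in[of "(\<xi>, \<eta>)"]] p
    by (auto simp: \<gamma>)
  then have "u \<bullet> D = 0" by (simp add: D_def inner_diff_right)
  then have "w * (u $ 1 * D $ 1 + u $ 2 * D $ 2 + (w - 1) * D $ 3) = 0" by (simp add: inner3 u3)
  then have "D $ 3 * ((u $ 1)\<^sup>2 + (u $ 2)\<^sup>2 + w * (w - 1)) = 0" using D by algebra
  then have "D $ 3 = 0" unfolding uu using w by (simp add: power2_eq_square algebra_simps)
  then have "D = 0" using D w by (simp add: vec3_eq_iff)
  then show ?thesis using p c by (simp add: \<gamma> D_def)
qed

lemma north_coords_differentiable:
  assumes "1 + fst \<gamma> $ 3 \<noteq> 0" shows "north_coords differentiable (at \<gamma>)"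
proof -
  have nth: "((\<lambda>\<gamma>. fst \<gamma> $ i) has_derivative (\<lambda>w. fst w $ i)) (at \<gamma>)"
    "((\<lambda>\<gamma>. snd \<gamma> $ i) has_derivative (\<lambda>w. snd w $ i)) (at \<gamma>)" for i
    by (intro bounded_linear_imp_has_derivative bounded_linear_compose[OF bounded_linear_vec_nth]
        bounded_linear_fst bounded_linear_snd)+
  show ?thesis
    unfolding north_coords_def[abs_def] differentiable_def Let_def Complex_eq
    by (rule exI) (use assms in \<open>auto intro!: derivative_eq_intros nth\<close>)
qed

lemma half_turn_linear: "bounded_linear half_turn"
proof -
  have "linear half_turn"
    by (rule linearI) (simp_all add: half_turn_def vec3_eq_iff)
  then show ?thesis by (simp add: linear_conv_bounded_linear)
qed

lemma half_turn_simps [simp]: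
  "half_turn (half_turn x) = x" "half_turn x \<bullet> half_turn y = x \<bullet> y"
  "half_turn x \<times> half_turn y = half_turn (x \<times> y)"
  by (simp_all add: half_turn_def vec3_eq_iff inner3 cross_components algebra_simps)

text \<open>
  The properties shared by the two coordinate systems: besides the derivative \<open>D\<close> there is a map \<open>N\<close>
  that recovers the coordinates of a line. It is differentiable at the line considered, and all
  lines in a neighbourhood \<open>W\<close> have coordinates. Since \<open>half_turn\<close> is a rotation, everything passes
  from the northern to the southern one.
\<close>
lemma line_chart:
  assumes "\<phi> \<in> line_params"
  obtains D N W where "(\<phi> has_derivative D) (at p)" "N differentiable (at (\<phi> p))" "\<And>q. N (\<phi> q) = q"
    "open W" "\<phi> p \<in> W" "\<forall>\<gamma>\<in>oriented_lines \<inter> W. \<phi> (N \<gamma>) = \<gamma>"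
    "\<And>X. fst (D (complex_structure X)) = fst (\<phi> p) \<times> fst (D X)"
    "\<And>X. \<exists>k. snd (D (complex_structure X)) = fst (\<phi> p) \<times> snd (D X) + k *\<^sub>R fst (\<phi> p)"
    "\<And>X Y. neutral_metric p X Y = - (1 / 4) *
       (fst (\<phi> p) \<bullet> (fst (D X) \<times> snd (D Y)) + fst (\<phi> p) \<bullet> (fst (D Y) \<times> snd (D X)))"
proof -
  obtain H where H: "bounded_linear H" "\<And>x. H (H x) = x" "\<And>x y. H x \<bullet> H y = x \<bullet> y" "\<And>x y. H x \<times> H y = H (x \<times> y)"
    and \<phi>: "\<phi> = (\<lambda>p. (H (fst (north_param p)), H (snd (north_param p))))"
  proof (cases "\<phi> = north_param")
    case True
    then show ?thesis using that[of "\<lambda>x. x"] by (simp add: bounded_linear_ident)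
  next
    case False
    then have "\<phi> = south_param" using assms by (simp add: line_params_def)
    then show ?thesis using that[of half_turn] half_turn_linear by (simp add: south_param_def[abs_def])
  qed
  interpret H: bounded_linear H by (rule H(1))
  define HH where "HH \<gamma> = (H (fst \<gamma>), H (snd \<gamma>))" for \<gamma> :: "(real^3) \<times> (real^3)"
  have HH: "bounded_linear HH"
    unfolding HH_def by (intro bounded_linear_Pair bounded_linear_compose[OF H(1)] bounded_linear_fst bounded_linear_snd)
  have HHHH: "HH (HH \<gamma>) = \<gamma>" for \<gamma> by (simp add: HH_def H)
  have HHin: "HH \<gamma> \<in> oriented_lines" if "\<gamma> \<in> oriented_lines" for \<gamma>
    using that by (auto simp: oriented_lines_def HH_def norm_eq_1 H)
  have \<phi>': "\<phi> = (\<lambda>p. HH (north_param p))" by (simp add: \<phi> HH_def)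
  let ?D = "\<lambda>X. HH (north_derivative p X)"
  let ?N = "\<lambda>\<gamma>. north_coords (HH \<gamma>)"
  let ?W = "{\<gamma>. 1 + fst (HH \<gamma>) $ 3 \<noteq> 0}"
  have dom: "1 + fst (north_param p) $ 3 \<noteq> 0"
    using denom_pos[of "fst p"] by (simp add: north_param_def case_prod_unfold line_dir_nth)
  show thesis
  proof (rule that[of ?D ?N ?W])
    show "(\<phi> has_derivative ?D) (at p)"
      unfolding \<phi>' by (rule bounded_linear.has_derivative[OF HH north_param_derivative])
    show "?N differentiable (at (\<phi> p))"
    proof -
      have "north_coords differentiable (at (HH (\<phi> p)))"
        using north_coords_differentiable[OF dom] by (simp add: \<phi>' HHHH)
      with bounded_linear_imp_differentiable[OF HH] show ?thesis
        using differentiable_chain_at[of HH "\<phi> p" north_coords] by (simp add: o_def)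
    qed
    show "?N (\<phi> q) = q" for q by (simp add: \<phi>' HHHH north_coords_param)
    have "continuous_on UNIV (\<lambda>\<gamma>. 1 + fst (HH \<gamma>) $ 3)"
      by (intro continuous_intros linear_continuous_on[OF HH])
    then show "open ?W" by (intro open_Collect_neq continuous_on_const)
    show "\<phi> p \<in> ?W" using dom by (simp add: \<phi>' HHHH)
    show "\<forall>\<gamma>\<in>oriented_lines \<inter> ?W. \<phi> (?N \<gamma>) = \<gamma>"
      using north_param_coords[OF HHin] by (auto simp: \<phi>' HHHH)
    show "fst (?D (complex_structure X)) = fst (\<phi> p) \<times> fst (?D X)" for X
      by (simp add: \<phi>' HH_def H north_derivative_complex_structure)
    show "\<exists>k. snd (?D (complex_structure X)) = fst (\<phi> p) \<times> snd (?D X) + k *\<^sub>R fst (\<phi> p)" for X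
      using north_derivative_complex_structure(2)[of p X] by (auto simp: \<phi>' HH_def H H.add H.scaleR)
    show "neutral_metric p X Y = - (1 / 4) *
       (fst (\<phi> p) \<bullet> (fst (?D X) \<times> snd (?D Y)) + fst (\<phi> p) \<bullet> (fst (?D Y) \<times> snd (?D X)))" for X Y
      by (simp add: neutral_metric_eq_det \<phi>' HH_def H)
  qed
qed

lemma line_params_cover:
  assumes "\<gamma> \<in> oriented_lines"
  shows "\<exists>\<phi>\<in>line_params. \<exists>p. \<phi> p = \<gamma>"
proof (cases "1 + fst \<gamma> $ 3 = 0")
  case False
  then show ?thesis using north_param_coords[OF assms]
    by (intro bexI[of _ north_param] exI[of _ "north_coords \<gamma>"]) (simp_all add: line_params_def)
next
  case True
  let ?\<delta> = "(half_turn (fst \<gamma>), half_turn (snd \<gamma>))"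
  have "?\<delta> \<in> oriented_lines" using assms by (auto simp: oriented_lines_def norm_eq_1)
  moreover have "1 + fst ?\<delta> $ 3 \<noteq> 0" using True by (simp add: half_turn_def)
  ultimately have "north_param (north_coords ?\<delta>) = ?\<delta>" by (rule north_param_coords)
  then have "south_param (north_coords ?\<delta>) = \<gamma>" by (simp add: south_param_def)
  then show ?thesis
    by (intro bexI[of _ south_param] exI[of _ "north_coords ?\<delta>"]) (simp_all add: line_params_def)
qed

lemma has_vector_derivative_cong_nhds:
  assumes "(f has_vector_derivative w) (at x)" "\<forall>\<^sub>F y in nhds x. f y = g y"
  shows "(g has_vector_derivative w) (at x)"
proof -
  obtain S where "open S" "x \<in> S" "\<And>y. y \<in> S \<Longrightarrow> f y = g y"
    using assms(2) unfolding eventually_nhds by blast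
  with assms(1) show ?thesis using has_vector_derivative_transform_within_open by blast
qed

text \<open>
  Tangent spaces taken in coordinates are those in the ambient space, as a curve of lines can be
  pulled back by the differentiable inverse of the coordinate system.
\<close>
lemma tangent_space_chart:
  assumes "A \<subseteq> oriented_lines"
    and D: "(\<phi> has_derivative D) (at p)" and N: "N differentiable (at (\<phi> p))" "\<And>q. N (\<phi> q) = q"
    and W: "open W" "\<phi> p \<in> W" "\<forall>\<gamma>\<in>oriented_lines \<inter> W. \<phi> (N \<gamma>) = \<gamma>"
    and p: "\<phi> p \<in> A"
  shows "tangent_space (\<phi> -` A) p = {X. D X \<in> tangent_space A (\<phi> p)}"
    and "D ` tangent_space (\<phi> -` A) p = tangent_space A (\<phi> p)"
    and "inj D"
proof -
  obtain DN where DN: "(N has_derivative DN) (at (\<phi> p))" using N(1) by (auto simp: differentiable_def)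
  have "((\<lambda>q. N (\<phi> q)) has_derivative (\<lambda>X. DN (D X))) (at p)"
    using diff_chain_at[OF D DN] by (simp add: o_def)
  then have "(\<lambda>X. DN (D X)) = (\<lambda>X. X)"
    unfolding N(2) using has_derivative_unique has_derivative_ident by blast
  then have DND: "DN (D X) = X" for X by metis
  then show "inj D" by (metis injI)
  have push: "D X \<in> tangent_space A (\<phi> p)" if "X \<in> tangent_space (\<phi> -` A) p" for X
  proof -
    from that[unfolded tangent_space_def mem_Collect_eq] obtain g
      where g: "range g \<subseteq> \<phi> -` A" "g 0 = p" "(g has_vector_derivative X) (at (0::real))"
      by (elim exE conjE)
    have "((\<lambda>t. \<phi> (g t)) has_vector_derivative D X) (at 0)"
      using vector_derivative_diff_chain_within[of g X 0 UNIV \<phi> D] g(2,3) D by (simp add: o_def has_derivative_at_withinI)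
    then show ?thesis unfolding tangent_space_def using g by (intro CollectI exI[of _ "\<lambda>t. \<phi> (g t)"]) auto
  qed
  have pull: "DN w \<in> tangent_space (\<phi> -` A) p \<and> D (DN w) = w" if w: "w \<in> tangent_space A (\<phi> p)" for w
  proof -
    obtain g where g: "range g \<subseteq> A" "g 0 = \<phi> p" "(g has_vector_derivative w) (at (0::real))"
      using w unfolding tangent_space_def by blast
    have "continuous (at 0) g" using g(3) has_vector_derivative_continuous by blast
    then have "\<forall>\<^sub>F t in at 0. g t \<in> W"
      using W(1,2) g(2) unfolding continuous_at by (auto dest: topological_tendstoD)
    then have "\<forall>\<^sub>F t in nhds 0. g t \<in> W"
      using W(2) g(2) by (simp add: eventually_nhds_conv_at)
    then have ev: "\<forall>\<^sub>F t in nhds 0. \<phi> (N (g t)) = g t"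
      by (rule eventually_mono) (use g(1) assms(1) W(3) in blast)
    have Ng: "((\<lambda>t. N (g t)) has_vector_derivative DN w) (at 0)"
      using vector_derivative_diff_chain_within[of g w 0 UNIV N DN] g(2,3) DN by (simp add: o_def has_derivative_at_withinI)
    define h where "h t = (if \<phi> (N (g t)) = g t then N (g t) else p)" for t
    have "\<forall>\<^sub>F t in nhds 0. N (g t) = h t" by (rule eventually_mono[OF ev]) (simp add: h_def)
    then have "(h has_vector_derivative DN w) (at 0)"
      by (rule has_vector_derivative_cong_nhds[OF Ng])
    moreover have "range h \<subseteq> \<phi> -` A" using g(1) p by (auto simp: h_def)
    moreover have "h 0 = p" using N(2) g(2) by (simp add: h_def)
    ultimately have 1: "DN w \<in> tangent_space (\<phi> -` A) p" unfolding tangent_space_def by blast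
    have "((\<lambda>t. \<phi> (N (g t))) has_vector_derivative D (DN w)) (at 0)"
      using vector_derivative_diff_chain_within[of "\<lambda>t. N (g t)" "DN w" 0 UNIV \<phi> D] Ng D g(2) N(2)
      by (simp add: o_def has_derivative_at_withinI)
    then have "(g has_vector_derivative D (DN w)) (at 0)"
      by (rule has_vector_derivative_cong_nhds) (rule ev)
    then have "D (DN w) = w" using g(3) vector_derivative_unique_at by blast
    with 1 show ?thesis by blast
  qed
  show "tangent_space (\<phi> -` A) p = {X. D X \<in> tangent_space A (\<phi> p)}"
    using push pull DND by (metis (mono_tags, lifting) mem_Collect_eq subsetI subset_antisym)
  show "D ` tangent_space (\<phi> -` A) p = tangent_space A (\<phi> p)"
    using push pull by (force simp: image_iff)
qed

section \<open>Complex points and induced metric for separated spheres\<close>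

lemma tangent_space_kernel:
  assumes "(F has_derivative F') (at x)" "\<And>y. y \<in> A \<Longrightarrow> F y = k" "w \<in> tangent_space A x"
  shows "F' w = 0"
proof -
  from assms(3)[unfolded tangent_space_def mem_Collect_eq] obtain g
    where g: "range g \<subseteq> A" "g 0 = x" "(g has_vector_derivative w) (at (0::real))"
    by (elim exE conjE)
  have "((\<lambda>t. F (g t)) has_vector_derivative F' w) (at 0)"
    using vector_derivative_diff_chain_within[of g w 0 UNIV F F'] g(2,3) assms(1)
    by (simp add: o_def has_derivative_at_withinI)
  moreover have "(\<lambda>t. F (g t)) = (\<lambda>t. k)" using g(1) assms(2) by auto
  ultimately have "((\<lambda>t::real. k) has_vector_derivative F' w) (at 0)" by simp
  then show ?thesis using has_vector_derivative_const vector_derivative_unique_at by blast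
qed

text \<open>
  As a tangent vector depends only on the germ of its curve, a curve that leaves \<open>A\<close> may be replaced by
  a constant there.
\<close>
lemma range_derivative_in_tangent_space:
  assumes D: "(f has_derivative f') (at z)" and ev: "\<forall>\<^sub>F y in nhds z. f y \<in> A"
  shows "range f' \<subseteq> tangent_space A (f z)"
proof
  fix w assume "w \<in> range f'"
  then obtain h where w: "w = f' h" by blast
  define g where "g t = (if f (z + t *\<^sub>R h) \<in> A then f (z + t *\<^sub>R h) else f z)" for t :: real
  have z: "f z \<in> A" using ev by (rule eventually_nhds_x_imp_x)
  have "((\<lambda>t::real. z + t *\<^sub>R h) has_vector_derivative h) (at 0)"
    by (auto intro!: derivative_eq_intros simp: has_vector_derivative_def)
  with D have "((\<lambda>t. f (z + t *\<^sub>R h)) has_vector_derivative f' h) (at 0)"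
    using vector_derivative_diff_chain_within[of "\<lambda>t. z + t *\<^sub>R h" h 0 UNIV f f']
    by (simp add: o_def has_derivative_at_withinI)
  moreover have "((\<lambda>t::real. z + t *\<^sub>R h) \<longlongrightarrow> z + 0 *\<^sub>R h) (nhds 0)"
    by (intro tendsto_intros filterlim_ident)
  then have "\<forall>\<^sub>F t in nhds 0. f (z + t *\<^sub>R h) \<in> A" using ev by (auto simp: filterlim_iff)
  then have "\<forall>\<^sub>F t in nhds 0. f (z + t *\<^sub>R h) = g t" by (rule eventually_mono) (simp add: g_def)
  ultimately have "(g has_vector_derivative f' h) (at 0)" by (rule has_vector_derivative_cong_nhds)
  moreover have "range g \<subseteq> A" "g 0 = f z" using z by (auto simp: g_def)
  ultimately show "w \<in> tangent_space A (f z)" unfolding tangent_space_def w by blast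
qed

lemma offset_derivative:
  "(offset c has_derivative (\<lambda>w. snd w + (c \<bullet> fst w) *\<^sub>R fst \<gamma> + (c \<bullet> fst \<gamma>) *\<^sub>R fst w)) (at \<gamma>)"
  unfolding offset_def[abs_def] by (auto intro!: derivative_eq_intros simp: algebra_simps)

lemma orthogonal_expansion:
  fixes u N q :: "real^3"
  assumes "u \<bullet> u = 1" "N \<bullet> u = 0" "N \<bullet> N = r\<^sup>2" "r \<noteq> 0"
  shows "q = (q \<bullet> u) *\<^sub>R u + (q \<bullet> N / r\<^sup>2) *\<^sub>R N + (q \<bullet> (u \<times> N) / r\<^sup>2) *\<^sub>R (u \<times> N)"
proof -
  interpret axis_frame "(1 / r) *\<^sub>R N" u
    by unfold_locales (use assms in \<open>auto simp: power2_eq_square\<close>)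
  have b: "b = - (1 / r) *\<^sub>R (u \<times> N)"
    unfolding b_def cross_mult_left cross_skew[of N u] by simp
  show ?thesis
    using cyl_planar[of q] by (simp add: cyl_def planar_def b power2_eq_square algebra_simps)
qed

context two_spheres
begin

lemma bitangent_iff:
  assumes \<gamma>: "\<gamma> \<in> common_tangents"
  shows "\<gamma> \<in> bitangent_plane_lines (sphere c1 r1) (sphere c2 r2) \<longleftrightarrow> sine \<gamma> = 0"
proof -
  note D = common_tangentsD[OF \<gamma>]
  let ?u = "fst \<gamma>" and ?N1 = "offset c1 \<gamma>" and ?N2 = "offset c2 \<gamma>"
  have n: "norm ?N1 = r1" "norm ?N2 = r2" using \<gamma> by (auto simp: common_tangents_def)
  note cp1 = contact_point_iff[OF D(1) r1_pos, of _ c1] and cp2 = contact_point_iff[OF D(1) r2_pos, of _ c2]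
  have T1: "tangent_space (sphere c1 r1) (c1 + ?N1) = {w. w \<bullet> ?N1 = 0}"
    using tangent_space_sphere[OF r1_pos, of "c1 + ?N1" c1] cp1[of "c1 + ?N1"] n by simp
  have T2: "tangent_space (sphere c2 r2) (c2 + ?N2) = {w. w \<bullet> ?N2 = 0}"
    using tangent_space_sphere[OF r2_pos, of "c2 + ?N2" c2] cp2[of "c2 + ?N2"] n by simp
  have "\<gamma> \<in> bitangent_plane_lines (sphere c1 r1) (sphere c2 r2) \<longleftrightarrow> {w. w \<bullet> ?N1 = 0} = {w. w \<bullet> ?N2 = 0}"
  proof
    assume "\<gamma> \<in> bitangent_plane_lines (sphere c1 r1) (sphere c2 r2)"
    then obtain p q where pq: "p \<in> sphere c1 r1 \<inter> points_of \<gamma>" "q \<in> sphere c2 r2 \<inter> points_of \<gamma>"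
      "?u \<in> tangent_space (sphere c1 r1) p" "tangent_space (sphere c1 r1) p = tangent_space (sphere c2 r2) q"
      unfolding bitangent_plane_lines_def by blast
    then have "p = c1 + ?N1" "q = c2 + ?N2" using cp1[of p] cp2[of q] by blast+
    then show "{w. w \<bullet> ?N1 = 0} = {w. w \<bullet> ?N2 = 0}" using pq(4) T1 T2 by simp
  next
    assume "{w. w \<bullet> ?N1 = 0} = {w. w \<bullet> ?N2 = 0}"
    then show "\<gamma> \<in> bitangent_plane_lines (sphere c1 r1) (sphere c2 r2)"
      unfolding bitangent_plane_lines_def
      using D(1) cp1[of "c1 + ?N1"] cp2[of "c2 + ?N2"] n T1 T2 by blast
  qed
  also have "\<dots> \<longleftrightarrow> sine \<gamma> = 0"
  proof
    assume eq: "{w. w \<bullet> ?N1 = 0} = {w. w \<bullet> ?N2 = 0}"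
    have "?u \<times> ?N1 \<in> {w. w \<bullet> ?N1 = 0}" by (simp add: dot_cross_self)
    then have "(?u \<times> ?N1) \<bullet> ?N2 = 0" unfolding eq by simp
    then show "sine \<gamma> = 0" using cross_triple[of ?u ?N1 ?N2] by (simp add: sine_def inner_commute)
  next
    assume "sine \<gamma> = 0"
    then have "?N2 \<bullet> (?u \<times> ?N1) = 0"
      using cross_triple[of ?u ?N1 ?N2] r1_pos r2_pos by (simp add: sine_def inner_commute)
    then have "?N2 = (?N2 \<bullet> ?N1 / r1\<^sup>2) *\<^sub>R ?N1"
      using orthogonal_expansion[OF D(2,5,3), of ?N2] r1_pos D(6) by simp
    then obtain k where k: "?N2 = k *\<^sub>R ?N1" by blast
    then have "k \<noteq> 0" using n r2_pos by auto
    then show "{w. w \<bullet> ?N1 = 0} = {w. w \<bullet> ?N2 = 0}" unfolding k by simp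
  qed
  finally show ?thesis .
qed

text \<open>
  The derivatives of the equations that define the common tangents among all pairs of vectors.
\<close>
lemma tangent_constraints:
  assumes A: "A \<subseteq> common_tangents" and \<gamma>: "\<gamma> \<in> common_tangents" and w: "w \<in> tangent_space A \<gamma>"
  shows "fst w \<bullet> fst \<gamma> = 0" and "snd w \<bullet> fst \<gamma> = - (fst w \<bullet> snd \<gamma>)"
    and "(snd w + (c1 \<bullet> fst \<gamma>) *\<^sub>R fst w) \<bullet> offset c1 \<gamma> = 0"
    and "(snd w + (c2 \<bullet> fst \<gamma>) *\<^sub>R fst w) \<bullet> offset c2 \<gamma> = 0"
proof -
  note kernel = tangent_space_kernel[OF _ _ w]
  have "((\<lambda>\<gamma>. fst \<gamma> \<bullet> fst \<gamma>) has_derivative (\<lambda>w. fst \<gamma> \<bullet> fst w + fst w \<bullet> fst \<gamma>)) (at \<gamma>)"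
    by (auto intro!: derivative_eq_intros)
  from kernel[OF this, of 1] have "fst \<gamma> \<bullet> fst w + fst w \<bullet> fst \<gamma> = 0"
    using A common_tangentsD(2) by blast
  then show "fst w \<bullet> fst \<gamma> = 0" by (simp add: inner_commute)
  have "((\<lambda>\<gamma>. fst \<gamma> \<bullet> snd \<gamma>) has_derivative (\<lambda>w. fst \<gamma> \<bullet> snd w + fst w \<bullet> snd \<gamma>)) (at \<gamma>)"
    by (auto intro!: derivative_eq_intros)
  from kernel[OF this, of 0] have "fst \<gamma> \<bullet> snd w + fst w \<bullet> snd \<gamma> = 0"
    using A oriented_linesD(2)[OF common_tangentsD(1)] by blast
  then show "snd w \<bullet> fst \<gamma> = - (fst w \<bullet> snd \<gamma>)" by (simp add: inner_commute)
  have "(snd w + (c \<bullet> fst \<gamma>) *\<^sub>R fst w) \<bullet> offset c \<gamma> = 0"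
    if "offset c \<gamma> \<bullet> fst \<gamma> = 0" "\<And>\<gamma>. \<gamma> \<in> common_tangents \<Longrightarrow> offset c \<gamma> \<bullet> offset c \<gamma> = k" for c k
  proof -
    let ?o = "\<lambda>w. snd w + (c \<bullet> fst w) *\<^sub>R fst \<gamma> + (c \<bullet> fst \<gamma>) *\<^sub>R fst w"
    have "((\<lambda>\<gamma>. offset c \<gamma> \<bullet> offset c \<gamma>) has_derivative (\<lambda>w. offset c \<gamma> \<bullet> ?o w + ?o w \<bullet> offset c \<gamma>)) (at \<gamma>)"
      by (intro has_derivative_inner offset_derivative)
    from kernel[OF this, of k] have "offset c \<gamma> \<bullet> ?o w + ?o w \<bullet> offset c \<gamma> = 0"
      using A that(2) by blast
    then have "?o w \<bullet> offset c \<gamma> = 0" by (simp add: inner_commute[of "offset c \<gamma>"])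
    moreover have "?o w \<bullet> offset c \<gamma> = (snd w + (c \<bullet> fst \<gamma>) *\<^sub>R fst w) \<bullet> offset c \<gamma> + (c \<bullet> fst w) * (offset c \<gamma> \<bullet> fst \<gamma>)"
      unfolding inner_add_left inner_scaleR_left inner_commute[of "fst \<gamma>" "offset c \<gamma>"] by simp
    ultimately show ?thesis using that(1) by simp
  qed
  from this[OF common_tangentsD(5)[OF \<gamma>] common_tangentsD(3)] this[OF common_tangentsD(6)[OF \<gamma>] common_tangentsD(4)]
  show "(snd w + (c1 \<bullet> fst \<gamma>) *\<^sub>R fst w) \<bullet> offset c1 \<gamma> = 0"
    "(snd w + (c2 \<bullet> fst \<gamma>) *\<^sub>R fst w) \<bullet> offset c2 \<gamma> = 0" by blast+
qed

text \<open>
  The variation in which the two contact normals rotate about the line with angular velocities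
  \<open>fst z\<close> and \<open>snd z\<close>. Where the height does not vanish, these determine the variation of the
  direction of the line, which is \<open>c2 - c1 - (offset c1 \<gamma> - offset c2 \<gamma>)\<close> divided by the height.
\<close>
definition variation :: "(real^3) \<times> (real^3) \<Rightarrow> real \<times> real \<Rightarrow> (real^3) \<times> (real^3)" where
  "variation \<gamma> z = (let u' = (1 / height \<gamma>) *\<^sub>R
       (snd z *\<^sub>R (fst \<gamma> \<times> offset c2 \<gamma>) - fst z *\<^sub>R (fst \<gamma> \<times> offset c1 \<gamma>))
     in (u', fst z *\<^sub>R (fst \<gamma> \<times> offset c1 \<gamma>) - (c1 \<bullet> fst \<gamma>) *\<^sub>R u' - (u' \<bullet> snd \<gamma>) *\<^sub>R fst \<gamma>))"

lemma variation_linear: "linear (variation \<gamma>)"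
  by (rule linearI) (simp_all add: variation_def Let_def algebra_simps inner_simps)

lemma tangent_space_subset_variations:
  assumes A: "A \<subseteq> common_tangents" and \<gamma>: "\<gamma> \<in> common_tangents" and h: "height \<gamma> \<noteq> 0"
  shows "tangent_space A \<gamma> \<subseteq> range (variation \<gamma>)"
proof
  fix w assume "w \<in> tangent_space A \<gamma>"
  note C = tangent_constraints[OF A \<gamma> this] and D = common_tangentsD[OF \<gamma>]
  let ?u = "fst \<gamma>" and ?u' = "fst w" and ?v' = "snd w" and ?N1 = "offset c1 \<gamma>" and ?N2 = "offset c2 \<gamma>"
  define q1 q2 where "q1 = ?v' + (c1 \<bullet> ?u) *\<^sub>R ?u'" and "q2 = ?v' + (c2 \<bullet> ?u) *\<^sub>R ?u'"
  define \<alpha>1 \<alpha>2 where "\<alpha>1 = q1 \<bullet> (?u \<times> ?N1) / r1\<^sup>2" and "\<alpha>2 = q2 \<bullet> (?u \<times> ?N2) / r2\<^sup>2"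
  have qu: "q1 \<bullet> ?u = - (?u' \<bullet> snd \<gamma>)" "q2 \<bullet> ?u = - (?u' \<bullet> snd \<gamma>)"
    using C by (simp_all add: q1_def q2_def inner_add_left)
  have q1: "q1 = - (?u' \<bullet> snd \<gamma>) *\<^sub>R ?u + \<alpha>1 *\<^sub>R (?u \<times> ?N1)"
    using orthogonal_expansion[OF D(2,5,3), of q1] r1_pos C(3) qu by (simp add: q1_def[symmetric] \<alpha>1_def)
  have q2: "q2 = - (?u' \<bullet> snd \<gamma>) *\<^sub>R ?u + \<alpha>2 *\<^sub>R (?u \<times> ?N2)"
    using orthogonal_expansion[OF D(2,6,4), of q2] r2_pos C(4) qu by (simp add: q2_def[symmetric] \<alpha>2_def)
  have "height \<gamma> *\<^sub>R ?u' = q2 - q1"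
    by (simp add: q1_def q2_def height_def inner_diff_left algebra_simps)
  also have "\<dots> = \<alpha>2 *\<^sub>R (?u \<times> ?N2) - \<alpha>1 *\<^sub>R (?u \<times> ?N1)" unfolding q1 q2 by simp
  finally have "(1 / height \<gamma>) *\<^sub>R (height \<gamma> *\<^sub>R ?u') = (1 / height \<gamma>) *\<^sub>R (\<alpha>2 *\<^sub>R (?u \<times> ?N2) - \<alpha>1 *\<^sub>R (?u \<times> ?N1))"
    by simp
  then have u': "?u' = (1 / height \<gamma>) *\<^sub>R (\<alpha>2 *\<^sub>R (?u \<times> ?N2) - \<alpha>1 *\<^sub>R (?u \<times> ?N1))"
    using h by simp
  have v': "?v' = \<alpha>1 *\<^sub>R (?u \<times> ?N1) - (c1 \<bullet> ?u) *\<^sub>R ?u' - (?u' \<bullet> snd \<gamma>) *\<^sub>R ?u"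
    using q1 by (simp add: q1_def algebra_simps)
  have "w = variation \<gamma> (\<alpha>1, \<alpha>2)"
    unfolding variation_def Let_def fst_conv snd_conv u'[symmetric] v'[symmetric] by simp
  then show "w \<in> range (variation \<gamma>)" by blast
qed

text \<open>
  For an immersed surface of common tangents both spaces are two-dimensional, so they agree.
\<close>
lemma tangent_space_eq_variations:
  fixes f :: "real \<times> real \<Rightarrow> (real^3) \<times> (real^3)"
  assumes A: "A \<subseteq> common_tangents" and f: "smooth_immersion f" "\<forall>\<^sub>F y in nhds z. f y \<in> A"
    and h: "height (f z) \<noteq> 0"
  shows "tangent_space A (f z) = range (variation (f z))"
proof -
  let ?f' = "frechet_derivative f (at z)"
  note D = smooth_immersionD(1,2)[OF f(1), of z]
  have \<gamma>: "f z \<in> common_tangents" using A eventually_nhds_x_imp_x[OF f(2)] by blast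
  have lin: "linear ?f'" using D(1) by (rule has_derivative_linear)
  have sub: "range ?f' \<subseteq> tangent_space A (f z)" "tangent_space A (f z) \<subseteq> range (variation (f z))"
    by (rule range_derivative_in_tangent_space[OF D(1) f(2)],
        rule tangent_space_subset_variations[OF A \<gamma> h])
  have "dim (range (variation (f z))) \<le> dim (UNIV :: (real \<times> real) set)"
    by (rule dim_image_le[OF variation_linear])
  also have "\<dots> = dim (range ?f')" by (rule dim_image_eq[OF lin, symmetric]) (use D(2) in simp)
  finally have "range ?f' = range (variation (f z))"
    by (intro subspace_dim_equal linear_subspace_image lin variation_linear subspace_UNIV)
      (use sub in auto)
  with sub show ?thesis by blast
qed

text \<open>
  The angular velocities are null coordinates for the induced metric, which vanishes where the
  contact normals are parallel.
\<close>
lemma det_variation: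
  assumes \<gamma>: "\<gamma> \<in> common_tangents"
  shows "fst \<gamma> \<bullet> (fst (variation \<gamma> y) \<times> snd (variation \<gamma> z)) + fst \<gamma> \<bullet> (fst (variation \<gamma> z) \<times> snd (variation \<gamma> y))
     = - (r1 * r2 * sine \<gamma> / height \<gamma>) * (snd y * fst z + snd z * fst y)"
proof -
  note D = common_tangentsD[OF \<gamma>]
  let ?u = "fst \<gamma>" and ?N1 = "offset c1 \<gamma>" and ?N2 = "offset c2 \<gamma>"
  have uN: "fst (variation \<gamma> y) \<bullet> ?N1 = - snd y * (r1 * r2 * sine \<gamma>) / height \<gamma>" for y
  proof -
    have "(?u \<times> ?N2) \<bullet> ?N1 = - (r1 * r2 * sine \<gamma>)"
      using cross_triple[of ?u ?N2 ?N1] cross_skew[of ?N1 ?N2] r1_pos r2_pos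
      by (simp add: sine_def inner_commute)
    then show ?thesis
      by (simp add: variation_def Let_def inner_diff_left dot_cross_self)
  qed
  have uu: "fst (variation \<gamma> y) \<bullet> ?u = 0" for y
    by (simp add: variation_def Let_def inner_diff_left dot_cross_self)
  have t: "?u \<bullet> (fst (variation \<gamma> y) \<times> snd (variation \<gamma> z)) = fst z * (fst (variation \<gamma> y) \<bullet> ?N1)
    - (c1 \<bullet> ?u) * (?u \<bullet> (fst (variation \<gamma> y) \<times> fst (variation \<gamma> z)))" for y z
  proof -
    obtain u' where u': "fst (variation \<gamma> y) = u'" by blast
    have v: "snd (variation \<gamma> z) = fst z *\<^sub>R (?u \<times> ?N1) - (c1 \<bullet> ?u) *\<^sub>R fst (variation \<gamma> z)
       - (fst (variation \<gamma> z) \<bullet> snd \<gamma>) *\<^sub>R ?u"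
      by (simp add: variation_def Let_def)
    have "?u \<bullet> (u' \<times> (?u \<times> ?N1)) = u' \<bullet> ?N1"
      using D(2,5) by (simp add: Lagrange inner_diff_right inner_commute)
    then show ?thesis
      unfolding u' v by (simp add: Cross3.right_diff_distrib cross_mult_right inner_diff_right dot_cross_self)
  qed
  have "?u \<bullet> (fst (variation \<gamma> z) \<times> fst (variation \<gamma> y)) = - (?u \<bullet> (fst (variation \<gamma> y) \<times> fst (variation \<gamma> z)))"
    by (subst cross_skew) simp
  then show ?thesis
    unfolding t uN by (simp add: algebra_simps add_divide_distrib)
qed

lemma bitangent_not_lorentz:
  assumes \<gamma>: "\<gamma> \<in> common_tangents" "height \<gamma> \<noteq> 0" "sine \<gamma> = 0"
  shows "\<not> lorentz_at common_tangents \<gamma>"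
proof
  assume L: "lorentz_at common_tangents \<gamma>"
  have X: "common_tangents \<subseteq> oriented_lines" by (auto simp: common_tangents_def)
  obtain \<phi> p where \<phi>: "\<phi> \<in> line_params" "\<phi> p = \<gamma>"
    using line_params_cover[OF common_tangentsD(1)[OF \<gamma>(1)]] by blast
  obtain D N W where c: "(\<phi> has_derivative D) (at p)" "N differentiable (at (\<phi> p))" "\<And>q. N (\<phi> q) = q"
    "open W" "\<phi> p \<in> W" "\<forall>\<gamma>\<in>oriented_lines \<inter> W. \<phi> (N \<gamma>) = \<gamma>"
    and metric: "\<And>X Y. neutral_metric p X Y = - (1 / 4) *
       (fst (\<phi> p) \<bullet> (fst (D X) \<times> snd (D Y)) + fst (\<phi> p) \<bullet> (fst (D Y) \<times> snd (D X)))"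
    by (rule line_chart[OF \<phi>(1), of p]) blast
  have "\<phi> p \<in> common_tangents" using \<phi> \<gamma> by simp
  note T = tangent_space_chart[OF X c this]
  have "signature_1_1_on (neutral_metric p) (tangent_space (\<phi> -` common_tangents) p)"
    using L \<phi> unfolding lorentz_at_def by blast
  then obtain Z Y where "tangent_space (\<phi> -` common_tangents) p = span {Z, Y}" and pos: "neutral_metric p Z Z > 0"
    unfolding signature_1_1_on_def by blast
  then have "Z \<in> tangent_space (\<phi> -` common_tangents) p" by (simp add: span_base)
  then have "D Z \<in> tangent_space common_tangents \<gamma>" using T(2) unfolding \<phi>(2) by blast
  then have "D Z \<in> range (variation \<gamma>)"
    using tangent_space_subset_variations[OF subset_refl \<gamma>(1,2)] by blast
  then obtain y where "D Z = variation \<gamma> y" by blast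
  with metric[of Z Z] det_variation[OF \<gamma>(1), of y y] \<gamma>(3) \<phi>(2) pos show False by simp
qed

end

context two_spheres_frame
begin

lemma separated_immersion:
  assumes "r1 + r2 < separation" "\<gamma> \<in> common_tangents"
  obtains f :: "real \<times> real \<Rightarrow> (real^3) \<times> (real^3)" and z
    where "smooth_immersion f" "range f \<subseteq> common_tangents" "f z = \<gamma>"
proof -
  obtain T where "embedded_torus T" "T \<subseteq> common_tangents" "\<gamma> \<in> T"
    using separated_spheres[OF assms(1)] assms(2) unfolding disjoint_embedded_tori_def by blast
  then show thesis using that unfolding embedded_torus_def torus_immersion_def by blast
qed

text \<open>
  If both a variation and its image under the complex structure preserve tangency to both spheres
  to first order, then the contact normals do not rotate about the line. As the height does not
  vanish, the direction of the line is then fixed to first order as well.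
\<close>
lemma totally_real_common_tangents:
  assumes sep: "r1 + r2 < separation"
  shows "totally_real_surface common_tangents"
  unfolding totally_real_surface_def
proof (intro conjI ballI allI impI)
  show X: "common_tangents \<subseteq> oriented_lines" by (auto simp: common_tangents_def)
  fix \<phi> p assume \<phi>: "\<phi> \<in> line_params" and \<gamma>: "\<phi> p \<in> common_tangents"
  note h = separated_spheres_height_nonzero[OF sep \<gamma>]
  obtain f :: "real \<times> real \<Rightarrow> (real^3) \<times> (real^3)" and z where f: "smooth_immersion f" "range f \<subseteq> common_tangents" "f z = \<phi> p"
    by (rule separated_immersion[OF sep \<gamma>])
  have TX: "tangent_space common_tangents (\<phi> p) = range (variation (\<phi> p))"
  proof -
    have "\<forall>\<^sub>F y in nhds z. f y \<in> common_tangents" using f(2) by (intro always_eventually) blast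
    from tangent_space_eq_variations[OF subset_refl f(1) this] h show ?thesis unfolding f(3) by blast
  qed
  obtain D N W where c: "(\<phi> has_derivative D) (at p)" "N differentiable (at (\<phi> p))" "\<And>q. N (\<phi> q) = q"
    "open W" "\<phi> p \<in> W" "\<forall>\<gamma>\<in>oriented_lines \<inter> W. \<phi> (N \<gamma>) = \<gamma>"
    and J: "\<And>X. fst (D (complex_structure X)) = fst (\<phi> p) \<times> fst (D X)"
      "\<And>X. \<exists>k. snd (D (complex_structure X)) = fst (\<phi> p) \<times> snd (D X) + k *\<^sub>R fst (\<phi> p)"
    by (rule line_chart[OF \<phi>, of p]) blast
  note T = tangent_space_chart[OF X c \<gamma>]
  let ?T = "tangent_space (\<phi> -` common_tangents) p"
  let ?u = "fst (\<phi> p)" and ?N1 = "offset c1 (\<phi> p)" and ?N2 = "offset c2 (\<phi> p)"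
  note CT = common_tangentsD[OF \<gamma>]
  show "complex_structure ` ?T \<noteq> ?T"
  proof
    assume inv: "complex_structure ` ?T = ?T"
    have "variation (\<phi> p) (1, 0) \<in> D ` ?T" unfolding T(2) TX by blast
    then obtain Z where Z: "Z \<in> ?T" "D Z = variation (\<phi> p) (1, 0)" by auto
    have "complex_structure Z \<in> ?T" using inv Z(1) by blast
    then have "D (complex_structure Z) \<in> tangent_space common_tangents (\<phi> p)"
      "D Z \<in> tangent_space common_tangents (\<phi> p)" using T(2) Z(1) by blast+
    note C = tangent_constraints[OF subset_refl \<gamma> this(2)] and CJ = tangent_constraints[OF subset_refl \<gamma> this(1)]
    let ?u' = "fst (D Z)" and ?v' = "snd (D Z)"
    obtain k where k: "snd (D (complex_structure Z)) = ?u \<times> ?v' + k *\<^sub>R ?u" using J(2) by blast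
    define q where "q c = ?v' + (c \<bullet> ?u) *\<^sub>R ?u'" for c
    have Jq: "snd (D (complex_structure Z)) + (c \<bullet> ?u) *\<^sub>R fst (D (complex_structure Z)) = ?u \<times> q c + k *\<^sub>R ?u" for c
      by (simp add: J(1) k q_def cross_add_right cross_mult_right)
    have "(?u \<times> q c1) \<bullet> ?N1 = 0" "(?u \<times> q c2) \<bullet> ?N2 = 0"
      using CJ(3,4) CT(5,6) unfolding Jq inner_add_left inner_scaleR_left inner_commute[of ?u] by simp_all
    then have rot: "q c1 \<bullet> (?u \<times> ?N1) = 0" "q c2 \<bullet> (?u \<times> ?N2) = 0"
      using cross_triple[of ?u "q c1" ?N1] cross_triple[of ?u ?N1 "q c1"] cross_skew[of ?N1 "q c1"]
        cross_triple[of ?u "q c2" ?N2] cross_triple[of ?u ?N2 "q c2"] cross_skew[of ?N2 "q c2"]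
      by (simp_all add: inner_commute)
    have "q c1 \<bullet> ?N1 = 0" "q c2 \<bullet> ?N2 = 0" using C(3,4) by (simp_all add: q_def)
    then have "q c1 = (q c1 \<bullet> ?u) *\<^sub>R ?u" "q c2 = (q c2 \<bullet> ?u) *\<^sub>R ?u"
      using orthogonal_expansion[OF CT(2,5,3), of "q c1"] orthogonal_expansion[OF CT(2,6,4), of "q c2"]
        rot r1_pos r2_pos by simp_all
    moreover have "q c \<bullet> ?u = ?v' \<bullet> ?u" for c using C(1) by (simp add: q_def inner_add_left)
    ultimately have "q c2 - q c1 = 0" by simp
    moreover have "q c2 - q c1 = height (\<phi> p) *\<^sub>R ?u'"
      by (simp add: q_def height_def inner_diff_left algebra_simps)
    ultimately have "?u' = 0" using h by simp
    then have "?u \<times> ?N1 = 0" using h by (simp add: Z(2) variation_def Let_def)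
    then have "?u \<bullet> ?N1 = 0 \<and> ?u \<times> ?N1 = 0" using CT(5) by (simp add: inner_commute)
    then have "?u = 0 \<or> ?N1 = 0" by (simp only: norm_and_cross_eq_0)
    then show False using CT(2,3) r1_pos by auto
  qed
qed

text \<open>
  The induced metric is a nonzero multiple of the product of the two angular velocities; equal and
  opposite velocities give an orthogonal basis with squares of opposite signs.
\<close>
lemma lorentz_common_tangents:
  assumes sep: "r1 + r2 < separation"
  shows "lorentz_surface {\<gamma> \<in> common_tangents. sine \<gamma> \<noteq> 0}" (is "lorentz_surface ?A")
  unfolding lorentz_surface_def lorentz_at_def
proof (intro conjI ballI allI impI)
  show X: "?A \<subseteq> oriented_lines" by (auto simp: common_tangents_def)
  fix \<gamma> \<phi> p assume \<gamma>: "\<gamma> \<in> ?A" and \<phi>: "\<phi> \<in> line_params" "\<phi> p = \<gamma>"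
  have g: "\<gamma> \<in> common_tangents" using \<gamma> by blast
  note h = separated_spheres_height_nonzero[OF sep g]
  obtain f :: "real \<times> real \<Rightarrow> (real^3) \<times> (real^3)" and z where f: "smooth_immersion f" "range f \<subseteq> common_tangents" "f z = \<gamma>"
    by (rule separated_immersion[OF sep g])
  have "isCont (\<lambda>y. sine (f y)) z"
    by (rule isCont_o2[OF has_derivative_continuous[OF smooth_immersionD(1)[OF f(1)]]
          differentiable_imp_continuous_within[OF differentiable_invariants(3)]])
  then have "((\<lambda>y. sine (f y)) \<longlongrightarrow> sine \<gamma>) (at z)" unfolding isCont_def f(3) .
  moreover have "sine \<gamma> \<noteq> 0" using \<gamma> by simp
  ultimately have "\<forall>\<^sub>F y in nhds z. sine (f y) \<noteq> 0"
    using f(3) tendsto_imp_eventually_ne by (auto simp: eventually_nhds_conv_at)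
  then have "\<forall>\<^sub>F y in nhds z. f y \<in> ?A" by (rule eventually_mono) (use f(2) in blast)
  then have TX: "tangent_space ?A (\<phi> p) = range (variation \<gamma>)"
    using tangent_space_eq_variations[OF _ f(1), of ?A z] h unfolding f(3) \<phi>(2) by blast
  obtain D N W where c: "(\<phi> has_derivative D) (at p)" "N differentiable (at (\<phi> p))" "\<And>q. N (\<phi> q) = q"
    "open W" "\<phi> p \<in> W" "\<forall>\<gamma>\<in>oriented_lines \<inter> W. \<phi> (N \<gamma>) = \<gamma>"
    and metric: "\<And>X Y. neutral_metric p X Y = - (1 / 4) *
       (fst (\<phi> p) \<bullet> (fst (D X) \<times> snd (D Y)) + fst (\<phi> p) \<bullet> (fst (D Y) \<times> snd (D X)))"
    by (rule line_chart[OF \<phi>(1), of p]) blast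
  have "\<phi> p \<in> ?A" using \<phi> \<gamma> by simp
  note T = tangent_space_chart[OF X c this, unfolded TX]
  let ?T = "tangent_space (\<phi> -` ?A) p"
  define k where "k = r1 * r2 * sine \<gamma> / height \<gamma>"
  have k: "k \<noteq> 0" using \<gamma> h r1_pos r2_pos by (simp add: k_def)
  have met: "neutral_metric p X Y = (k / 4) * (snd y * fst z + snd z * fst y)"
    if "D X = variation \<gamma> y" "D Y = variation \<gamma> z" for X Y y z
    using metric[of X Y] det_variation[OF g, of y z] by (simp add: that \<phi>(2) k_def)
  have linD: "linear D" using c(1) by (rule has_derivative_linear)
  have "variation \<gamma> (1, 1) \<in> D ` ?T" "variation \<gamma> (1, - 1) \<in> D ` ?T" unfolding T(2) by blast+
  then obtain Z1 Z2 where Z: "Z1 \<in> ?T" "D Z1 = variation \<gamma> (1, 1)" "Z2 \<in> ?T" "D Z2 = variation \<gamma> (1, - 1)"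
    by auto
  have span: "?T = span {Z1, Z2}"
  proof
    have "subspace ?T"
      unfolding T(1) by (intro linear_subspace_vimage[OF linD, unfolded vimage_def]
          linear_subspace_image variation_linear subspace_UNIV)
    then show "span {Z1, Z2} \<subseteq> ?T" using Z by (intro span_minimal) auto
    show "?T \<subseteq> span {Z1, Z2}"
    proof
      fix Z assume "Z \<in> ?T"
      then obtain x y where "D Z = variation \<gamma> (x, y)" using T(1) by auto
      also have "(x, y) = ((x + y) / 2) *\<^sub>R (1, 1) + ((x - y) / 2) *\<^sub>R (1, - 1)"
        by (simp add: field_simps)
      also have "variation \<gamma> \<dots> = ((x + y) / 2) *\<^sub>R D Z1 + ((x - y) / 2) *\<^sub>R D Z2"
        unfolding linear_add[OF variation_linear] linear_cmul[OF variation_linear] Z ..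
      also have "\<dots> = D (((x + y) / 2) *\<^sub>R Z1 + ((x - y) / 2) *\<^sub>R Z2)"
        by (simp only: linear_add[OF linD] linear_cmul[OF linD])
      finally have "Z = ((x + y) / 2) *\<^sub>R Z1 + ((x - y) / 2) *\<^sub>R Z2" using T(3) by (simp add: inj_eq)
      then show "Z \<in> span {Z1, Z2}" by (simp add: span_add span_scale span_base)
    qed
  qed
  have m: "neutral_metric p Z1 Z1 = k / 2" "neutral_metric p Z2 Z2 = - k / 2"
    "neutral_metric p Z1 Z2 = 0" "neutral_metric p Z2 Z1 = 0"
    by (simp_all add: met[OF Z(2,2)] met[OF Z(4,4)] met[OF Z(2,4)] met[OF Z(4,2)])
  show "signature_1_1_on (neutral_metric p) ?T"
  proof (cases "0 < k")
    case True
    then show ?thesis unfolding signature_1_1_on_def using span m by (intro exI[of _ Z1] exI[of _ Z2]) simp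
  next
    case False
    then have "k < 0" using k by simp
    then show ?thesis unfolding signature_1_1_on_def using span m
      by (intro exI[of _ Z2] exI[of _ Z1]) (simp add: insert_commute)
  qed
qed

end

unbundle no cross3_syntax

theorem theorem3:
  fixes c1 c2 :: "real^3" and r1 r2 l :: real
    and S1 S2 :: "(real^3) set" and X :: "((real^3) \<times> (real^3)) set"
  assumes "0 < r2" and "r2 \<le> r1"
    and "S1 = sphere c1 r1" and "S2 = sphere c2 r2" and "S1 \<noteq> S2"
    and "l = dist c1 c2"
    and "X = tangent_hypersurface S1 \<inter> tangent_hypersurface S2"
  shows "(X = {} \<longleftrightarrow> l < r1 - r2)
    \<and> (embedded_circle X \<longleftrightarrow> l = r1 - r2)
    \<and> (immersed_torus X \<longleftrightarrow> r1 - r2 < l \<and> l \<le> r1 + r2)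
    \<and> (r1 - r2 < l \<and> l < r1 + r2 \<longrightarrow> embedded_torus X)
    \<and> (disjoint_embedded_tori X \<longleftrightarrow> r1 + r2 < l)
    \<and> (r1 + r2 < l \<longrightarrow>
        S1 \<inter> S2 = {}
        \<and> totally_real_surface X
        \<and> lorentz_surface (X - bitangent_plane_lines S1 S2)
        \<and> (\<forall>\<gamma> \<in> X \<inter> bitangent_plane_lines S1 S2. \<not> lorentz_at X \<gamma>))"
proof -
  interpret two_spheres c1 c2 r1 r2 using assms by unfold_locales
  have X: "X = common_tangents" using common_tangents_eq assms by simp
  have frame: "\<exists>a e. two_spheres_frame c1 c2 r1 r2 a e" if "0 < l"
  proof -
    let ?e = "(1 / l) *\<^sub>R (c2 - c1)"
    obtain a0 :: "real^3" where a0: "a0 \<noteq> 0" "orthogonal ?e a0"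
      using orthogonal_to_vector_exists[of ?e] by auto
    have "two_spheres_frame c1 c2 r1 r2 ((1 / norm a0) *\<^sub>R a0) ?e"
    proof unfold_locales
      show "(1 / norm a0) *\<^sub>R a0 \<bullet> (1 / norm a0) *\<^sub>R a0 = 1"
        using a0 by (simp add: power2_norm_eq_inner[symmetric] power2_eq_square)
      have "(c2 - c1) \<bullet> (c2 - c1) = l * l" using separation_sq assms(6) by (simp add: power2_eq_square)
      then show "?e \<bullet> ?e = 1" using that by simp
      show "(1 / norm a0) *\<^sub>R a0 \<bullet> ?e = 0" using a0 by (simp add: orthogonal_def inner_commute)
      show "c2 - c1 = dist c1 c2 *\<^sub>R ?e" "0 < dist c1 c2" using that assms(6) by simp_all
    qed
    then show ?thesis by blast
  qed
  have l0: "0 < l" if "r1 - r2 \<le> l"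
  proof (rule ccontr)
    assume "\<not> 0 < l"
    then have "l = 0" using assms(6) zero_le_dist[of c1 c2] by linarith
    then show False using that assms by auto
  qed
  have empty: "X = {}" if "l < r1 - r2" using no_common_tangents that assms(6) X by simp
  have circle: "embedded_circle X" if "l = r1 - r2"
    using frame[OF l0] two_spheres_frame.circle_of_common_tangents that assms(6) X by fastforce
  have torus: "embedded_torus X" if "r1 - r2 < l" "l < r1 + r2"
    using frame[OF l0] two_spheres_frame.crossing_spheres that assms(6) X by fastforce
  have immersed: "immersed_torus X" if "r1 - r2 < l" "l \<le> r1 + r2"
  proof (cases "l = r1 + r2")
    case True
    then show ?thesis using frame[OF l0] two_spheres_frame.touching_spheres that assms(6) X by fastforce
  next
    case False
    then show ?thesis using torus that embedded_torus_imp_immersed_torus by simp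
  qed
  have tori: "disjoint_embedded_tori X" if "r1 + r2 < l"
    using frame[OF l0] two_spheres_frame.separated_spheres that assms(1,6) X by fastforce
  have torus_in: "\<exists>T\<subseteq>X. immersed_torus T" if "r1 - r2 < l"
  proof (cases "l \<le> r1 + r2")
    case False
    then show ?thesis
      using tori embedded_torus_imp_immersed_torus unfolding disjoint_embedded_tori_def by fastforce
  qed (use immersed that in blast)
  have ne: "X \<noteq> {}" if "r1 - r2 \<le> l"
    using torus_in immersed_torus_connected(2) circle embedded_circle_connected(2) that by (cases "l = r1 - r2") force+
  have not_circle: "\<not> embedded_circle X" if "r1 - r2 < l"
    using torus_in[OF that] immersed_torus_not_in_circle by blast
  have conn: "connected X" if "l \<le> r1 + r2"
    using that empty circle embedded_circle_connected(1) immersed immersed_torus_connected(1)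
    by (metis connected_empty linorder_cases)
  have "X = {} \<longleftrightarrow> l < r1 - r2" using empty ne by (meson not_le)
  moreover have "embedded_circle X \<longleftrightarrow> l = r1 - r2"
    using circle not_circle empty embedded_circle_connected(2) by (metis linorder_cases)
  moreover have "immersed_torus X \<longleftrightarrow> r1 - r2 < l \<and> l \<le> r1 + r2"
  proof
    assume T: "immersed_torus X"
    then have "\<not> l < r1 - r2" using empty immersed_torus_connected(2) by blast
    moreover have "l \<noteq> r1 - r2" using circle T immersed_torus_not_in_circle by blast
    moreover have "\<not> r1 + r2 < l"
      using tori disjoint_embedded_tori_not_connected immersed_torus_connected(1) T by blast
    ultimately show "r1 - r2 < l \<and> l \<le> r1 + r2" by linarith
  qed (use immersed in blast)
  moreover have "disjoint_embedded_tori X \<longleftrightarrow> r1 + r2 < l"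
    using tori conn disjoint_embedded_tori_not_connected by (meson not_le)
  moreover have "S1 \<inter> S2 = {} \<and> totally_real_surface X \<and> lorentz_surface (X - bitangent_plane_lines S1 S2)
      \<and> (\<forall>\<gamma> \<in> X \<inter> bitangent_plane_lines S1 S2. \<not> lorentz_at X \<gamma>)" if sep: "r1 + r2 < l"
  proof -
    obtain a e where "two_spheres_frame c1 c2 r1 r2 a e" using frame l0 sep assms(1) by fastforce
    then interpret two_spheres_frame c1 c2 r1 r2 a e .
    have sep': "r1 + r2 < dist c1 c2" using sep assms(6) by simp
    have "S1 \<inter> S2 = {}"
    proof (rule ccontr)
      assume "S1 \<inter> S2 \<noteq> {}"
      then obtain x where "x \<in> S1" "x \<in> S2" by blast
      then have "dist c1 x = r1" "dist c2 x = r2" using assms(3,4) by auto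
      then show False using dist_triangle2[of c1 c2 x] sep' by simp
    qed
    moreover have bit: "\<gamma> \<in> bitangent_plane_lines S1 S2 \<longleftrightarrow> sine \<gamma> = 0" if "\<gamma> \<in> X" for \<gamma>
      using bitangent_iff that X assms(3,4) by simp
    have "X - bitangent_plane_lines S1 S2 = {\<gamma> \<in> common_tangents. sine \<gamma> \<noteq> 0}" using bit X by blast
    moreover have "\<not> lorentz_at X \<gamma>" if "\<gamma> \<in> X \<inter> bitangent_plane_lines S1 S2" for \<gamma>
      using bitangent_not_lorentz[of \<gamma>] separated_spheres_height_nonzero[OF sep'] bit that X by blast
    ultimately show ?thesis
      using totally_real_common_tangents[OF sep'] lorentz_common_tangents[OF sep'] X by simp
  qed
  ultimately show ?thesis using torus by blast
qed

end
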